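(* Let $K\ge1$, let $\rho_S$ be a state of the $n$-qubit system, let $O$ be an observable on the system, and let $\mathcal{N}_K$ be the non-Markovian $K$-collision map determined by the collision Hamiltonians $H_1,\dots,H_K$, the sub-environment states $\rho_{E_1},\dots,\rho_{E_K}$, the collision time $\Delta t$ and the swap probability $p\in[0,1]$, as defined in the context. Let $\varepsilon,\delta\in(0,1)$ and set $\varepsilon'=\varepsilon/(6K\|O\|)$. Then, with probability at least $1-\delta$, the algorithm described in the context (run with precision $\varepsilon'$ and a suitable choice of its LCU segment parameters $r_1,\dots,r_K$) outputs a number $\mu$ such that $$\left|\mu-\mathrm{Tr}\big[O\,\mathcal{N}_K[\rho_S]\big]\right|\le\varepsilon ,$$ using $T$ repetitions (coherent runs) of its circuit, where $$T=\mathcal{O}\left(\frac{\|O\|^2\ln(2/\delta)}{\varepsilon^2}\right),$$ and each coherent run has circuit depth $$\tau_d=\mathcal{O}\left(\beta^2K^2\Delta t^2\,\frac{\log(\beta K\|O\|\Delta t/\varepsilon)}{\log\log(\beta K\|O\|\Delta t/\varepsilon)}+K\tau_{\rho_E}\right),$$ where $\beta=\max_j\beta_j$ and $\tau_{\rho_E}=\max_j\tau_{\rho_{E_j}}$, with $\tau_{\rho_{E_j}}$ the circuit depth of the unitary preparing the sub-environment $E_j$ in the state $\rho_{E_j}$.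
   Context: **Notation.** $\|\cdot\|$ is the spectral norm. $g=\mathcal{O}(f)$ means $g\le k_2f$ for a constant $k_2$ once the parameters exceed a constant. **Collision Hamiltonians.** $S$ is an $n$-qubit system with Hamiltonian $H_S$. For $1\le j\le K$, $E_j$ is a sub-environment (a register of qubits, all $E_j$ of the same dimension) with Hamiltonian $H_{E_j}$ and initial state $\rho_{E_j}$, and $H_{I_j}$ is an interaction Hamiltonian on $S\otimes E_j$. The total Hamiltonian $H_j=H_S+H_{E_j}+H_{I_j}=\sum_{i=1}^{L_j}h_{i,j}P_{i,j}$ has $P_{i,j}$ signed Pauli strings on the qubits of $S\otimes E_j$ and $h_{i,j}>0$. Put $\beta_j=\sum_ih_{i,j}$, $\overline{H}_j=H_j/\beta_j$, and $U_j=e^{-i\beta_j\overline{H}_j\Delta t}$, acting on $S\otimes E_j$. **Non-Markovian $K$-collision map.** For $p\in[0,1]$ let $\mathcal{C}_{j,j+1}$ be the partial swap channel on $E_j\otimes E_{j+1}$, $\mathcal{C}_{j,j+1}[X]=(1-p)X+p\,S_{j,j+1}XS_{j,j+1}^\dagger$, with $S_{j,j+1}$ the swap of $E_j$ and $E_{j+1}$; let $\mathcal{V}_{j,j+1}=\mathrm{id}_S\otimes\mathcal{C}_{j,j+1}$ and $U_{S_j}=U_j\otimes I$ (identity on the other sub-environment register). For $1\le j\le K-1$ the map $\Phi_j^{\mathcal N}$ sends a state $\sigma$ of $S\otimes E_j$ to the state of $S\otimes E_{j+1}$ given by $$\Phi_j^{\mathcal N}[\sigma]=\mathrm{Tr}_{E_j}\Big[\mathcal{V}_{j,j+1}\big[U_{S_j}(\sigma\otimes\rho_{E_{j+1}})U_{S_j}^\dagger\big]\Big].$$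 (Physically two environment registers are used alternately: for odd $j$ the first holds $E_j$ and the second $E_{j+1}$; for even $j$ the roles are exchanged.) The non-Markovian $K$-collision map is $$\mathcal{N}_K[\rho_S]=\mathrm{Tr}_{E_K}\Big[U_{S_K}\big(\Phi_{K-1}^{\mathcal N}\circ\cdots\circ\Phi_1^{\mathcal N}[\rho_S\otimes\rho_{E_1}]\big)U_{S_K}^\dagger\Big].$$ **LCU decomposition used by the algorithm.** Let $\overline{H}=\sum_{\ell=1}^Lp_\ell P_\ell$ be a convex combination of signed Pauli strings, $\tau>0$, and $r$ a positive integer with $\tau/r<1$. Truncating the Taylor series of $e^{-i\tau\overline{H}/r}$ and pairing consecutive orders gives $$\widetilde S_r=\sum_{\substack{0\le k\le q\\ k\text{ even}}}\ \sum_{\ell_1,\dots,\ell_k,m=1}^{L}\frac{(\tau/r)^k}{k!}\sqrt{1+\Big(\tfrac{\tau/r}{k+1}\Big)^2}\;p_{\ell_1}\cdots p_{\ell_k}p_m\;\,(-i)^kP_{\ell_1}\cdots P_{\ell_k}e^{-i\theta_kP_m},$$ with $\theta_k=\arccos\big([1+(\tfrac{\tau/r}{k+1})^2]^{-1/2}\big)$. Expanding $\widetilde U=\widetilde S_r^{\,r}=\sum_i\alpha_iW_i$ expresses $\widetilde U$ with positive coefficients in terms of unitaries $W_i$, each a product of $r$ blocks consisting of at most $q$ Pauli strings and one Pauli rotation. The truncation order is $q=\mathcal{O}\big(\log(r/\varepsilon')/\log\log(r/\varepsilon')\big)$, chosen so that $\|\widetilde U-e^{-i\tau\overline{H}}\|\le\varepsilon'$;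 moreover $\sum_i|\alpha_i|\le e^{\tau^2/r}$. For each $j$ this is applied with $\overline{H}=\overline{H}_j$, $\tau=\beta_j\Delta t$ and segment parameter $r=r_j$ (free parameter), giving $\widetilde U_j=\sum_k\alpha_{jk}W_{jk}$ with $\|\widetilde U_j-U_j\|\le\varepsilon'$. Put $\alpha^{(j)}=\sum_k|\alpha_{jk}|$ and $\zeta=\prod_{j=1}^K\alpha^{(j)}$. **Algorithm.** One coherent run: (1) initialize the system in $\rho_S$, the first environment register in $\rho_{E_1}$, and a single ancilla qubit in $|+\rangle$. (2) For $j=1,\dots,K-1$: (a) draw two i.i.d. samples $X_j,Y_j$ from the distribution in which $W_{jk}$ has probability $\alpha_{jk}/\alpha^{(j)}$; (b) apply $X_j^{(c)}=|0\rangle\langle0|\otimes I+|1\rangle\langle1|\otimes X_j$ and then $Y_j^{(a)}=|0\rangle\langle0|\otimes Y_j+|1\rangle\langle1|\otimes I$, controlled on the ancilla and acting on the system and the first (second) environment register if $j$ is odd (even); (c) initialize the second (first) environment register in $\rho_{E_{j+1}}$ if $j$ is odd (even); (d) with probability $p$ apply the swap gate between the two environment registers, otherwise do nothing; (e) trace out the first (second) environment register if $j$ is odd (even). (3) Draw two i.i.d. samples $X_K,Y_K$ in the same way from the distribution for $j=K$, and apply $X_K^{(c)}$ and $Y_K^{(a)}$ to the system and the first (second) environment register if $K$ is odd (even); then trace out that environment register. (4) Measure $\sigma^x\otimes O$ on ancilla and system and record the outcome. The run is repeated independently $T$ times with outcomes $\mu_1,\dots,\mu_T$, and the output is $\mu=\frac{\zeta^2}{T}\sum_{i=1}^T\mu_i$.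 **Circuit depth convention.** Each controlled (or anti-controlled) Pauli string, each controlled Pauli rotation, and each swap between two environment registers (assumed to be implemented perfectly) counts as $\mathcal{O}(1)$; the depths of preparing the states $\rho_{E_j}$ are added. *)

theory Defs
  imports
    "HOL-Probability.Probability"
    "Jordan_Normal_Form.Schur_Decomposition"
begin

section \<open>Finite-dimensional linear algebra\<close>

(* Dimensions are natural numbers here, not types, because the constants hidden in the
   asymptotic bounds must not depend on the numbers of qubits. *)

definition mat_trace :: "complex mat \<Rightarrow> complex" where
  "mat_trace A = (\<Sum>i<dim_row A. A $$ (i, i))"

definition hermitian_mat :: "nat \<Rightarrow> complex mat \<Rightarrow> bool" where
  "hermitian_mat d A \<longleftrightarrow> A \<in> carrier_mat d d \<and> mat_adjoint A = A"

definition density_mat :: "nat \<Rightarrow> complex mat \<Rightarrow> bool" where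
  "density_mat d A \<longleftrightarrow> hermitian_mat d A \<and>
     (\<forall>v \<in> carrier_vec d. 0 \<le> Re ((A *\<^sub>v v) \<bullet>c v)) \<and> mat_trace A = 1"

definition l2_norm :: "complex Matrix.vec \<Rightarrow> real" where
  "l2_norm v = sqrt (\<Sum>i<dim_vec v. (cmod (vec_index v i))\<^sup>2)"

definition spectral_norm :: "complex mat \<Rightarrow> real" where
  "spectral_norm A = (SUP v \<in> {v \<in> carrier_vec (dim_col A). l2_norm v = 1}. l2_norm (A *\<^sub>v v))"

definition mat_exp :: "complex mat \<Rightarrow> complex mat" where
  "mat_exp A = Matrix.mat (dim_row A) (dim_row A)
     (\<lambda>(i, j). \<Sum>k. (A ^\<^sub>m k) $$ (i, j) / fact k)"

definition mat_sum :: "nat \<Rightarrow> ('i \<Rightarrow> complex mat) \<Rightarrow> 'i set \<Rightarrow> complex mat" where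
  "mat_sum d F I = Matrix.mat d d (\<lambda>(i, j). \<Sum>x\<in>I. F x $$ (i, j))"

text \<open>In a tensor product of two or three factors the leftmost factor is the most significant
  digit of the row and column indices.\<close>

definition kron :: "complex mat \<Rightarrow> complex mat \<Rightarrow> complex mat" (infixr "\<otimes>\<^sub>k" 72) where
  "A \<otimes>\<^sub>k B = Matrix.mat (dim_row A * dim_row B) (dim_col A * dim_col B)
     (\<lambda>(i, j). A $$ (i div dim_row B, j div dim_col B) * B $$ (i mod dim_row B, j mod dim_col B))"

text \<open>Partial trace over the second factor of a space of dimension \<open>a * b\<close>, and over the middle
  factor of a space of dimension \<open>a * b * c\<close>.\<close>

definition ptrace_last :: "nat \<Rightarrow> nat \<Rightarrow> complex mat \<Rightarrow> complex mat" where
  "ptrace_last a b X = Matrix.mat a a (\<lambda>(i, j). \<Sum>k<b. X $$ (i * b + k, j * b + k))"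

definition ptrace_mid :: "nat \<Rightarrow> nat \<Rightarrow> nat \<Rightarrow> complex mat \<Rightarrow> complex mat" where
  "ptrace_mid a b c X = Matrix.mat (a * c) (a * c) (\<lambda>(i, j).
     \<Sum>k<b. X $$ (((i div c) * b + k) * c + i mod c, ((j div c) * b + k) * c + j mod c))"

definition swap_mat :: "nat \<Rightarrow> complex mat" where
  "swap_mat d = Matrix.mat (d * d) (d * d) (\<lambda>(i, j). if i = (j mod d) * d + j div d then 1 else 0)"

definition conj_by :: "complex mat \<Rightarrow> complex mat \<Rightarrow> complex mat" where
  "conj_by V X = V * X * mat_adjoint V"


section \<open>Pauli strings\<close>

datatype pauli = Pauli_I | Pauli_X | Pauli_Y | Pauli_Z

fun pauli_mat :: "pauli \<Rightarrow> complex mat" where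
  "pauli_mat Pauli_I = 1\<^sub>m 2"
| "pauli_mat Pauli_X = mat_of_rows_list 2 [[0, 1], [1, 0]]"
| "pauli_mat Pauli_Y = mat_of_rows_list 2 [[0, - \<i>], [\<i>, 0]]"
| "pauli_mat Pauli_Z = mat_of_rows_list 2 [[1, 0], [0, - 1]]"

type_synonym signed_pauli = "bool \<times> pauli list"

(* The flag of a signed Pauli string says whether its sign is negative. *)
fun signed_pauli_mat :: "signed_pauli \<Rightarrow> complex mat" where
  "signed_pauli_mat (neg, ps) =
     (if neg then - 1 else 1) \<cdot>\<^sub>m foldr (\<otimes>\<^sub>k) (map pauli_mat ps) (1\<^sub>m 1)"


section \<open>The non-Markovian collision model\<close>

text \<open>The sub-environments are numbered from 1. The list \<open>pauli_terms M j\<close> contains the pairs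
  $(h_{i,j}, P_{i,j})$, and \<open>prep_depth M j\<close> is the depth of the circuit that prepares
  \<open>env_state M j\<close>.\<close>

record collision_model =
  sys_qubits :: nat
  env_qubits :: nat
  sys_ham :: "complex mat"
  env_ham :: "nat \<Rightarrow> complex mat"
  int_ham :: "nat \<Rightarrow> complex mat"
  pauli_terms :: "nat \<Rightarrow> (real \<times> signed_pauli) list"
  env_state :: "nat \<Rightarrow> complex mat"
  prep_depth :: "nat \<Rightarrow> nat"
  coll_time :: real
  swap_prob :: real

definition sys_dim :: "collision_model \<Rightarrow> nat" where
  "sys_dim M = 2 ^ sys_qubits M"

definition env_dim :: "collision_model \<Rightarrow> nat" where
  "env_dim M = 2 ^ env_qubits M"

definition total_dim :: "collision_model \<Rightarrow> nat" where
  "total_dim M = sys_dim M * env_dim M"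

definition total_ham :: "collision_model \<Rightarrow> nat \<Rightarrow> complex mat" where
  "total_ham M j = sys_ham M \<otimes>\<^sub>k 1\<^sub>m (env_dim M) + 1\<^sub>m (sys_dim M) \<otimes>\<^sub>k env_ham M j + int_ham M j"

definition pauli_sum :: "collision_model \<Rightarrow> nat \<Rightarrow> complex mat" where
  "pauli_sum M j = mat_sum (total_dim M)
     (\<lambda>i. complex_of_real (fst (pauli_terms M j ! i)) \<cdot>\<^sub>m signed_pauli_mat (snd (pauli_terms M j ! i)))
     {..<length (pauli_terms M j)}"

definition collision_model_wf :: "nat \<Rightarrow> collision_model \<Rightarrow> bool" where
  "collision_model_wf K M \<longleftrightarrow>
     hermitian_mat (sys_dim M) (sys_ham M) \<and>
     (\<forall>j \<in> {1..K}.
        hermitian_mat (env_dim M) (env_ham M j) \<and>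
        hermitian_mat (total_dim M) (int_ham M j) \<and>
        pauli_terms M j \<noteq> [] \<and>
        (\<forall>(h, neg, ps) \<in> set (pauli_terms M j).
           0 < h \<and> length ps = sys_qubits M + env_qubits M) \<and>
        total_ham M j = pauli_sum M j \<and>
        density_mat (env_dim M) (env_state M j)) \<and>
     0 < coll_time M \<and> 0 \<le> swap_prob M \<and> swap_prob M \<le> 1"

definition coll_beta :: "collision_model \<Rightarrow> nat \<Rightarrow> real" where
  "coll_beta M j = sum_list (map fst (pauli_terms M j))"

definition normalized_ham :: "collision_model \<Rightarrow> nat \<Rightarrow> complex mat" where
  "normalized_ham M j = complex_of_real (1 / coll_beta M j) \<cdot>\<^sub>m total_ham M j"

definition coll_tau :: "collision_model \<Rightarrow> nat \<Rightarrow> real" where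
  "coll_tau M j = coll_beta M j * coll_time M"

definition coll_unitary :: "collision_model \<Rightarrow> nat \<Rightarrow> complex mat" where
  "coll_unitary M j = mat_exp ((- \<i> * complex_of_real (coll_tau M j)) \<cdot>\<^sub>m normalized_ham M j)"

text \<open>\<open>partial_swap\<close> is the channel $\mathrm{id} \otimes \mathcal{C}$ on a space of dimension
  \<open>a * e * e\<close>, where $\mathcal{C}$ swaps the last two factors with probability \<open>p\<close>.\<close>

definition partial_swap :: "nat \<Rightarrow> nat \<Rightarrow> real \<Rightarrow> complex mat \<Rightarrow> complex mat" where
  "partial_swap a e p X = complex_of_real (1 - p) \<cdot>\<^sub>m X +
     complex_of_real p \<cdot>\<^sub>m conj_by (1\<^sub>m a \<otimes>\<^sub>k swap_mat e) X"

definition nm_step :: "collision_model \<Rightarrow> nat \<Rightarrow> complex mat \<Rightarrow> complex mat" where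
  "nm_step M j \<sigma> = ptrace_mid (sys_dim M) (env_dim M) (env_dim M)
     (partial_swap (sys_dim M) (env_dim M) (swap_prob M)
       (conj_by (coll_unitary M j \<otimes>\<^sub>k 1\<^sub>m (env_dim M)) (\<sigma> \<otimes>\<^sub>k env_state M (Suc j))))"

primrec nm_state :: "collision_model \<Rightarrow> complex mat \<Rightarrow> nat \<Rightarrow> complex mat" where
  "nm_state M \<rho> 0 = \<rho> \<otimes>\<^sub>k env_state M 1"
| "nm_state M \<rho> (Suc j) = nm_step M (Suc j) (nm_state M \<rho> j)"

definition nm_collision_map :: "collision_model \<Rightarrow> nat \<Rightarrow> complex mat \<Rightarrow> complex mat" where
  "nm_collision_map M K \<rho> = ptrace_last (sys_dim M) (env_dim M)
     (conj_by (coll_unitary M K) (nm_state M \<rho> (K - 1)))"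


section \<open>The linear combination of unitaries\<close>

text \<open>A block $((\ell_1, \dots, \ell_k), m)$ indexes one summand of the truncated series of a single
  segment, with indices into the list \<open>ts\<close> of pairs $(p_\ell, P_\ell)$ starting at 0; an index of
  the expansion of its \<open>r\<close>-th power is a list of \<open>r\<close> blocks.\<close>

type_synonym lcu_block = "nat list \<times> nat"

definition lcu_blocks :: "nat \<Rightarrow> nat \<Rightarrow> lcu_block set" where
  "lcu_blocks L q = {(ls, m). length ls \<le> q \<and> even (length ls) \<and> set ls \<subseteq> {..<L} \<and> m < L}"

definition lcu_ratio :: "real \<Rightarrow> nat \<Rightarrow> nat \<Rightarrow> real" where
  "lcu_ratio \<tau> r k = (\<tau> / real r) / real (k + 1)"

definition lcu_angle :: "real \<Rightarrow> nat \<Rightarrow> nat \<Rightarrow> real" where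
  "lcu_angle \<tau> r k = arccos (1 / sqrt (1 + (lcu_ratio \<tau> r k)\<^sup>2))"

fun block_coeff :: "(real \<times> complex mat) list \<Rightarrow> real \<Rightarrow> nat \<Rightarrow> lcu_block \<Rightarrow> real" where
  "block_coeff ts \<tau> r (ls, m) =
     (\<tau> / real r) ^ length ls / fact (length ls) * sqrt (1 + (lcu_ratio \<tau> r (length ls))\<^sup>2) *
     prod_list (map (\<lambda>l. fst (ts ! l)) ls) * fst (ts ! m)"

fun block_unitary :: "nat \<Rightarrow> (real \<times> complex mat) list \<Rightarrow> real \<Rightarrow> nat \<Rightarrow> lcu_block \<Rightarrow> complex mat" where
  "block_unitary d ts \<tau> r (ls, m) =
     (- \<i>) ^ length ls \<cdot>\<^sub>m (foldr (*) (map (\<lambda>l. snd (ts ! l)) ls) (1\<^sub>m d) *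
       mat_exp ((- \<i> * complex_of_real (lcu_angle \<tau> r (length ls))) \<cdot>\<^sub>m snd (ts ! m)))"

definition lcu_segment :: "nat \<Rightarrow> (real \<times> complex mat) list \<Rightarrow> real \<Rightarrow> nat \<Rightarrow> nat \<Rightarrow> complex mat" where
  "lcu_segment d ts \<tau> r q = mat_sum d
     (\<lambda>b. complex_of_real (block_coeff ts \<tau> r b) \<cdot>\<^sub>m block_unitary d ts \<tau> r b)
     (lcu_blocks (length ts) q)"

definition lcu_approx :: "nat \<Rightarrow> (real \<times> complex mat) list \<Rightarrow> real \<Rightarrow> nat \<Rightarrow> nat \<Rightarrow> complex mat" where
  "lcu_approx d ts \<tau> r q = lcu_segment d ts \<tau> r q ^\<^sub>m r"

definition lcu_indices :: "nat \<Rightarrow> nat \<Rightarrow> nat \<Rightarrow> lcu_block list set" where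
  "lcu_indices L r q = {bs. length bs = r \<and> set bs \<subseteq> lcu_blocks L q}"

definition lcu_coeff :: "(real \<times> complex mat) list \<Rightarrow> real \<Rightarrow> nat \<Rightarrow> lcu_block list \<Rightarrow> real" where
  "lcu_coeff ts \<tau> r bs = prod_list (map (block_coeff ts \<tau> r) bs)"

definition lcu_unitary :: "nat \<Rightarrow> (real \<times> complex mat) list \<Rightarrow> real \<Rightarrow> nat \<Rightarrow> lcu_block list \<Rightarrow> complex mat" where
  "lcu_unitary d ts \<tau> r bs = foldr (*) (map (block_unitary d ts \<tau> r) bs) (1\<^sub>m d)"

definition lcu_weight :: "(real \<times> complex mat) list \<Rightarrow> real \<Rightarrow> nat \<Rightarrow> nat \<Rightarrow> real" where
  "lcu_weight ts \<tau> r q = (\<Sum>bs \<in> lcu_indices (length ts) r q. \<bar>lcu_coeff ts \<tau> r bs\<bar>)"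

definition lcu_pmf :: "(real \<times> complex mat) list \<Rightarrow> real \<Rightarrow> nat \<Rightarrow> nat \<Rightarrow> lcu_block list pmf" where
  "lcu_pmf ts \<tau> r q = embed_pmf (\<lambda>bs.
     if bs \<in> lcu_indices (length ts) r q then lcu_coeff ts \<tau> r bs / lcu_weight ts \<tau> r q else 0)"

text \<open>Each block costs one controlled gate per Pauli string and one for the Pauli rotation; the
  phase $(-i)^k$ and the signs are not counted.\<close>

definition lcu_depth :: "lcu_block list \<Rightarrow> nat" where
  "lcu_depth bs = sum_list (map (\<lambda>(ls, m). length ls + 1) bs)"


section \<open>The algorithm\<close>

definition normalized_terms :: "collision_model \<Rightarrow> nat \<Rightarrow> (real \<times> complex mat) list" where
  "normalized_terms M j =
     map (\<lambda>(h, P). (h / coll_beta M j, signed_pauli_mat P)) (pauli_terms M j)"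

definition coll_approx :: "collision_model \<Rightarrow> nat \<Rightarrow> nat \<Rightarrow> nat \<Rightarrow> complex mat" where
  "coll_approx M j r q = lcu_approx (total_dim M) (normalized_terms M j) (coll_tau M j) r q"

definition coll_sample :: "collision_model \<Rightarrow> nat \<Rightarrow> nat \<Rightarrow> nat \<Rightarrow> lcu_block list pmf" where
  "coll_sample M j r q = lcu_pmf (normalized_terms M j) (coll_tau M j) r q"

definition coll_gate :: "collision_model \<Rightarrow> nat \<Rightarrow> nat \<Rightarrow> lcu_block list \<Rightarrow> complex mat" where
  "coll_gate M j r bs = lcu_unitary (total_dim M) (normalized_terms M j) (coll_tau M j) r bs"

definition coll_weight :: "collision_model \<Rightarrow> nat \<Rightarrow> nat \<Rightarrow> nat \<Rightarrow> real" where
  "coll_weight M j r q = lcu_weight (normalized_terms M j) (coll_tau M j) r q"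

definition lcu_zeta :: "collision_model \<Rightarrow> nat \<Rightarrow> (nat \<Rightarrow> nat) \<Rightarrow> (nat \<Rightarrow> nat) \<Rightarrow> real" where
  "lcu_zeta M K r q = (\<Prod>j = 1..K. coll_weight M j (r j) (q j))"

definition lcu_valid :: "collision_model \<Rightarrow> nat \<Rightarrow> nat \<Rightarrow> nat \<Rightarrow> real \<Rightarrow> bool" where
  "lcu_valid M j r q \<epsilon>' \<longleftrightarrow>
     0 < r \<and> coll_tau M j / real r < 1 \<and>
     spectral_norm (coll_approx M j r q - coll_unitary M j) \<le> \<epsilon>'"

definition proj0 :: "complex mat" where
  "proj0 = mat_of_rows_list 2 [[1, 0], [0, 0]]"

definition proj1 :: "complex mat" where
  "proj1 = mat_of_rows_list 2 [[0, 0], [0, 1]]"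

definition plus_state :: "complex mat" where
  "plus_state = mat_of_rows_list 2 [[1 / 2, 1 / 2], [1 / 2, 1 / 2]]"

definition controlled :: "nat \<Rightarrow> complex mat \<Rightarrow> complex mat" where
  "controlled d X = proj0 \<otimes>\<^sub>k 1\<^sub>m d + proj1 \<otimes>\<^sub>k X"

definition anti_controlled :: "nat \<Rightarrow> complex mat \<Rightarrow> complex mat" where
  "anti_controlled d Y = proj0 \<otimes>\<^sub>k Y + proj1 \<otimes>\<^sub>k 1\<^sub>m d"

definition interact :: "collision_model \<Rightarrow> nat \<Rightarrow> nat \<Rightarrow> lcu_block list \<Rightarrow> lcu_block list
    \<Rightarrow> complex mat \<Rightarrow> complex mat" where
  "interact M j r X Y \<sigma> =
     conj_by (anti_controlled (total_dim M) (coll_gate M j r Y))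
       (conj_by (controlled (total_dim M) (coll_gate M j r X)) \<sigma>)"

text \<open>Between collisions the joint state lives on ancilla, system and the environment register in
  use. The other register is appended on the right when it is initialized; after the first one
  has been traced out it becomes the register in use, which realizes the alternation between the
  two registers.\<close>

definition refresh :: "collision_model \<Rightarrow> nat \<Rightarrow> bool \<Rightarrow> complex mat \<Rightarrow> complex mat" where
  "refresh M j b \<sigma> =
     (let \<sigma>' = \<sigma> \<otimes>\<^sub>k env_state M (Suc j);
          \<sigma>'' = (if b then conj_by (1\<^sub>m (2 * sys_dim M) \<otimes>\<^sub>k swap_mat (env_dim M)) \<sigma>' else \<sigma>')
      in ptrace_mid (2 * sys_dim M) (env_dim M) (env_dim M) \<sigma>'')"

text \<open>\<open>run_state M \<rho> r q j\<close> is the joint distribution of the quantum state before collision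
  \<open>j + 1\<close> and of the circuit depth spent so far. Swaps count 1; the preparation of \<open>\<rho>\<close> and of
  the ancilla and the final measurement are not counted.\<close>

primrec run_state :: "collision_model \<Rightarrow> complex mat \<Rightarrow> (nat \<Rightarrow> nat) \<Rightarrow> (nat \<Rightarrow> nat) \<Rightarrow> nat
    \<Rightarrow> (complex mat \<times> nat) pmf" where
  "run_state M \<rho> r q 0 = return_pmf (plus_state \<otimes>\<^sub>k \<rho> \<otimes>\<^sub>k env_state M 1, prep_depth M 1)"
| "run_state M \<rho> r q (Suc j) = do {
     (\<sigma>, dep) \<leftarrow> run_state M \<rho> r q j;
     X \<leftarrow> coll_sample M (Suc j) (r (Suc j)) (q (Suc j));
     Y \<leftarrow> coll_sample M (Suc j) (r (Suc j)) (q (Suc j));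
     b \<leftarrow> bernoulli_pmf (swap_prob M);
     return_pmf (refresh M (Suc j) b (interact M (Suc j) (r (Suc j)) X Y \<sigma>),
       dep + lcu_depth X + lcu_depth Y + prep_depth M (Suc (Suc j)) + (if b then 1 else 0))
   }"

text \<open>The projector onto the eigenspace of \<open>A\<close> for \<open>x\<close> (zero if \<open>x\<close> is not an eigenvalue), and
  the distribution of the outcome when the observable \<open>A\<close> is measured in the state \<open>\<sigma>\<close>.\<close>

definition eigen_projector :: "nat \<Rightarrow> complex mat \<Rightarrow> real \<Rightarrow> complex mat" where
  "eigen_projector d A x = (THE P. hermitian_mat d P \<and> P * P = P \<and>
     (\<forall>v \<in> carrier_vec d. P *\<^sub>v v = v \<longleftrightarrow> A *\<^sub>v v = complex_of_real x \<cdot>\<^sub>v v))"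

definition outcome_pmf :: "nat \<Rightarrow> complex mat \<Rightarrow> complex mat \<Rightarrow> real pmf" where
  "outcome_pmf d A \<sigma> = embed_pmf (\<lambda>x. Re (mat_trace (eigen_projector d A x * \<sigma>)))"

text \<open>One coherent run: measurement outcome and circuit depth.\<close>

definition coherent_run :: "collision_model \<Rightarrow> nat \<Rightarrow> complex mat \<Rightarrow> complex mat
    \<Rightarrow> (nat \<Rightarrow> nat) \<Rightarrow> (nat \<Rightarrow> nat) \<Rightarrow> (real \<times> nat) pmf" where
  "coherent_run M K \<rho> A r q = do {
     (\<sigma>, dep) \<leftarrow> run_state M \<rho> r q (K - 1);
     X \<leftarrow> coll_sample M K (r K) (q K);
     Y \<leftarrow> coll_sample M K (r K) (q K);
     \<mu> \<leftarrow> outcome_pmf (2 * sys_dim M) (pauli_mat Pauli_X \<otimes>\<^sub>k A)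
            (ptrace_last (2 * sys_dim M) (env_dim M) (interact M K (r K) X Y \<sigma>));
     return_pmf (\<mu>, dep + lcu_depth X + lcu_depth Y)
   }"

definition estimator_pmf :: "collision_model \<Rightarrow> nat \<Rightarrow> complex mat \<Rightarrow> complex mat
    \<Rightarrow> (nat \<Rightarrow> nat) \<Rightarrow> (nat \<Rightarrow> nat) \<Rightarrow> nat \<Rightarrow> real pmf" where
  "estimator_pmf M K \<rho> A r q T =
     map_pmf (\<lambda>runs. (lcu_zeta M K r q)\<^sup>2 / real T * sum_list (map fst runs))
       (replicate_pmf T (coherent_run M K \<rho> A r q))"

definition max_beta :: "collision_model \<Rightarrow> nat \<Rightarrow> real" where
  "max_beta M K = Max (coll_beta M ` {1..K})"

definition max_prep_depth :: "collision_model \<Rightarrow> nat \<Rightarrow> nat" where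
  "max_prep_depth M K = Max (prep_depth M ` {1..K})"

end

(* The ancilla turns the pair of samples (X, Y) into the map sigma |-> X sigma Y^dagger on an
   off-diagonal block of the joint state. As X and Y are independent, the mean of that block
   evolves exactly as in the collision model with every U_j replaced by the truncated LCU
   operator, up to the factor prod_j alpha_j^-2, so zeta^2 times the outcome is an unbiased
   estimator of the perturbed expectation value. The bias is at most
   |O| ((1 + eps')^(2K) - 1) because all remaining operations contract the trace norm, and
   Hoeffding's inequality bounds the fluctuations. If |O| <= eps/3 this bias bound is useless
   (eps' is then large), but the claim is trivial since all outcomes are at most 2 |O|.

   With t = beta dt all r_j are chosen as r ~ 4 K t^2 + t, so that zeta^2 <= 2. The truncation
   order is the least even q with 2 (t^2 / r) <= eps' (q + 2)!. The factor t^2 / r <= 1 / (4 K)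
   is what allows q to be bounded in terms of Z as well as in terms of r / eps', although
   r / eps' is not polynomially bounded in Z. *)

theory Submission
  imports
    Defs
    "Jordan_Normal_Form.Spectral_Radius"
    "HOL-Probability.Hoeffding"
    "HOL-Real_Asymp.Real_Asymp"
begin

section \<open>Norms and adjoints\<close>

text \<open>The constants must be uniform in the number of qubits, so matrices of all sizes live in
  one type. That type is no normed space, hence means of random matrices are not taken directly.
  They are read off through an arbitrary linear functional \<phi>. Averaging over one collision
  turns \<phi> into \<phi> composed with the averaged collision, so the induction over collisions
  transforms \<phi>, as in the Heisenberg picture, and all expectations stay scalar and finite.
  Whatever depends on a single Hermitian matrix (the exponential, the truncated series, the
  measurement) is diagonalised and becomes a question about a scalar function of the eigenvalues.
  The exact dynamics and the mean of the sampled dynamics are instances of one recursion with a free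
  family of operators, so that the bias is a pure perturbation estimate for that family. The
  truncation order is defined as a minimum because a single number has to satisfy two bounds with
  different arguments: it lies below every admissible witness, and each bound supplies its
  own.\<close>

lemma mat_adjoint_dim [simp]:
  "dim_row (mat_adjoint A) = dim_col A" "dim_col (mat_adjoint A) = dim_row A"
  unfolding mat_adjoint_def by auto

lemma mat_adjoint_carrier [simp]: "mat_adjoint A \<in> carrier_mat m n \<longleftrightarrow> A \<in> carrier_mat n m"
  by (metis carrier_matD carrier_matI mat_adjoint_dim)

lemma mat_adjoint_index [simp]:
  "i < dim_col A \<Longrightarrow> j < dim_row A \<Longrightarrow> mat_adjoint A $$ (i, j) = cnj (A $$ (j, i))"
  for A :: "complex mat"
  unfolding mat_adjoint_def by (simp add: mat_of_rows_index)

lemma mat_adjoint_adjoint [simp]: "mat_adjoint (mat_adjoint A) = A" for A :: "complex mat"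
  by (rule eq_matI) auto

lemma mult_mat_index:
  "i < dim_row A \<Longrightarrow> j < dim_col B \<Longrightarrow> dim_col A = dim_row B \<Longrightarrow>
    (A * B) $$ (i, j) = (\<Sum>k<dim_row B. A $$ (i, k) * B $$ (k, j))"
  by (auto simp: scalar_prod_def atLeast0LessThan intro!: sum.cong)

lemma mult_vec_index:
  "i < dim_row A \<Longrightarrow> dim_col A = dim_vec v \<Longrightarrow>
    vec_index (A *\<^sub>v v) i = (\<Sum>k<dim_vec v. A $$ (i, k) * vec_index v k)"
  by (auto simp: scalar_prod_def atLeast0LessThan intro!: sum.cong)

lemma cscalar_prod_sum:
  "dim_vec v = dim_vec w \<Longrightarrow> v \<bullet>c w = (\<Sum>k<dim_vec w. vec_index v k * cnj (vec_index w k))"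
  for v w :: "complex Matrix.vec"
  by (auto simp: scalar_prod_def atLeast0LessThan intro!: sum.cong)

lemma mat_adjoint_mult:
  "dim_col A = dim_row B \<Longrightarrow> mat_adjoint (A * B) = mat_adjoint B * mat_adjoint A" for A :: "complex mat"
  by (rule eq_matI) (auto simp: mult_mat_index simp del: index_mult_mat(1) intro!: sum.cong)

lemma mat_adjoint_one [simp]: "mat_adjoint (1\<^sub>m n) = (1\<^sub>m n :: complex mat)"
  by (rule eq_matI) auto

lemma mat_adjoint_smult: "mat_adjoint (c \<cdot>\<^sub>m A) = cnj c \<cdot>\<^sub>m mat_adjoint A"
  by (rule eq_matI) auto

lemma mat_adjoint_minus:
  "dim_row A = dim_row B \<Longrightarrow> dim_col A = dim_col B \<Longrightarrow>
    mat_adjoint (A - B) = mat_adjoint A - mat_adjoint B" for A :: "complex mat"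
  by (rule eq_matI) auto

text \<open>Bridge to \<open>L2_set\<close>, from which the triangle inequality, Cauchy-Schwarz and
  the comparison with plain sums are taken.\<close>

lemma l2_norm_L2_set: "l2_norm v = L2_set (\<lambda>i. cmod (vec_index v i)) {..<dim_vec v}"
  by (simp add: l2_norm_def L2_set_def)

lemma l2_norm_ge_0 [simp]: "0 \<le> l2_norm v"
  by (simp add: l2_norm_L2_set)

lemma l2_norm_sq: "(l2_norm v)\<^sup>2 = (\<Sum>i<dim_vec v. (cmod (vec_index v i))\<^sup>2)"
  by (simp add: l2_norm_def sum_nonneg)

lemma l2_norm_sq_complex:
  "complex_of_real ((l2_norm v)\<^sup>2) = (\<Sum>i<dim_vec v. vec_index v i * cnj (vec_index v i))"
  unfolding l2_norm_sq by (simp only: of_real_sum complex_norm_square)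

lemma l2_norm_smult: "l2_norm (c \<cdot>\<^sub>v v) = cmod c * l2_norm v"
  unfolding l2_norm_def by (simp add: norm_mult power_mult_distrib real_sqrt_mult flip: sum_distrib_left)

lemma l2_norm_triangle:
  assumes "dim_vec v = dim_vec w"
  shows "l2_norm (v + w) \<le> l2_norm v + l2_norm w"
proof -
  have "l2_norm (v + w) \<le> L2_set (\<lambda>i. cmod (vec_index v i) + cmod (vec_index w i)) {..<dim_vec w}"
    unfolding l2_norm_L2_set by (simp, rule L2_set_mono) (auto intro: norm_triangle_ineq)
  also have "\<dots> \<le> l2_norm v + l2_norm w"
    unfolding l2_norm_L2_set using assms by (simp add: L2_set_triangle_ineq)
  finally show ?thesis .
qed

lemma l2_norm_zero [simp]: "l2_norm (0\<^sub>v n) = 0"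
  by (simp add: l2_norm_def)

lemma l2_norm_eq_0: "v \<in> carrier_vec n \<Longrightarrow> l2_norm v = 0 \<Longrightarrow> v = 0\<^sub>v n"
  by (rule eq_vecI) (auto simp: l2_norm_L2_set L2_set_eq_0_iff)

lemma cscalar_prod_cauchy_schwarz:
  assumes "dim_vec v = dim_vec w"
  shows "cmod (\<Sum>i<dim_vec w. vec_index v i * cnj (vec_index w i)) \<le> l2_norm v * l2_norm w"
proof -
  have "cmod (\<Sum>i<dim_vec w. vec_index v i * cnj (vec_index w i))
      \<le> (\<Sum>i<dim_vec w. \<bar>cmod (vec_index v i)\<bar> * \<bar>cmod (vec_index w i)\<bar>)"
    by (rule order_trans[OF norm_sum]) (simp add: norm_mult)
  also have "\<dots> \<le> l2_norm v * l2_norm w"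
    unfolding l2_norm_L2_set assms by (rule L2_set_mult_ineq)
  finally show ?thesis .
qed

text \<open>A crude bound by the sum of all entries. Its purpose is to show that the supremum in
  \<open>spectral_norm\<close> ranges over a bounded set.\<close>

lemma l2_norm_mult_vec_le_sum:
  assumes A: "A \<in> carrier_mat d e" and v: "v \<in> carrier_vec e"
  shows "l2_norm (A *\<^sub>v v) \<le> (\<Sum>i<d. \<Sum>j<e. cmod (A $$ (i, j))) * l2_norm v"
proof -
  have comp: "cmod (vec_index v j) \<le> l2_norm v" if "j < e" for j
    using v that member_le_L2_set[of "{..<e}" j "\<lambda>i. cmod (vec_index v i)"] by (simp add: l2_norm_L2_set)
  have "l2_norm (A *\<^sub>v v) \<le> (\<Sum>i<d. \<bar>cmod (vec_index (A *\<^sub>v v) i)\<bar>)"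
    unfolding l2_norm_L2_set using A by (simp del: index_mult_mat_vec, intro L2_set_le_sum) auto
  also have "\<dots> \<le> (\<Sum>i<d. \<Sum>j<e. cmod (A $$ (i, j)) * l2_norm v)"
  proof (rule sum_mono)
    fix i assume i: "i \<in> {..<d}"
    have "cmod (vec_index (A *\<^sub>v v) i) \<le> (\<Sum>j<e. cmod (A $$ (i, j)) * cmod (vec_index v j))"
      using A v i by (subst mult_vec_index) (auto intro!: order_trans[OF norm_sum] simp: norm_mult)
    also have "\<dots> \<le> (\<Sum>j<e. cmod (A $$ (i, j)) * l2_norm v)"
      by (intro sum_mono mult_left_mono comp) auto
    finally show "\<bar>cmod (vec_index (A *\<^sub>v v) i)\<bar> \<le> (\<Sum>j<e. cmod (A $$ (i, j)) * l2_norm v)" by simp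
  qed
  also have "\<dots> = (\<Sum>i<d. \<Sum>j<e. cmod (A $$ (i, j))) * l2_norm v"
    by (simp add: sum_distrib_right)
  finally show ?thesis .
qed

lemma l2_norm_le_spectral_norm:
  assumes A: "A \<in> carrier_mat d e" and v: "v \<in> carrier_vec e"
  shows "l2_norm (A *\<^sub>v v) \<le> spectral_norm A * l2_norm v"
proof (cases "l2_norm v = 0")
  case True
  with l2_norm_eq_0[OF v] A have "A *\<^sub>v v = 0\<^sub>v d" by auto
  then show ?thesis using True by simp
next
  case False
  then have pos: "l2_norm v > 0" using l2_norm_ge_0[of v] by linarith
  define w where "w = complex_of_real (1 / l2_norm v) \<cdot>\<^sub>v v"
  have w: "w \<in> carrier_vec e" "l2_norm w = 1"
    using v pos by (auto simp: w_def l2_norm_smult norm_divide)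
  have vw: "v = complex_of_real (l2_norm v) \<cdot>\<^sub>v w"
    using pos by (auto simp: w_def smult_smult_assoc)
  have "bdd_above ((\<lambda>v. l2_norm (A *\<^sub>v v)) ` {v \<in> carrier_vec e. l2_norm v = 1})"
    by (rule bdd_aboveI2[where M="\<Sum>i<d. \<Sum>j<e. cmod (A $$ (i, j))"])
      (use l2_norm_mult_vec_le_sum[OF A] in force)
  then have "l2_norm (A *\<^sub>v w) \<le> spectral_norm A"
    unfolding spectral_norm_def using A w by (intro cSUP_upper) auto
  moreover have "l2_norm (A *\<^sub>v v) = l2_norm v * l2_norm (A *\<^sub>v w)"
    by (subst vw) (use A w pos in \<open>simp add: mult_mat_vec l2_norm_smult\<close>)
  ultimately show ?thesis using pos by (simp add: mult.commute)
qed

lemma l2_norm_unit_vec: "i < n \<Longrightarrow> l2_norm (unit_vec n i) = 1"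
  by (simp add: l2_norm_def unit_vec_def if_distrib[of "\<lambda>x. (cmod x)\<^sup>2"] cong: if_cong)

text \<open>A positive dimension supplies a unit vector; in dimension 0 the supremum would range
  over the empty set.\<close>

lemma spectral_norm_le:
  assumes A: "A \<in> carrier_mat d e" and e: "e > 0"
    and le: "\<And>v. v \<in> carrier_vec e \<Longrightarrow> l2_norm (A *\<^sub>v v) \<le> c * l2_norm v"
  shows "spectral_norm A \<le> c"
proof -
  have "unit_vec e 0 \<in> {v \<in> carrier_vec e. l2_norm v = 1}"
    using e by (simp add: l2_norm_unit_vec)
  then show ?thesis
    unfolding spectral_norm_def using A le by (intro cSUP_least) fastforce+
qed

lemma spectral_norm_ge_0:
  assumes A: "A \<in> carrier_mat d e" and e: "e > 0"
  shows "0 \<le> spectral_norm A"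
  using l2_norm_le_spectral_norm[OF A, of "unit_vec e 0"] l2_norm_unit_vec[OF e]
    l2_norm_ge_0[of "A *\<^sub>v unit_vec e 0"] by (simp del: l2_norm_ge_0)

section \<open>Unitary matrices and isometries\<close>

definition unitary_mat :: "nat \<Rightarrow> complex mat \<Rightarrow> bool" where
  "unitary_mat d U \<longleftrightarrow> U \<in> carrier_mat d d \<and> mat_adjoint U * U = 1\<^sub>m d"

text \<open>A left inverse of a square matrix is two-sided, which is why the definition asks for one
  side only.\<close>

lemma unitary_mat_right_inverse: "unitary_mat d U \<Longrightarrow> U * mat_adjoint U = 1\<^sub>m d"
  unfolding unitary_mat_def by (auto intro: mat_mult_left_right_inverse)

lemma unitary_mat_mult:
  assumes U: "unitary_mat d U" and V: "unitary_mat d V"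
  shows "unitary_mat d (U * V)"
proof -
  have c: "U \<in> carrier_mat d d" "V \<in> carrier_mat d d"
    "mat_adjoint U \<in> carrier_mat d d" "mat_adjoint V \<in> carrier_mat d d"
    using U V by (auto simp: unitary_mat_def)
  have "mat_adjoint (U * V) * (U * V) = mat_adjoint V * (mat_adjoint U * (U * V))"
    using c by (simp add: mat_adjoint_mult assoc_mult_mat[of _ d d _ d _ d])
  also have "mat_adjoint U * (U * V) = (mat_adjoint U * U) * V"
    using c by (intro assoc_mult_mat[symmetric])
  also have "\<dots> = V" using U c by (simp add: unitary_mat_def)
  finally show ?thesis using V c by (simp add: unitary_mat_def)
qed

lemma unitary_mat_one: "unitary_mat d (1\<^sub>m d)"
  by (simp add: unitary_mat_def)

text \<open>The squared norm of the image is the quadratic form of the Gram matrix; a matrix whose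
  Gram matrix is the identity is therefore an isometry.\<close>

lemma l2_norm_sq_adjoint:
  assumes A: "A \<in> carrier_mat d e" and v: "v \<in> carrier_vec e"
  shows "complex_of_real ((l2_norm (A *\<^sub>v v))\<^sup>2) = ((mat_adjoint A * A) *\<^sub>v v) \<bullet>c v"
proof -
  have "complex_of_real ((l2_norm (A *\<^sub>v v))\<^sup>2)
      = (\<Sum>i<d. (\<Sum>k<e. A $$ (i, k) * vec_index v k) * (\<Sum>l<e. cnj (A $$ (i, l)) * cnj (vec_index v l)))"
    unfolding l2_norm_sq_complex using A v by (auto simp: mult_vec_index simp del: index_mult_mat_vec)
  also have "\<dots> = (\<Sum>l<e. \<Sum>k<e. \<Sum>i<d. cnj (A $$ (i, l)) * A $$ (i, k) * vec_index v k * cnj (vec_index v l))"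
    unfolding sum_product
    by (subst sum.swap, subst sum.swap, rule sum.cong[OF refl], subst sum.swap)
       (auto intro!: sum.cong simp: ac_simps)
  also have "\<dots> = ((mat_adjoint A * A) *\<^sub>v v) \<bullet>c v"
    using A v
    by (auto simp: cscalar_prod_sum mult_vec_index mult_mat_index sum_distrib_right
          simp del: index_mult_mat_vec index_mult_mat(1) assoc_mult_mat_vec intro!: sum.cong)
  finally show ?thesis .
qed

lemma unitary_mat_l2_norm:
  assumes U: "unitary_mat d U" and v: "v \<in> carrier_vec d"
  shows "l2_norm (U *\<^sub>v v) = l2_norm v"
proof -
  have "complex_of_real ((l2_norm (U *\<^sub>v v))\<^sup>2) = complex_of_real ((l2_norm v)\<^sup>2)"
    using U v by (subst l2_norm_sq_adjoint[of _ d d])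
      (auto simp: unitary_mat_def cscalar_prod_sum l2_norm_sq_complex simp del: of_real_power)
  then show ?thesis by (simp del: of_real_power)
qed

section \<open>The spectral theorem and the functional calculus\<close>

text \<open>This is V diag(g) times the adjoint of V, the functional calculus in the basis formed by
  the columns of V. It is entrywise, and \<open>g\<close> is a function of the index instead of the
  eigenvalue, so that sums, products, powers and exponentials become pointwise statements about
  \<open>g\<close>.\<close>

definition fcalc :: "nat \<Rightarrow> complex mat \<Rightarrow> (nat \<Rightarrow> complex) \<Rightarrow> complex mat" where
  "fcalc d V g = Matrix.mat d d (\<lambda>(i, j). \<Sum>m<d. V $$ (i, m) * g m * cnj (V $$ (j, m)))"

lemma fcalc_carrier [simp]: "fcalc d V g \<in> carrier_mat d d"
  and fcalc_dim [simp]: "dim_row (fcalc d V g) = d" "dim_col (fcalc d V g) = d"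
  and fcalc_index: "i < d \<Longrightarrow> j < d \<Longrightarrow>
    fcalc d V g $$ (i, j) = (\<Sum>m<d. V $$ (i, m) * g m * cnj (V $$ (j, m)))"
  by (auto simp: fcalc_def)

lemma fcalc_cong: "(\<And>m. m < d \<Longrightarrow> g m = h m) \<Longrightarrow> fcalc d V g = fcalc d V h"
  by (auto simp: fcalc_def intro!: sum.cong eq_matI)

lemma fcalc_smult: "c \<cdot>\<^sub>m fcalc d V g = fcalc d V (\<lambda>m. c * g m)"
  by (rule eq_matI) (auto simp: fcalc_index sum_distrib_left mult_ac)

lemma fcalc_add: "fcalc d V g + fcalc d V h = fcalc d V (\<lambda>m. g m + h m)"
  by (rule eq_matI) (auto simp: fcalc_index algebra_simps sum.distrib)

lemma fcalc_minus: "fcalc d V g - fcalc d V h = fcalc d V (\<lambda>m. g m - h m)"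
  by (rule eq_matI) (auto simp: fcalc_index algebra_simps sum_subtractf)

lemma fcalc_adjoint: "mat_adjoint (fcalc d V g) = fcalc d V (\<lambda>m. cnj (g m))"
  by (rule eq_matI) (auto simp: fcalc_index mult_ac intro!: sum.cong)

lemma unitary_mat_cols:
  assumes "unitary_mat d V" "k < d" "l < d"
  shows "(\<Sum>i<d. cnj (V $$ (i, k)) * V $$ (i, l)) = (if k = l then 1 else 0)"
proof -
  have V: "V \<in> carrier_mat d d" and "mat_adjoint V * V = 1\<^sub>m d"
    using assms by (auto simp: unitary_mat_def)
  then have "(mat_adjoint V * V) $$ (k, l) = (1\<^sub>m d :: complex mat) $$ (k, l)" by simp
  then show ?thesis using V assms(2,3) by (simp add: mult_mat_index del: index_mult_mat(1))
qed

lemma unitary_mat_rows: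
  assumes "unitary_mat d V" "i < d" "j < d"
  shows "(\<Sum>m<d. V $$ (i, m) * cnj (V $$ (j, m))) = (if i = j then 1 else 0)"
proof -
  have V: "V \<in> carrier_mat d d" using assms by (auto simp: unitary_mat_def)
  have "(V * mat_adjoint V) $$ (i, j) = (1\<^sub>m d :: complex mat) $$ (i, j)"
    using unitary_mat_right_inverse[OF assms(1)] by simp
  then show ?thesis using V assms(2,3) by (simp add: mult_mat_index del: index_mult_mat(1))
qed

lemma unitary_matI:
  assumes V: "V \<in> carrier_mat d d"
    and cols: "\<And>k l. k < d \<Longrightarrow> l < d \<Longrightarrow> (\<Sum>i<d. cnj (V $$ (i, k)) * V $$ (i, l)) = (if k = l then 1 else 0)"
  shows "unitary_mat d V"
  unfolding unitary_mat_def
proof (intro conjI eq_matI)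
  fix i j assume "i < dim_row (1\<^sub>m d)" "j < dim_col (1\<^sub>m d)"
  then show "(mat_adjoint V * V) $$ (i, j) = (1\<^sub>m d :: complex mat) $$ (i, j)"
    using V cols[of i j] by (simp add: mult_mat_index del: index_mult_mat(1))
qed (use V in auto)

lemma unitary_mat_adjoint:
  assumes "unitary_mat d U"
  shows "unitary_mat d (mat_adjoint U)"
  using assms unitary_mat_right_inverse[OF assms] by (simp add: unitary_mat_def)

text \<open>Orthonormality of the columns collapses the double sum over eigenvector indices to its
  diagonal.\<close>

lemma fcalc_mult:
  assumes V: "unitary_mat d V"
  shows "fcalc d V g * fcalc d V h = fcalc d V (\<lambda>m. g m * h m)"
proof (rule eq_matI)
  fix i j assume ij: "i < dim_row (fcalc d V (\<lambda>m. g m * h m))" "j < dim_col (fcalc d V (\<lambda>m. g m * h m))"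
  have "(fcalc d V g * fcalc d V h) $$ (i, j) =
      (\<Sum>k<d. \<Sum>m<d. \<Sum>n<d. (V $$ (i, m) * g m * cnj (V $$ (k, m))) * (V $$ (k, n) * h n * cnj (V $$ (j, n))))"
    using ij by (simp add: mult_mat_index fcalc_index sum_product del: index_mult_mat(1))
  also have "\<dots> = (\<Sum>m<d. \<Sum>k<d. \<Sum>n<d. (V $$ (i, m) * g m * cnj (V $$ (k, m))) * (V $$ (k, n) * h n * cnj (V $$ (j, n))))"
    by (rule sum.swap)
  also have "\<dots> = (\<Sum>m<d. \<Sum>n<d. \<Sum>k<d. (V $$ (i, m) * g m * cnj (V $$ (k, m))) * (V $$ (k, n) * h n * cnj (V $$ (j, n))))"
    by (intro sum.cong refl sum.swap)
  also have "\<dots> = (\<Sum>m<d. \<Sum>n<d. V $$ (i, m) * g m * h n * cnj (V $$ (j, n)) * (\<Sum>k<d. cnj (V $$ (k, m)) * V $$ (k, n)))"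
    unfolding sum_distrib_left by (intro sum.cong refl) (simp add: mult_ac)
  also have "\<dots> = (\<Sum>m<d. \<Sum>n<d. if m = n then V $$ (i, m) * g m * h n * cnj (V $$ (j, n)) else 0)"
    by (intro sum.cong refl) (simp add: unitary_mat_cols[OF V])
  also have "\<dots> = fcalc d V (\<lambda>m. g m * h m) $$ (i, j)"
    using ij by (simp add: fcalc_index mult_ac)
  finally show "(fcalc d V g * fcalc d V h) $$ (i, j) = fcalc d V (\<lambda>m. g m * h m) $$ (i, j)" .
qed auto

lemma fcalc_one: "unitary_mat d V \<Longrightarrow> fcalc d V (\<lambda>_. 1) = 1\<^sub>m d"
  by (rule eq_matI) (auto simp: fcalc_index unitary_mat_rows)

lemma fcalc_pow: "unitary_mat d V \<Longrightarrow> fcalc d V g ^\<^sub>m n = fcalc d V (\<lambda>m. g m ^ n)"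
  by (induction n) (auto simp: fcalc_one fcalc_mult mult.commute)

lemma fcalc_trace:
  assumes V: "unitary_mat d V"
  shows "mat_trace (fcalc d V g) = (\<Sum>m<d. g m)"
proof -
  have "mat_trace (fcalc d V g) = (\<Sum>m<d. \<Sum>i<d. V $$ (i, m) * g m * cnj (V $$ (i, m)))"
    unfolding mat_trace_def by (subst sum.swap) (simp add: fcalc_index)
  also have "\<dots> = (\<Sum>m<d. g m * (\<Sum>i<d. cnj (V $$ (i, m)) * V $$ (i, m)))"
    unfolding sum_distrib_left by (intro sum.cong refl) (simp add: mult_ac)
  finally show ?thesis by (simp add: unitary_mat_cols[OF V])
qed

lemma fcalc_unitary:
  assumes V: "unitary_mat d V" and g: "\<And>m. m < d \<Longrightarrow> cmod (g m) = 1"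
  shows "unitary_mat d (fcalc d V g)"
proof -
  have "cnj (g m) * g m = 1" if "m < d" for m
    using g[OF that] by (metis complex_norm_square mult.commute of_real_1 power_one)
  then have "mat_adjoint (fcalc d V g) * fcalc d V g = fcalc d V (\<lambda>_. 1)"
    by (simp add: fcalc_adjoint fcalc_mult[OF V] cong: fcalc_cong)
  then show ?thesis by (simp add: unitary_mat_def fcalc_one[OF V])
qed

text \<open>The factorised form is used where the isometry of V or a change of basis matters, not
  the entries.\<close>

lemma fcalc_decomp:
  assumes V: "V \<in> carrier_mat d d"
  shows "fcalc d V g = V * (Matrix.mat d d (\<lambda>(i, j). if i = j then g i else 0) * mat_adjoint V)"
proof (rule eq_matI)
  fix i j assume ij: "i < dim_row (V * (Matrix.mat d d (\<lambda>(i, j). if i = j then g i else 0) * mat_adjoint V))"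
    "j < dim_col (V * (Matrix.mat d d (\<lambda>(i, j). if i = j then g i else 0) * mat_adjoint V))"
  have "(Matrix.mat d d (\<lambda>(i, j). if i = j then g i else 0) * mat_adjoint V) $$ (m, j)
      = g m * cnj (V $$ (j, m))" if "m < d" for m
    using ij V that
    by (simp add: mult_mat_index if_distrib[of "\<lambda>x. x * _"] del: index_mult_mat(1) cong: if_cong)
  then show "fcalc d V g $$ (i, j) = (V * (Matrix.mat d d (\<lambda>(i, j). if i = j then g i else 0) * mat_adjoint V)) $$ (i, j)"
    using ij V by (simp add: fcalc_index mult_mat_index mult_ac del: index_mult_mat(1))
qed (use V in auto)

text \<open>Both outer factors are isometries; only the diagonal factor changes the norm, and it
  scales each coordinate by at most \<open>c\<close>.\<close>

lemma fcalc_l2_norm_le: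
  assumes V: "unitary_mat d V" and g: "\<And>m. m < d \<Longrightarrow> cmod (g m) \<le> c" and v: "v \<in> carrier_vec d"
    and c: "0 \<le> c"
  shows "l2_norm (fcalc d V g *\<^sub>v v) \<le> c * l2_norm v"
proof -
  let ?D = "Matrix.mat d d (\<lambda>(i, j). if i = j then g i else 0)"
  have Vc: "V \<in> carrier_mat d d" using V by (simp add: unitary_mat_def)
  define w where "w = mat_adjoint V *\<^sub>v v"
  have w: "w \<in> carrier_vec d"
    unfolding w_def using Vc v by (intro mult_mat_vec_carrier[of _ d d]) auto
  have "fcalc d V g *\<^sub>v v = V *\<^sub>v (?D *\<^sub>v w)"
    unfolding fcalc_decomp[OF Vc] w_def using Vc v
    by (simp add: assoc_mult_mat_vec[of _ d d _ d] mult_carrier_mat[of _ d d])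
  then have "l2_norm (fcalc d V g *\<^sub>v v) = l2_norm (?D *\<^sub>v w)"
    using unitary_mat_l2_norm[OF V, of "?D *\<^sub>v w"] mult_mat_vec_carrier[of ?D d d w] w by simp
  also have "\<dots> = sqrt (\<Sum>i<d. (cmod (g i * vec_index w i))\<^sup>2)"
    using w unfolding l2_norm_def
    by (simp add: mult_vec_index if_distrib[of "\<lambda>x. x * _"] del: index_mult_mat_vec cong: if_cong)
  also have "\<dots> \<le> sqrt (\<Sum>i<d. c\<^sup>2 * (cmod (vec_index w i))\<^sup>2)"
    by (intro real_sqrt_le_mono sum_mono)
      (auto simp: norm_mult power_mult_distrib intro!: mult_right_mono power_mono g)
  also have "\<dots> = c * l2_norm w"
    using w c by (simp add: l2_norm_def real_sqrt_mult flip: sum_distrib_left)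
  also have "l2_norm w = l2_norm v"
    unfolding w_def by (rule unitary_mat_l2_norm[OF unitary_mat_adjoint[OF V] v])
  finally show ?thesis .
qed

lemma fcalc_eigenvector:
  assumes V: "unitary_mat d V" and k: "k < d"
  shows "fcalc d V g *\<^sub>v col V k = g k \<cdot>\<^sub>v col V k"
proof (rule eq_vecI)
  have Vc: "V \<in> carrier_mat d d" using V by (simp add: unitary_mat_def)
  fix i assume i: "i < dim_vec (g k \<cdot>\<^sub>v col V k)"
  then have i: "i < d" using Vc by simp
  have "vec_index (fcalc d V g *\<^sub>v col V k) i =
     (\<Sum>j<d. \<Sum>m<d. V $$ (i, m) * g m * cnj (V $$ (j, m)) * V $$ (j, k))"
    using i k Vc by (simp add: mult_vec_index fcalc_index sum_distrib_right del: index_mult_mat_vec)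
  also have "\<dots> = (\<Sum>m<d. V $$ (i, m) * g m * (\<Sum>j<d. cnj (V $$ (j, m)) * V $$ (j, k)))"
    unfolding sum_distrib_left by (subst sum.swap) (simp add: mult_ac)
  also have "\<dots> = (\<Sum>m<d. if m = k then V $$ (i, m) * g m else 0)"
    by (intro sum.cong refl) (simp add: unitary_mat_cols[OF V _ k])
  finally show "vec_index (fcalc d V g *\<^sub>v col V k) i = vec_index (g k \<cdot>\<^sub>v col V k) i"
    using i k Vc by (simp add: mult_ac)
qed (use V in \<open>auto simp: unitary_mat_def\<close>)

lemma unitary_mat_col_l2_norm:
  assumes V: "unitary_mat d V" and k: "k < d"
  shows "l2_norm (col V k) = 1"
proof -
  have Vc: "V \<in> carrier_mat d d" using V by (simp add: unitary_mat_def)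
  have "complex_of_real ((l2_norm (col V k))\<^sup>2) = 1"
    unfolding l2_norm_sq_complex using unitary_mat_cols[OF V k k] Vc k
    by (simp add: mult.commute)
  then have "(l2_norm (col V k))\<^sup>2 = 1" by (metis of_real_eq_1_iff)
  then show ?thesis by (simp add: power2_eq_1_iff) (use l2_norm_ge_0[of "col V k"] in linarith)
qed

text \<open>Each entry of the exponential series is a finite linear combination of scalar
  exponential series, so only scalar convergence is involved.\<close>

lemma mat_exp_fcalc:
  assumes V: "unitary_mat d V"
  shows "mat_exp (fcalc d V g) = fcalc d V (\<lambda>m. exp (g m))"
proof (rule eq_matI)
  fix i j assume ij: "i < dim_row (fcalc d V (\<lambda>m. exp (g m)))" "j < dim_col (fcalc d V (\<lambda>m. exp (g m)))"
  have "(\<lambda>k. (\<Sum>m<d. V $$ (i, m) * (g m ^ k /\<^sub>R fact k) * cnj (V $$ (j, m))))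
      sums (\<Sum>m<d. V $$ (i, m) * exp (g m) * cnj (V $$ (j, m)))"
    by (intro sums_sum sums_mult sums_mult2 exp_converges)
  moreover have "(fcalc d V g ^\<^sub>m k) $$ (i, j) / fact k
      = (\<Sum>m<d. V $$ (i, m) * (g m ^ k /\<^sub>R fact k) * cnj (V $$ (j, m)))" for k
    using ij by (simp add: fcalc_pow[OF V] fcalc_index sum_divide_distrib scaleR_conv_of_real field_simps)
  ultimately have "(\<Sum>k. (fcalc d V g ^\<^sub>m k) $$ (i, j) / fact k)
      = (\<Sum>m<d. V $$ (i, m) * exp (g m) * cnj (V $$ (j, m)))"
    by (simp only: sums_iff)
  then show "mat_exp (fcalc d V g) $$ (i, j) = fcalc d V (\<lambda>m. exp (g m)) $$ (i, j)"
    using ij by (simp add: mat_exp_def fcalc_index)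
qed (auto simp: mat_exp_def)

section \<open>Diagonalisation of Hermitian matrices\<close>

lemma fcalc_conj:
  assumes V: "V \<in> carrier_mat d d" and W: "W \<in> carrier_mat d d"
  shows "W * (fcalc d V g * mat_adjoint W) = fcalc d (W * V) g"
  unfolding fcalc_decomp[OF V] fcalc_decomp[OF mult_carrier_mat[OF W V]]
  using V W
  by (simp add: mat_adjoint_mult assoc_mult_mat[of _ d d _ d _ d] mult_carrier_mat[of _ d d])

text \<open>The vector is completed to a basis, and Gram-Schmidt orthogonalises the basis without
  changing its first element. After normalisation the first column is thus still a multiple of
  \<open>v\<close>.\<close>

lemma ex_unitary_mat_first_col:
  assumes v: "v \<in> carrier_vec n" and v0: "v \<noteq> 0\<^sub>v n"
  shows "\<exists>W c. unitary_mat n W \<and> col W 0 = c \<cdot>\<^sub>v v"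
proof -
  define b where "b = basis_completion v"
  define ws where "ws = gram_schmidt n b"
  interpret cof_vec_space n "TYPE(complex)" .
  from basis_completion[OF v v0, folded b_def]
  have dist_b: "distinct b"
    and indep: "\<not> lin_dep (set b)" and b: "set b \<subseteq> carrier_vec n" and hdb: "hd b = v"
    and len_b: "length b = n" by auto
  have n: "n \<noteq> 0" using v v0 by auto
  from hdb len_b n obtain vs where bv: "b = v # vs" by (cases b, auto)
  from gram_schmidt_result[OF b dist_b indep refl, folded ws_def]
  have ws: "set ws \<subseteq> carrier_vec n" "corthogonal ws" "length ws = n"
    by (auto simp: len_b)
  from gram_schmidt_hd[OF v, of vs, folded bv] have hdws: "hd ws = v" unfolding ws_def .
  have wsc: "ws ! k \<in> carrier_vec n" if "k < n" for k using ws that by auto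
  define W where "W = Matrix.mat n n (\<lambda>(i, j). vec_index (ws ! j) i / complex_of_real (l2_norm (ws ! j)))"
  have "unitary_mat n W"
  proof (rule unitary_matI)
    fix k l assume k: "k < n" and l: "l < n"
    have "(\<Sum>i<n. cnj (W $$ (i, k)) * W $$ (i, l))
        = (ws ! l \<bullet>c ws ! k) / (complex_of_real (l2_norm (ws ! k)) * complex_of_real (l2_norm (ws ! l)))"
      using k l wsc[OF k] wsc[OF l] by (simp add: W_def cscalar_prod_sum sum_divide_distrib mult_ac)
    also have "\<dots> = (if k = l then 1 else 0)"
    proof (cases "k = l")
      case True
      have "ws ! k \<bullet>c ws ! k = complex_of_real ((l2_norm (ws ! k))\<^sup>2)"
        using wsc[OF k] by (simp add: cscalar_prod_sum l2_norm_sq_complex del: of_real_power)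
      moreover have "ws ! k \<bullet>c ws ! k \<noteq> 0" using corthogonalD[OF ws(2), of k k] k ws(3) by simp
      ultimately show ?thesis using True by (simp add: power2_eq_square)
    next
      case False
      then show ?thesis using corthogonalD[OF ws(2), of l k] k l ws(3) by auto
    qed
    finally show "(\<Sum>i<n. cnj (W $$ (i, k)) * W $$ (i, l)) = (if k = l then 1 else 0)" .
  qed (simp add: W_def)
  moreover have "col W 0 = (1 / complex_of_real (l2_norm v)) \<cdot>\<^sub>v v"
  proof -
    have "ws ! 0 = v" using n hdws ws(3) hd_conv_nth[of ws] by fastforce
    then show ?thesis using n v by (intro eq_vecI) (auto simp: W_def)
  qed
  ultimately show ?thesis by blast
qed

text \<open>Deflation: an eigenvector, which exists over the complex numbers, is completed to a
  unitary \<open>W\<close>. Conjugation by \<open>W\<close> splits off a block of size 1, and the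
  induction hypothesis diagonalises the Hermitian rest.\<close>

theorem hermitian_mat_spectral:
  assumes "hermitian_mat d A"
  shows "\<exists>V ev. unitary_mat d V \<and> A = fcalc d V (\<lambda>m. complex_of_real (ev m))"
  using assms
proof (induction d arbitrary: A)
  case 0
  then have "A = fcalc 0 (1\<^sub>m 0) (\<lambda>m. complex_of_real 0)"
    by (intro eq_matI) (auto simp: hermitian_mat_def)
  then show ?case using unitary_mat_one by (intro exI[of _ "1\<^sub>m 0"] exI[of _ "\<lambda>_. 0"]) auto
next
  case (Suc n)
  let ?d = "Suc n"
  have A: "A \<in> carrier_mat ?d ?d" and Aadj: "mat_adjoint A = A"
    using Suc.prems by (auto simp: hermitian_mat_def)
  obtain e v where v: "v \<in> carrier_vec ?d" "v \<noteq> 0\<^sub>v ?d" "A *\<^sub>v v = e \<cdot>\<^sub>v v"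
    using spectrum_non_empty[OF A] A by (auto simp: spectrum_def eigenvalue_def eigenvector_def)
  obtain W c where W: "unitary_mat ?d W" and col: "col W 0 = c \<cdot>\<^sub>v v"
    using ex_unitary_mat_first_col[OF v(1,2)] by auto
  have Wc: "W \<in> carrier_mat ?d ?d" using W by (simp add: unitary_mat_def)
  define B where "B = mat_adjoint W * (A * W)"
  have B: "B \<in> carrier_mat ?d ?d" using Wc A by (auto simp: B_def)
  have Badj: "mat_adjoint B = B"
    using Wc A by (simp add: B_def mat_adjoint_mult Aadj assoc_mult_mat[of _ ?d ?d _ ?d _ ?d])
  have "A *\<^sub>v col W 0 = e \<cdot>\<^sub>v col W 0"
    using v A unfolding col by (simp add: mult_mat_vec smult_smult_assoc mult.commute)
  then have ev: "vec_index (A *\<^sub>v col W 0) i = vec_index (e \<cdot>\<^sub>v col W 0) i" for i by (rule arg_cong)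
  have AW: "(A * W) $$ (i, 0) = e * W $$ (i, 0)" if "i < ?d" for i
    using ev[of i] that A Wc by simp
  \<comment> \<open>The first column of \<open>W\<close> is an eigenvector orthogonal to the other
    columns, so the first column of \<open>B\<close> vanishes below the diagonal. By Hermitian
    symmetry so does the first row.\<close>
  have B0: "B $$ (i, 0) = (if i = 0 then e else 0)" if "i < ?d" for i
  proof -
    have "B $$ (i, 0) = (\<Sum>k<?d. cnj (W $$ (k, i)) * (e * W $$ (k, 0)))"
      unfolding B_def using that Wc A AW
      by (subst mult_mat_index) (auto simp del: index_mult_mat(1) intro!: sum.cong)
    also have "\<dots> = e * (\<Sum>k<?d. cnj (W $$ (k, i)) * W $$ (k, 0))"
      by (simp add: sum_distrib_left mult_ac del: sum.lessThan_Suc)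
    finally show ?thesis using unitary_mat_cols[OF W that, of 0] by simp
  qed
  have Bsym: "B $$ (i, j) = cnj (B $$ (j, i))" if "i < ?d" "j < ?d" for i j
    using mat_adjoint_index[of i B j] that B unfolding Badj by auto
  \<comment> \<open>The eigenvalue is a diagonal entry of a Hermitian matrix, hence real.\<close>
  have e: "e = complex_of_real (Re e)"
    using Bsym[of 0 0] B0[of 0] by (simp add: complex_eq_iff)
  define C where "C = Matrix.mat n n (\<lambda>(i, j). B $$ (Suc i, Suc j))"
  have "hermitian_mat n C"
    unfolding hermitian_mat_def
  proof (intro conjI eq_matI)
    fix i j assume "i < dim_row C" "j < dim_col C"
    then show "mat_adjoint C $$ (i, j) = C $$ (i, j)"
      using Bsym[of "Suc i" "Suc j"] by (simp add: C_def)
  qed (auto simp: C_def)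
  from Suc.IH[OF this] obtain V ev where V: "unitary_mat n V"
    and CV: "C = fcalc n V (\<lambda>m. complex_of_real (ev m))" by auto
  \<comment> \<open>The direct sum of the scalar 1 and V; \<open>ev'\<close> puts the split-off
    eigenvalue in front.\<close>
  define V' where "V' = Matrix.mat ?d ?d (\<lambda>(i, j). case i of
     0 \<Rightarrow> (case j of 0 \<Rightarrow> 1 | Suc j' \<Rightarrow> 0) | Suc i' \<Rightarrow> (case j of 0 \<Rightarrow> 0 | Suc j' \<Rightarrow> V $$ (i', j')))"
  define ev' where "ev' = case_nat (Re e) ev"
  have V': "unitary_mat ?d V'"
  proof (rule unitary_matI)
    fix k l assume "k < ?d" "l < ?d"
    then show "(\<Sum>i<?d. cnj (V' $$ (i, k)) * V' $$ (i, l)) = (if k = l then 1 else 0)"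
      unfolding sum.lessThan_Suc_shift
      by (cases k; cases l) (auto simp: V'_def unitary_mat_cols[OF V])
  qed (simp add: V'_def)
  have BV: "B = fcalc ?d V' (\<lambda>m. complex_of_real (ev' m))"
  proof (rule eq_matI)
    fix i j assume "i < dim_row (fcalc ?d V' (\<lambda>m. complex_of_real (ev' m)))"
      "j < dim_col (fcalc ?d V' (\<lambda>m. complex_of_real (ev' m)))"
    then have ij: "i < ?d" "j < ?d" by auto
    have CV': "B $$ (Suc i', Suc j') = fcalc n V (\<lambda>m. complex_of_real (ev m)) $$ (i', j')"
      if "i' < n" "j' < n" for i' j'
      using that unfolding CV[symmetric] by (simp add: C_def)
    show "B $$ (i, j) = fcalc ?d V' (\<lambda>m. complex_of_real (ev' m)) $$ (i, j)"
      unfolding fcalc_index[OF ij] sum.lessThan_Suc_shift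
      using ij B0 Bsym[of i j] e by (cases i; cases j) (auto simp: V'_def ev'_def CV' fcalc_index)
  qed (use B in auto)
  have V'c: "V' \<in> carrier_mat ?d ?d" by (simp add: V'_def)
  have WW: "W * mat_adjoint W = 1\<^sub>m ?d" by (rule unitary_mat_right_inverse[OF W])
  have Wa: "mat_adjoint W \<in> carrier_mat ?d ?d" using Wc by simp
  have "W * (B * mat_adjoint W) = (W * mat_adjoint W) * (A * (W * mat_adjoint W))"
    unfolding B_def using Wc Wa A by (simp add: assoc_mult_mat[of _ ?d ?d _ ?d _ ?d])
  also have "\<dots> = A" unfolding WW using A by simp
  finally have "A = fcalc ?d (W * V') (\<lambda>m. complex_of_real (ev' m))"
    unfolding BV fcalc_conj[OF V'c Wc] by simp
  then show ?case using unitary_mat_mult[OF W V'] by blast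
qed

section \<open>Kronecker products and partial traces\<close>

text \<open>Indices of a tensor product are two-digit numbers \<open>x * b + y\<close>. Summing
  digit by digit is the basis of all computations with \<open>kron\<close> and partial
  traces.\<close>

lemma sum_lessThan_mult: "(\<Sum>k<a * b. f k) = (\<Sum>x<a. \<Sum>y<b. f (x * b + y))" for b :: nat
proof -
  have "(\<Sum>k<a * b. f k) = (\<Sum>x<a. sum f {x * b..<x * b + b})"
    by (rule sum.nat_group[symmetric])
  also have "\<dots> = (\<Sum>x<a. \<Sum>y<b. f (x * b + y))"
    by (rule sum.cong[OF refl], subst sum.atLeastLessThan_shift_0) (simp add: atLeast0LessThan)
  finally show ?thesis .
qed

lemma pair_index_less: "x < a \<Longrightarrow> y < b \<Longrightarrow> x * b + y < a * b" for x :: nat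
proof -
  assume "x < a" "y < b"
  then have "x * b + y < Suc x * b" by simp
  also have "\<dots> \<le> a * b" using \<open>x < a\<close> by (intro mult_le_mono1) simp
  finally show ?thesis .
qed

lemma div_less_of_less_mult: "i < a * b \<Longrightarrow> i div b < a" for i :: nat
  by (simp add: less_mult_imp_div_less)

lemma mod_less_of_less_mult: "i < a * b \<Longrightarrow> i mod b < b" for i :: nat
  by (cases "b = 0") auto

lemma kron_dim [simp]:
  "dim_row (A \<otimes>\<^sub>k B) = dim_row A * dim_row B" "dim_col (A \<otimes>\<^sub>k B) = dim_col A * dim_col B"
  by (auto simp: kron_def)

lemma kron_carrier [simp]:
  "A \<in> carrier_mat a a' \<Longrightarrow> B \<in> carrier_mat b b' \<Longrightarrow> A \<otimes>\<^sub>k B \<in> carrier_mat (a * b) (a' * b')"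
  by (intro carrier_matI) auto

lemma kron_index:
  "i < dim_row A * dim_row B \<Longrightarrow> j < dim_col A * dim_col B \<Longrightarrow>
   (A \<otimes>\<^sub>k B) $$ (i, j) =
     A $$ (i div dim_row B, j div dim_col B) * B $$ (i mod dim_row B, j mod dim_col B)"
  by (simp add: kron_def)

lemma kron_index_pair:
  assumes "A \<in> carrier_mat a a'" "B \<in> carrier_mat b b'" "x < a" "y < b" "z < a'" "w < b'"
  shows "(A \<otimes>\<^sub>k B) $$ (x * b + y, z * b' + w) = A $$ (x, z) * B $$ (y, w)"
  using assms pair_index_less[of x a y b] pair_index_less[of z a' w b'] by (simp add: kron_index)

text \<open>Comparing entries at two-digit indices keeps \<open>div\<close> and \<open>mod\<close>
  out of the proofs of tensor identities.\<close>

lemma eq_mat_pairI: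
  assumes A: "A \<in> carrier_mat (a * b) (a' * b')" and B: "B \<in> carrier_mat (a * b) (a' * b')"
    and eq: "\<And>x y z w. x < a \<Longrightarrow> y < b \<Longrightarrow> z < a' \<Longrightarrow> w < b' \<Longrightarrow>
      A $$ (x * b + y, z * b' + w) = B $$ (x * b + y, z * b' + w)"
  shows "A = B"
proof (rule eq_matI)
  fix i j assume "i < dim_row B" "j < dim_col B"
  then have "i < a * b" "j < a' * b'" using B by auto
  then show "A $$ (i, j) = B $$ (i, j)"
    using eq[of "i div b" "i mod b" "j div b'" "j mod b'"]
    by (simp add: div_less_of_less_mult mod_less_of_less_mult)
qed (use A B in auto)

text \<open>The mixed-product rule: the sum over the joint inner index factors into one sum per
  tensor factor.\<close>

lemma kron_mult:
  assumes A: "A \<in> carrier_mat a a'" and B: "B \<in> carrier_mat b b'"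
    and C: "C \<in> carrier_mat a' a''" and D: "D \<in> carrier_mat b' b''"
  shows "(A \<otimes>\<^sub>k B) * (C \<otimes>\<^sub>k D) = (A * C) \<otimes>\<^sub>k (B * D)"
proof (rule eq_mat_pairI[of _ a b a'' b''])
  fix x y z w assume *: "x < a" "y < b" "z < a''" "w < b''"
  have "((A \<otimes>\<^sub>k B) * (C \<otimes>\<^sub>k D)) $$ (x * b + y, z * b'' + w)
      = (\<Sum>k<a'. \<Sum>l<b'. (A \<otimes>\<^sub>k B) $$ (x * b + y, k * b' + l) * (C \<otimes>\<^sub>k D) $$ (k * b' + l, z * b'' + w))"
    using assms * pair_index_less[of x a y b] pair_index_less[of z a'' w b'']
    by (subst mult_mat_index) (auto simp: sum_lessThan_mult)
  also have "\<dots> = (\<Sum>k<a'. \<Sum>l<b'. (A $$ (x, k) * C $$ (k, z)) * (B $$ (y, l) * D $$ (l, w)))"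
    using * by (intro sum.cong refl, subst kron_index_pair[OF A B], simp_all,
        subst kron_index_pair[OF C D], simp_all)
  also have "\<dots> = (A * C) $$ (x, z) * (B * D) $$ (y, w)"
    using assms * by (simp add: mult_mat_index sum_product del: index_mult_mat(1))
  also have "\<dots> = ((A * C) \<otimes>\<^sub>k (B * D)) $$ (x * b + y, z * b'' + w)"
    using assms * by (subst kron_index_pair[of _ a a'' _ b b'']) auto
  finally show "((A \<otimes>\<^sub>k B) * (C \<otimes>\<^sub>k D)) $$ (x * b + y, z * b'' + w)
    = ((A * C) \<otimes>\<^sub>k (B * D)) $$ (x * b + y, z * b'' + w)" .
qed (use assms in \<open>auto intro!: mult_carrier_mat kron_carrier\<close>)

lemma kron_adjoint: "mat_adjoint (A \<otimes>\<^sub>k B) = mat_adjoint A \<otimes>\<^sub>k mat_adjoint B"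
  by (rule eq_matI) (auto simp: kron_index div_less_of_less_mult mod_less_of_less_mult)

lemma kron_one: "(1\<^sub>m a :: complex mat) \<otimes>\<^sub>k 1\<^sub>m b = 1\<^sub>m (a * b)"
proof (rule eq_mat_pairI[of _ a b a b])
  fix x y z w assume "x < a" "y < b" "z < a" "w < b"
  moreover from this have "x * b + y = z * b + w \<longleftrightarrow> x = z \<and> y = w"
    by (metis div_mult_self3 div_less add.right_neutral mod_mult_self3 mod_less not_less_zero)
  ultimately show "((1\<^sub>m a :: complex mat) \<otimes>\<^sub>k 1\<^sub>m b) $$ (x * b + y, z * b + w)
      = 1\<^sub>m (a * b) $$ (x * b + y, z * b + w)"
    using pair_index_less[of x a y b] pair_index_less[of z a w b] by (simp add: kron_index_pair[of _ a a _ b b])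
qed auto

lemma kron_add_left:
  assumes "A \<in> carrier_mat a a'" "A' \<in> carrier_mat a a'"
  shows "(A + A') \<otimes>\<^sub>k B = A \<otimes>\<^sub>k B + A' \<otimes>\<^sub>k B"
  using assms by (intro eq_matI) (auto simp: kron_index div_less_of_less_mult algebra_simps)

lemma kron_add_right:
  assumes "B \<in> carrier_mat b b'" "B' \<in> carrier_mat b b'"
  shows "A \<otimes>\<^sub>k (B + B') = A \<otimes>\<^sub>k B + A \<otimes>\<^sub>k B'"
  using assms by (intro eq_matI) (auto simp: kron_index mod_less_of_less_mult algebra_simps)

lemma kron_smult_left: "(c \<cdot>\<^sub>m A) \<otimes>\<^sub>k B = c \<cdot>\<^sub>m (A \<otimes>\<^sub>k B)"
  by (intro eq_matI) (auto simp: kron_index div_less_of_less_mult)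

lemma mat_trace_add:
  "A \<in> carrier_mat d d \<Longrightarrow> B \<in> carrier_mat d d \<Longrightarrow> mat_trace (A + B) = mat_trace A + mat_trace B"
  by (auto simp: mat_trace_def sum.distrib)

lemma mat_trace_smult: "A \<in> carrier_mat d d \<Longrightarrow> mat_trace (c \<cdot>\<^sub>m A) = c * mat_trace A"
  by (auto simp: mat_trace_def sum_distrib_left)

lemma mat_trace_mult_commute:
  assumes "A \<in> carrier_mat d e" "B \<in> carrier_mat e d"
  shows "mat_trace (A * B) = mat_trace (B * A)"
proof -
  have "mat_trace (A * B) = (\<Sum>i<d. \<Sum>k<e. A $$ (i, k) * B $$ (k, i))"
    using assms by (auto simp: mat_trace_def mult_mat_index simp del: index_mult_mat(1))
  also have "\<dots> = (\<Sum>k<e. \<Sum>i<d. B $$ (k, i) * A $$ (i, k))"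
    by (subst sum.swap) (simp add: mult.commute)
  also have "\<dots> = mat_trace (B * A)"
    using assms by (auto simp: mat_trace_def mult_mat_index simp del: index_mult_mat(1))
  finally show ?thesis .
qed

lemma mat_trace_kron:
  assumes "A \<in> carrier_mat a a" "B \<in> carrier_mat b b"
  shows "mat_trace (A \<otimes>\<^sub>k B) = mat_trace A * mat_trace B"
proof -
  have "mat_trace (A \<otimes>\<^sub>k B) = (\<Sum>x<a. \<Sum>y<b. (A \<otimes>\<^sub>k B) $$ (x * b + y, x * b + y))"
    using assms by (simp add: mat_trace_def sum_lessThan_mult)
  also have "\<dots> = mat_trace A * mat_trace B"
    using assms by (simp add: mat_trace_def kron_index_pair sum_product)
  finally show ?thesis .
qed

section \<open>Partial traces and the swap of two registers\<close>

lemma ptrace_last_carrier [simp]: "ptrace_last a b X \<in> carrier_mat a a"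
  by (simp add: ptrace_last_def)

lemma ptrace_last_dim [simp]: "dim_row (ptrace_last a b X) = a" "dim_col (ptrace_last a b X) = a"
  by (auto simp: ptrace_last_def)

lemma mat_trace_ptrace_last:
  "X \<in> carrier_mat (a * b) (a * b) \<Longrightarrow> mat_trace (ptrace_last a b X) = mat_trace X"
  by (simp add: mat_trace_def ptrace_last_def sum_lessThan_mult)

lemma ptrace_last_add:
  assumes "X \<in> carrier_mat (a * b) (a * b)" "Y \<in> carrier_mat (a * b) (a * b)"
  shows "ptrace_last a b (X + Y) = ptrace_last a b X + ptrace_last a b Y"
  using assms by (intro eq_matI) (auto simp: ptrace_last_def pair_index_less sum.distrib)

lemma ptrace_last_smult:
  assumes "X \<in> carrier_mat (a * b) (a * b)"
  shows "ptrace_last a b (c \<cdot>\<^sub>m X) = c \<cdot>\<^sub>m ptrace_last a b X"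
  using assms by (intro eq_matI) (auto simp: ptrace_last_def pair_index_less sum_distrib_left)

lemma triple_index_less:
  "x < a \<Longrightarrow> k < e \<Longrightarrow> z < e' \<Longrightarrow> (x * e + k) * e' + z < a * e * e'" for x :: nat
  by (intro pair_index_less) auto

text \<open>The branch without swap: the register used so far is the middle factor and is traced
  out, and the fresh register survives.\<close>

lemma ptrace_mid_kron:
  assumes X: "X \<in> carrier_mat (a * e) (a * e)" and E: "E \<in> carrier_mat e e"
  shows "ptrace_mid a e e (X \<otimes>\<^sub>k E) = ptrace_last a e X \<otimes>\<^sub>k E"
proof (rule eq_mat_pairI[of _ a e a e])
  fix x y z w assume *: "x < a" "y < e" "z < a" "w < e"
  have "ptrace_mid a e e (X \<otimes>\<^sub>k E) $$ (x * e + y, z * e + w)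
      = (\<Sum>k<e. (X \<otimes>\<^sub>k E) $$ ((x * e + k) * e + y, (z * e + k) * e + w))"
    using * by (simp add: ptrace_mid_def pair_index_less)
  also have "\<dots> = (\<Sum>k<e. X $$ (x * e + k, z * e + k) * E $$ (y, w))"
    using * assms by (intro sum.cong refl kron_index_pair) (auto simp: pair_index_less)
  also have "\<dots> = (ptrace_last a e X \<otimes>\<^sub>k E) $$ (x * e + y, z * e + w)"
    using * assms
    by (simp add: kron_index_pair[of _ a a] ptrace_last_def sum_distrib_right)
  finally show "ptrace_mid a e e (X \<otimes>\<^sub>k E) $$ (x * e + y, z * e + w)
    = (ptrace_last a e X \<otimes>\<^sub>k E) $$ (x * e + y, z * e + w)" .
qed (use assms in \<open>auto simp: ptrace_mid_def intro!: kron_carrier\<close>)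

lemma swap_mat_carrier [simp]: "swap_mat d \<in> carrier_mat (d * d) (d * d)"
  by (simp add: swap_mat_def)

lemma swap_mat_dim [simp]: "dim_row (swap_mat d) = d * d" "dim_col (swap_mat d) = d * d"
  by (auto simp: swap_mat_def)

lemma swap_mat_index:
  assumes "x < d" "y < d" "z < d" "w < d"
  shows "swap_mat d $$ (x * d + y, z * d + w) = (if x = w \<and> y = z then 1 else 0)"
proof -
  have "x * d + y = w * d + z \<longleftrightarrow> x = w \<and> y = z"
    using assms by (metis div_mult_self3 div_less add.right_neutral mod_mult_self3 mod_less not_less_zero)
  then show ?thesis using assms by (simp add: swap_mat_def pair_index_less)
qed

text \<open>The branch with swap: the fresh state \<open>E\<close> is moved to the middle, where the
  trace turns it into a scalar, while the environment part of \<open>X\<close> moves to the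
  surviving register.\<close>

lemma ptrace_mid_swap_kron:
  assumes X: "X \<in> carrier_mat (a * e) (a * e)" and E: "E \<in> carrier_mat e e"
  shows "ptrace_mid a e e (conj_by (1\<^sub>m a \<otimes>\<^sub>k swap_mat e) (X \<otimes>\<^sub>k E)) = mat_trace E \<cdot>\<^sub>m X"
proof (rule eq_mat_pairI[of _ a e a e])
  let ?S = "(1\<^sub>m a \<otimes>\<^sub>k swap_mat e) :: complex mat"
  have S: "?S \<in> carrier_mat (a * e * e) (a * e * e)"
    using kron_carrier[of "1\<^sub>m a" a a "swap_mat e" "e * e" "e * e"] by (simp add: mult.assoc)
  have Sidx: "?S $$ ((x * e + k) * e + y, (x' * e + k') * e + y')
      = (if x = x' \<and> k = y' \<and> y = k' then 1 else 0)"
    if "x < a" "k < e" "y < e" "x' < a" "k' < e" "y' < e" for x k y x' k' y'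
    using kron_index_pair[of "1\<^sub>m a" a a "swap_mat e" "e * e" "e * e" x "k * e + y" x' "k' * e + y'"] that
    by (auto simp: pair_index_less swap_mat_index add_mult_distrib mult.assoc add.assoc)
  \<comment> \<open>As a permutation matrix, the swap exchanges the last two digits of the row
    index.\<close>
  have left: "(?S * Y) $$ ((x * e + k) * e + y, j) = Y $$ ((x * e + y) * e + k, j)"
    if Y: "Y \<in> carrier_mat (a * e * e) (a * e * e)" and j: "j < a * e * e"
      and x: "x < a" "k < e" "y < e" for Y x k y j
  proof -
    have "(?S * Y) $$ ((x * e + k) * e + y, j)
      = (\<Sum>x'<a. \<Sum>k'<e. \<Sum>y'<e. ?S $$ ((x * e + k) * e + y, (x' * e + k') * e + y') * Y $$ ((x' * e + k') * e + y', j))"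
      using S Y j triple_index_less[OF x]
      by (subst mult_mat_index) (auto simp: sum_lessThan_mult carrier_matD[OF S] simp del: kron_dim)
    also have "\<dots> = (\<Sum>x'<a. \<Sum>k'<e. \<Sum>y'<e. if y' = k then (if x = x' \<and> y = k' then Y $$ ((x' * e + k') * e + k, j) else 0) else 0)"
      using x by (intro sum.cong refl) (auto simp: Sidx)
    also have "\<dots> = (\<Sum>x'<a. \<Sum>k'<e. if k' = y then (if x = x' then Y $$ ((x' * e + y) * e + k, j) else 0) else 0)"
      using x by (intro sum.cong refl) auto
    also have "\<dots> = (\<Sum>x'<a. if x' = x then Y $$ ((x * e + y) * e + k, j) else 0)"
      using x by (intro sum.cong refl) auto
    finally show ?thesis using x by simp
  qed
  \<comment> \<open>The version for columns follows from the one for rows by taking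
    adjoints.\<close>
  have right: "(Y * mat_adjoint ?S) $$ (i, (x * e + k) * e + y) = Y $$ (i, (x * e + y) * e + k)"
    if Y: "Y \<in> carrier_mat (a * e * e) (a * e * e)" and i: "i < a * e * e"
      and x: "x < a" "k < e" "y < e" for Y x k y i
  proof -
    have "(Y * mat_adjoint ?S) $$ (i, (x * e + k) * e + y)
        = cnj ((?S * mat_adjoint Y) $$ ((x * e + k) * e + y, i))"
      using Y S i triple_index_less[OF x] mat_adjoint_index[of i "?S * mat_adjoint Y" "(x * e + k) * e + y"]
      by (simp add: mat_adjoint_mult del: index_mult_mat(1))
    also have "\<dots> = cnj (mat_adjoint Y $$ ((x * e + y) * e + k, i))"
      using Y i x by (subst left) auto
    also have "\<dots> = Y $$ (i, (x * e + y) * e + k)"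
      using Y i triple_index_less[OF x(1,3,2)] by simp
    finally show ?thesis .
  qed
  have XE: "X \<otimes>\<^sub>k E \<in> carrier_mat (a * e * e) (a * e * e)" using X E by (rule kron_carrier)
  fix x y z w assume *: "x < a" "y < e" "z < a" "w < e"
  have "conj_by ?S (X \<otimes>\<^sub>k E) $$ ((x * e + k) * e + y, (z * e + k) * e + w)
      = X $$ (x * e + y, z * e + w) * E $$ (k, k)" if k: "k < e" for k
  proof -
    have "conj_by ?S (X \<otimes>\<^sub>k E) $$ ((x * e + k) * e + y, (z * e + k) * e + w)
        = (X \<otimes>\<^sub>k E) $$ ((x * e + y) * e + k, (z * e + w) * e + k)"
      unfolding conj_by_def using * k S XE triple_index_less[of x a k e y e] triple_index_less[of z a w e k e]
      by (subst right) (auto intro!: left simp del: index_mult_mat(1))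
    then show ?thesis using * k X E by (simp add: kron_index_pair pair_index_less)
  qed
  then have "ptrace_mid a e e (conj_by ?S (X \<otimes>\<^sub>k E)) $$ (x * e + y, z * e + w)
      = (\<Sum>k<e. X $$ (x * e + y, z * e + w) * E $$ (k, k))"
    using * by (simp add: ptrace_mid_def pair_index_less)
  also have "\<dots> = mat_trace E * X $$ (x * e + y, z * e + w)"
    unfolding mat_trace_def sum_distrib_right using E by (auto intro!: sum.cong)
  also have "\<dots> = (mat_trace E \<cdot>\<^sub>m X) $$ (x * e + y, z * e + w)"
    using X * by (simp add: pair_index_less)
  finally show "ptrace_mid a e e (conj_by ?S (X \<otimes>\<^sub>k E)) $$ (x * e + y, z * e + w)
      = (mat_trace E \<cdot>\<^sub>m X) $$ (x * e + y, z * e + w)" .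
qed (use assms in \<open>auto simp: ptrace_mid_def\<close>)

section \<open>Sums of rank-one matrices\<close>

text \<open>The operator |u><v|, whose trace norm is the product of the two vector norms.\<close>

definition rank_one :: "complex Matrix.vec \<Rightarrow> complex Matrix.vec \<Rightarrow> complex mat" where
  "rank_one u v = Matrix.mat (dim_vec u) (dim_vec v) (\<lambda>(i, j). vec_index u i * cnj (vec_index v j))"

text \<open>For \<open>s = False\<close> the predicate says that the trace norm of the matrix is at most \<open>c\<close>; for
  \<open>s = True\<close> it says in addition that the matrix is positive semidefinite. Working with the
  decompositions instead of the norm itself reduces every estimate to matrices of rank one.\<close>

inductive rank_one_sum :: "bool \<Rightarrow> nat \<Rightarrow> complex mat \<Rightarrow> real \<Rightarrow> bool" for s d where
  zero: "rank_one_sum s d (0\<^sub>m d d) 0"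
| rank_one: "u \<in> carrier_vec d \<Longrightarrow> v \<in> carrier_vec d \<Longrightarrow> (s \<Longrightarrow> u = v) \<Longrightarrow>
    rank_one_sum s d (rank_one u v) (l2_norm u * l2_norm v)"
| add: "rank_one_sum s d A a \<Longrightarrow> rank_one_sum s d B b \<Longrightarrow> rank_one_sum s d (A + B) (a + b)"
| weaken: "rank_one_sum s d A a \<Longrightarrow> a \<le> b \<Longrightarrow> rank_one_sum s d A b"

lemma rank_one_dim [simp]: "dim_row (rank_one u v) = dim_vec u" "dim_col (rank_one u v) = dim_vec v"
  by (auto simp: rank_one_def)

lemma rank_one_carrier [simp]:
  "u \<in> carrier_vec d \<Longrightarrow> v \<in> carrier_vec e \<Longrightarrow> rank_one u v \<in> carrier_mat d e"
  by (auto simp: rank_one_def)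

lemma rank_one_index [simp]:
  "i < dim_vec u \<Longrightarrow> j < dim_vec v \<Longrightarrow> rank_one u v $$ (i, j) = vec_index u i * cnj (vec_index v j)"
  by (auto simp: rank_one_def)

lemma rank_one_sum_carrier: "rank_one_sum s d A c \<Longrightarrow> A \<in> carrier_mat d d"
  by (induction rule: rank_one_sum.induct) auto

lemma rank_one_sum_False: "rank_one_sum s d A c \<Longrightarrow> rank_one_sum False d A c"
  by (induction rule: rank_one_sum.induct) (auto intro: rank_one_sum.intros)

lemma rank_one_sum_nonneg: "rank_one_sum s d A c \<Longrightarrow> 0 \<le> c"
  by (induction rule: rank_one_sum.induct) auto

text \<open>Induction over the decomposition: an additive map has to be estimated on rank-one
  matrices only. The rules for multiples, conjugations, tensor products and partial traces are
  instances.\<close>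

lemma rank_one_sum_map:
  assumes "rank_one_sum s d A a" and k: "0 \<le> k"
    and zero: "F (0\<^sub>m d d) = 0\<^sub>m e e"
    and add: "\<And>A B. A \<in> carrier_mat d d \<Longrightarrow> B \<in> carrier_mat d d \<Longrightarrow> F (A + B) = F A + F B"
    and rank_one: "\<And>u v. u \<in> carrier_vec d \<Longrightarrow> v \<in> carrier_vec d \<Longrightarrow> (s \<Longrightarrow> u = v) \<Longrightarrow>
      rank_one_sum s e (F (rank_one u v)) (k * (l2_norm u * l2_norm v))"
  shows "rank_one_sum s e (F A) (k * a)"
  using assms(1)
proof (induction rule: rank_one_sum.induct)
  case (add A a B b)
  then show ?case
    using rank_one_sum.add[OF add.IH] by (simp add: assms(4) rank_one_sum_carrier distrib_left)
next
  case (weaken A a b)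
  then show ?case using k by (auto intro: rank_one_sum.weaken mult_left_mono)
qed (auto simp: zero rank_one intro: rank_one_sum.intros)

lemma rank_one_sum_smult:
  assumes "rank_one_sum s d A a" and k: "0 \<le> k"
  shows "rank_one_sum s d (complex_of_real k \<cdot>\<^sub>m A) (k * a)"
proof (rule rank_one_sum_map[OF assms])
  fix u v :: "complex Matrix.vec" assume u: "u \<in> carrier_vec d" and v: "v \<in> carrier_vec d" and s: "s \<Longrightarrow> u = v"
  \<comment> \<open>The factor is split evenly between the two vectors, so that a term with u = v
    keeps this form.\<close>
  let ?c = "complex_of_real (sqrt k)"
  have "complex_of_real k \<cdot>\<^sub>m rank_one u v = rank_one (?c \<cdot>\<^sub>v u) (?c \<cdot>\<^sub>v v)"
    using u v k by (intro eq_matI) (auto simp: mult_ac simp flip: of_real_mult)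
  moreover have "k * (l2_norm u * l2_norm v) = l2_norm (?c \<cdot>\<^sub>v u) * l2_norm (?c \<cdot>\<^sub>v v)"
    using k by (simp add: l2_norm_smult)
  moreover have "rank_one_sum s d (rank_one (?c \<cdot>\<^sub>v u) (?c \<cdot>\<^sub>v v)) (l2_norm (?c \<cdot>\<^sub>v u) * l2_norm (?c \<cdot>\<^sub>v v))"
    using u v s by (intro rank_one_sum.rank_one) auto
  ultimately show "rank_one_sum s d (complex_of_real k \<cdot>\<^sub>m rank_one u v) (k * (l2_norm u * l2_norm v))"
    by simp
qed (auto intro!: eq_matI simp: algebra_simps)

lemma rank_one_mult:
  assumes X: "X \<in> carrier_mat d e" and Y: "Y \<in> carrier_mat d' e'"
    and u: "u \<in> carrier_vec e" and v: "v \<in> carrier_vec e'"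
  shows "X * rank_one u v * mat_adjoint Y = rank_one (X *\<^sub>v u) (Y *\<^sub>v v)"
proof (rule eq_matI)
  fix i j assume ij: "i < dim_row (rank_one (X *\<^sub>v u) (Y *\<^sub>v v))" "j < dim_col (rank_one (X *\<^sub>v u) (Y *\<^sub>v v))"
  have "(X * rank_one u v) $$ (i, l) = vec_index (X *\<^sub>v u) i * cnj (vec_index v l)" if "l < e'" for l
    using ij X u v that
    by (simp add: mult_mat_index mult_vec_index sum_distrib_left sum_distrib_right mult_ac
        del: index_mult_mat(1) index_mult_mat_vec)
  then have "(X * rank_one u v * mat_adjoint Y) $$ (i, j)
      = (\<Sum>l<e'. vec_index (X *\<^sub>v u) i * cnj (vec_index v l) * cnj (Y $$ (j, l)))"
    using ij X Y u v by (subst mult_mat_index) (auto simp del: index_mult_mat(1) index_mult_mat_vec)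
  also have "\<dots> = rank_one (X *\<^sub>v u) (Y *\<^sub>v v) $$ (i, j)"
    using ij Y v
    by (simp add: mult_vec_index[of j Y v] sum_distrib_left mult_ac del: index_mult_mat_vec)
  finally show "(X * rank_one u v * mat_adjoint Y) $$ (i, j) = rank_one (X *\<^sub>v u) (Y *\<^sub>v v) $$ (i, j)" .
qed (use X Y u v in auto)

text \<open>The map sends |u><v| to |Xu><Yv|. The outer factors may differ, as the perturbation
  argument requires; the flag for positivity is kept when they agree.\<close>

lemma rank_one_sum_mult:
  assumes A: "rank_one_sum s d A a" and X: "X \<in> carrier_mat d d" and Y: "Y \<in> carrier_mat d d"
    and s: "s \<Longrightarrow> X = Y" and x: "0 \<le> x" and y: "0 \<le> y"
    and Xx: "\<And>u. u \<in> carrier_vec d \<Longrightarrow> l2_norm (X *\<^sub>v u) \<le> x * l2_norm u"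
    and Yy: "\<And>u. u \<in> carrier_vec d \<Longrightarrow> l2_norm (Y *\<^sub>v u) \<le> y * l2_norm u"
  shows "rank_one_sum s d (X * A * mat_adjoint Y) (x * y * a)"
proof (rule rank_one_sum_map[OF A])
  have "mat_adjoint Y \<in> carrier_mat d d" using Y by simp
  then show "X * 0\<^sub>m d d * mat_adjoint Y = 0\<^sub>m d d" using X by simp
  fix A B :: "complex mat" assume "A \<in> carrier_mat d d" "B \<in> carrier_mat d d"
  then show "X * (A + B) * mat_adjoint Y = X * A * mat_adjoint Y + X * B * mat_adjoint Y"
    using X Y by (simp add: mult_add_distrib_mat[of _ d d] add_mult_distrib_mat[of _ d d] mult_carrier_mat[of _ d d])
next
  fix u v :: "complex Matrix.vec" assume u: "u \<in> carrier_vec d" and v: "v \<in> carrier_vec d" and uv: "s \<Longrightarrow> u = v"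
  have "rank_one_sum s d (rank_one (X *\<^sub>v u) (Y *\<^sub>v v)) (l2_norm (X *\<^sub>v u) * l2_norm (Y *\<^sub>v v))"
    using X Y u v uv s by (intro rank_one_sum.rank_one) auto
  moreover have "l2_norm (X *\<^sub>v u) * l2_norm (Y *\<^sub>v v) \<le> (x * l2_norm u) * (y * l2_norm v)"
    using Xx[OF u] Yy[OF v] x by (intro mult_mono) auto
  ultimately show "rank_one_sum s d (X * rank_one u v * mat_adjoint Y) (x * y * (l2_norm u * l2_norm v))"
    using rank_one_mult[OF X Y u v] by (auto intro: rank_one_sum.weaken simp: mult_ac)
qed (use x y in auto)

definition kron_vec :: "complex Matrix.vec \<Rightarrow> complex Matrix.vec \<Rightarrow> complex Matrix.vec" where
  "kron_vec u w = Matrix.vec (dim_vec u * dim_vec w)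
     (\<lambda>i. vec_index u (i div dim_vec w) * vec_index w (i mod dim_vec w))"

lemma kron_vec_carrier:
  "u \<in> carrier_vec a \<Longrightarrow> w \<in> carrier_vec b \<Longrightarrow> kron_vec u w \<in> carrier_vec (a * b)"
  by (auto simp: kron_vec_def)

lemma pair_index_div [simp]: "y < b \<Longrightarrow> (x * b + y) div b = x"
  and pair_index_mod [simp]: "y < b \<Longrightarrow> (x * b + y) mod b = y" for x :: nat
  by auto

lemma l2_norm_kron_vec: "l2_norm (kron_vec u w) = l2_norm u * l2_norm w"
proof -
  have "(\<Sum>i<dim_vec u * dim_vec w. (cmod (vec_index (kron_vec u w) i))\<^sup>2)
      = (\<Sum>x<dim_vec u. \<Sum>y<dim_vec w. (cmod (vec_index u x))\<^sup>2 * (cmod (vec_index w y))\<^sup>2)"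
    unfolding sum_lessThan_mult
    by (intro sum.cong refl) (auto simp: kron_vec_def pair_index_less norm_mult power_mult_distrib)
  then show ?thesis
    by (simp add: l2_norm_def kron_vec_def sum_product real_sqrt_mult flip: sum_product)
qed

lemma kron_rank_one:
  assumes "u \<in> carrier_vec a" "v \<in> carrier_vec a" "w \<in> carrier_vec b" "z \<in> carrier_vec b"
  shows "rank_one u v \<otimes>\<^sub>k rank_one w z = rank_one (kron_vec u w) (kron_vec v z)"
  using assms
  by (intro eq_matI) (auto simp: kron_index kron_vec_def div_less_of_less_mult mod_less_of_less_mult)

lemma kron_zero_left: "B \<in> carrier_mat b b' \<Longrightarrow> 0\<^sub>m a a' \<otimes>\<^sub>k B = 0\<^sub>m (a * b) (a' * b')"
  by (intro eq_matI) (auto simp: kron_index div_less_of_less_mult)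

lemma kron_zero_right: "A \<in> carrier_mat a a' \<Longrightarrow> A \<otimes>\<^sub>k 0\<^sub>m b b' = 0\<^sub>m (a * b) (a' * b')"
  by (intro eq_matI) (auto simp: kron_index mod_less_of_less_mult)

text \<open>Decomposes one tensor factor at a time. The tensor product of rank-one matrices has rank
  one, and the vector norms multiply.\<close>

lemma rank_one_sum_kron:
  assumes A: "rank_one_sum s a A x" and B: "rank_one_sum s b B y"
  shows "rank_one_sum s (a * b) (A \<otimes>\<^sub>k B) (y * x)"
proof (rule rank_one_sum_map[OF A])
  have Bc: "B \<in> carrier_mat b b" by (rule rank_one_sum_carrier[OF B])
  then show "0\<^sub>m a a \<otimes>\<^sub>k B = 0\<^sub>m (a * b) (a * b)" by (rule kron_zero_left)
  fix u v :: "complex Matrix.vec" assume u: "u \<in> carrier_vec a" and v: "v \<in> carrier_vec a" and uv: "s \<Longrightarrow> u = v"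
  have "rank_one_sum s (a * b) (rank_one u v \<otimes>\<^sub>k B) ((l2_norm u * l2_norm v) * y)"
  proof (rule rank_one_sum_map[OF B])
    show "rank_one u v \<otimes>\<^sub>k 0\<^sub>m b b = 0\<^sub>m (a * b) (a * b)"
      using u v by (intro kron_zero_right) auto
    fix w z :: "complex Matrix.vec" assume w: "w \<in> carrier_vec b" and z: "z \<in> carrier_vec b" and wz: "s \<Longrightarrow> w = z"
    have "rank_one_sum s (a * b) (rank_one (kron_vec u w) (kron_vec v z))
        (l2_norm (kron_vec u w) * l2_norm (kron_vec v z))"
      using u v w z uv wz by (intro rank_one_sum.rank_one kron_vec_carrier) auto
    then show "rank_one_sum s (a * b) (rank_one u v \<otimes>\<^sub>k rank_one w z)
        (l2_norm u * l2_norm v * (l2_norm w * l2_norm z))"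
      using u v w z by (simp add: kron_rank_one l2_norm_kron_vec mult_ac)
  qed (auto intro: kron_add_right)
  then show "rank_one_sum s (a * b) (rank_one u v \<otimes>\<^sub>k B) (y * (l2_norm u * l2_norm v))"
    by (simp add: mult.commute)
qed (auto intro: kron_add_left rank_one_sum_nonneg[OF B])

lemma rank_one_sum_sum:
  fixes n :: nat
  assumes "\<And>k. k < n \<Longrightarrow> rank_one_sum s d (F k) (c k)" and "\<And>k. k < n \<Longrightarrow> F k \<in> carrier_mat d d"
  shows "rank_one_sum s d (Matrix.mat d d (\<lambda>(i, j). \<Sum>k<n. F k $$ (i, j))) (\<Sum>k<n. c k)"
  using assms
proof (induction n)
  case 0
  have "Matrix.mat d d (\<lambda>(i, j). \<Sum>k<0. F k $$ (i, j)) = 0\<^sub>m d d" by (intro eq_matI) auto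
  then show ?case by (simp only: lessThan_0 sum.empty rank_one_sum.zero)
next
  case (Suc n)
  have "Matrix.mat d d (\<lambda>(i, j). \<Sum>k<Suc n. F k $$ (i, j))
      = Matrix.mat d d (\<lambda>(i, j). \<Sum>k<n. F k $$ (i, j)) + F n"
    using Suc.prems(2)[of n] by (intro eq_matI) auto
  moreover have "rank_one_sum s d (Matrix.mat d d (\<lambda>(i, j). \<Sum>k<n. F k $$ (i, j)) + F n) ((\<Sum>k<n. c k) + c n)"
    using Suc.prems by (intro rank_one_sum.add Suc.IH) auto
  ultimately show ?case by (simp only: sum.lessThan_Suc)
qed

text \<open>Contractivity of the partial trace. From |u><v| it produces the sum over k of
  |u_k><v_k|, where u_k and v_k are the slices with last digit k, and Cauchy-Schwarz in k bounds the
  sum of the products of slice norms.\<close>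

lemma rank_one_sum_ptrace_last:
  assumes A: "rank_one_sum s (a * b) A x"
  shows "rank_one_sum s a (ptrace_last a b A) x"
proof -
  have "rank_one_sum s a (ptrace_last a b A) (1 * x)"
  proof (rule rank_one_sum_map[OF A])
    show "ptrace_last a b (0\<^sub>m (a * b) (a * b)) = 0\<^sub>m a a"
      by (intro eq_matI) (auto simp: ptrace_last_def pair_index_less)
    fix u v :: "complex Matrix.vec"
    assume u: "u \<in> carrier_vec (a * b)" and v: "v \<in> carrier_vec (a * b)" and uv: "s \<Longrightarrow> u = v"
    define slice where "slice = (\<lambda>(u :: complex Matrix.vec) k. Matrix.vec a (\<lambda>i. vec_index u (i * b + k)))"
    have "ptrace_last a b (rank_one u v)
        = Matrix.mat a a (\<lambda>(i, j). \<Sum>k<b. rank_one (slice u k) (slice v k) $$ (i, j))"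
      using u v by (intro eq_matI) (auto simp: ptrace_last_def slice_def pair_index_less)
    moreover have "rank_one_sum s a (Matrix.mat a a (\<lambda>(i, j). \<Sum>k<b. rank_one (slice u k) (slice v k) $$ (i, j)))
        (\<Sum>k<b. l2_norm (slice u k) * l2_norm (slice v k))"
      by (intro rank_one_sum_sum rank_one_sum.rank_one) (auto simp: slice_def uv)
    moreover have "(\<Sum>k<b. l2_norm (slice u k) * l2_norm (slice v k)) \<le> l2_norm u * l2_norm v"
    proof -
      have norm: "L2_set (\<lambda>k. l2_norm (slice u k)) {..<b} = l2_norm u" if "u \<in> carrier_vec (a * b)" for u
      proof -
        have "L2_set (\<lambda>k. l2_norm (slice u k)) {..<b}
            = sqrt (\<Sum>k<b. \<Sum>i<a. (cmod (vec_index u (i * b + k)))\<^sup>2)"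
          by (simp add: L2_set_def l2_norm_sq slice_def)
        also have "\<dots> = l2_norm u"
          using that by (subst sum.swap) (simp add: l2_norm_def sum_lessThan_mult)
        finally show ?thesis .
      qed
      have "(\<Sum>k<b. l2_norm (slice u k) * l2_norm (slice v k))
          = (\<Sum>k<b. \<bar>l2_norm (slice u k)\<bar> * \<bar>l2_norm (slice v k)\<bar>)" by simp
      also have "\<dots> \<le> L2_set (\<lambda>k. l2_norm (slice u k)) {..<b} * L2_set (\<lambda>k. l2_norm (slice v k)) {..<b}"
        by (rule L2_set_mult_ineq)
      finally show ?thesis using norm u v by simp
    qed
    ultimately show "rank_one_sum s a (ptrace_last a b (rank_one u v)) (1 * (l2_norm u * l2_norm v))"
      by (auto intro: rank_one_sum.weaken)
  qed (auto intro: ptrace_last_add)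
  then show ?thesis by simp
qed

lemma mat_trace_mult_rank_one:
  assumes A: "A \<in> carrier_mat d d" and u: "u \<in> carrier_vec d" and v: "v \<in> carrier_vec d"
  shows "mat_trace (A * rank_one u v) = (\<Sum>i<d. vec_index (A *\<^sub>v u) i * cnj (vec_index v i))"
  using assms unfolding mat_trace_def
  by (auto simp: mult_mat_index mult_vec_index sum_distrib_left sum_distrib_right mult_ac
      simp del: index_mult_mat(1) index_mult_mat_vec intro!: sum.cong)

text \<open>The duality of spectral norm and trace norm; on rank-one matrices it is
  Cauchy-Schwarz.\<close>

lemma mat_trace_mult_bound:
  assumes B: "rank_one_sum s d B b" and A: "A \<in> carrier_mat d d" and c: "0 \<le> c"
    and Ac: "\<And>u. u \<in> carrier_vec d \<Longrightarrow> l2_norm (A *\<^sub>v u) \<le> c * l2_norm u"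
  shows "cmod (mat_trace (A * B)) \<le> c * b"
  using B
proof (induction rule: rank_one_sum.induct)
  case zero
  then show ?case using A by (simp add: mat_trace_def)
next
  case (rank_one u v)
  have "cmod (mat_trace (A * rank_one u v)) \<le> l2_norm (A *\<^sub>v u) * l2_norm v"
    unfolding mat_trace_mult_rank_one[OF A rank_one(1,2)]
    using cscalar_prod_cauchy_schwarz[of "A *\<^sub>v u" v] A rank_one by simp
  also have "\<dots> \<le> c * l2_norm u * l2_norm v" by (intro mult_right_mono Ac rank_one) auto
  finally show ?case by (simp add: mult_ac)
next
  case (add B b C e)
  have "B \<in> carrier_mat d d" "C \<in> carrier_mat d d" using add.hyps by (auto intro: rank_one_sum_carrier)
  then have "mat_trace (A * (B + C)) = mat_trace (A * B) + mat_trace (A * C)"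
    using A by (simp add: mult_add_distrib_mat[of _ d d] mat_trace_add[of _ d] mult_carrier_mat[of _ d d])
  then show ?case using add.IH by (auto intro: norm_triangle_le simp: distrib_left)
next
  case (weaken B a b)
  then show ?case using mult_left_mono[OF \<open>a \<le> b\<close> c] by linarith
qed

text \<open>A density matrix with its decomposition as certificate. In this form, stability under
  unitaries, tensor products and partial traces follows from the rules for
  \<open>rank_one_sum\<close>.\<close>

definition qstate :: "nat \<Rightarrow> complex mat \<Rightarrow> bool" where
  "qstate d \<sigma> \<longleftrightarrow> rank_one_sum True d \<sigma> 1 \<and> mat_trace \<sigma> = 1"

lemma qstate_carrier: "qstate d \<sigma> \<Longrightarrow> \<sigma> \<in> carrier_mat d d"
  by (auto simp: qstate_def rank_one_sum_carrier)

lemma fcalc_rank_one_sum: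
  assumes V: "unitary_mat d V" and g: "\<And>m. m < d \<Longrightarrow> 0 \<le> g m"
  shows "rank_one_sum True d (fcalc d V (\<lambda>m. complex_of_real (g m))) (\<Sum>m<d. g m)"
proof -
  have Vc: "V \<in> carrier_mat d d" using V by (simp add: unitary_mat_def)
  have "fcalc d V (\<lambda>m. complex_of_real (g m))
      = Matrix.mat d d (\<lambda>(i, j). \<Sum>k<d. (complex_of_real (g k) \<cdot>\<^sub>m rank_one (col V k) (col V k)) $$ (i, j))"
    using Vc by (intro eq_matI) (auto simp: fcalc_index mult_ac intro!: sum.cong)
  moreover have "rank_one_sum True d (complex_of_real (g k) \<cdot>\<^sub>m rank_one (col V k) (col V k)) (g k)" if "k < d" for k
    using rank_one_sum_smult[OF rank_one_sum.rank_one[of "col V k" d "col V k" True] g[OF that]] Vc that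
    by (simp add: unitary_mat_col_l2_norm[OF V])
  ultimately show ?thesis using Vc by (auto intro!: rank_one_sum_sum)
qed

text \<open>The eigenvalues are values of the quadratic form at unit vectors, hence nonnegative, and
  they add up to the trace 1. The spectral decomposition is then the required certificate.\<close>

lemma density_mat_qstate:
  assumes "density_mat d \<rho>"
  shows "qstate d \<rho>"
proof -
  have herm: "hermitian_mat d \<rho>" and pos: "\<And>v. v \<in> carrier_vec d \<Longrightarrow> 0 \<le> Re ((\<rho> *\<^sub>v v) \<bullet>c v)"
    and tr: "mat_trace \<rho> = 1" using assms by (auto simp: density_mat_def)
  obtain V ev where V: "unitary_mat d V" and \<rho>: "\<rho> = fcalc d V (\<lambda>m. complex_of_real (ev m))"
    using hermitian_mat_spectral[OF herm] by auto
  have Vc: "V \<in> carrier_mat d d" using V by (simp add: unitary_mat_def)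
  have ev: "0 \<le> ev m" if "m < d" for m
  proof -
    have "(\<rho> *\<^sub>v col V m) \<bullet>c col V m = complex_of_real (ev m) * complex_of_real ((l2_norm (col V m))\<^sup>2)"
      unfolding \<rho> fcalc_eigenvector[OF V that] l2_norm_sq_complex
      using Vc that by (simp add: cscalar_prod_sum sum_distrib_left mult_ac)
    then have "Re ((\<rho> *\<^sub>v col V m) \<bullet>c col V m) = ev m"
      by (simp add: unitary_mat_col_l2_norm[OF V that])
    then show ?thesis using pos[of "col V m"] Vc that by simp
  qed
  have "complex_of_real (\<Sum>m<d. ev m) = 1" using tr unfolding \<rho> fcalc_trace[OF V] by simp
  then have "(\<Sum>m<d. ev m) = 1" by (simp only: of_real_eq_1_iff)
  then show ?thesis using fcalc_rank_one_sum[OF V, of ev] ev tr unfolding qstate_def \<rho> by simp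
qed

lemma qstate_conj_by:
  assumes \<sigma>: "qstate d \<sigma>" and U: "unitary_mat d U"
  shows "qstate d (conj_by U \<sigma>)"
proof -
  have Uc: "U \<in> carrier_mat d d" "mat_adjoint U \<in> carrier_mat d d" using U by (auto simp: unitary_mat_def)
  have \<sigma>c: "\<sigma> \<in> carrier_mat d d" by (rule qstate_carrier[OF \<sigma>])
  have "mat_trace (conj_by U \<sigma>) = mat_trace (mat_adjoint U * (U * \<sigma>))"
    unfolding conj_by_def using Uc \<sigma>c by (intro mat_trace_mult_commute) (auto intro: mult_carrier_mat)
  also have "mat_adjoint U * (U * \<sigma>) = (mat_adjoint U * U) * \<sigma>"
    using Uc \<sigma>c by (intro assoc_mult_mat[symmetric])
  also have "\<dots> = \<sigma>" using U \<sigma>c by (simp add: unitary_mat_def)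
  finally have "mat_trace (conj_by U \<sigma>) = 1" using \<sigma> by (simp add: qstate_def)
  moreover have "rank_one_sum True d (conj_by U \<sigma>) (1 * 1 * 1)"
    unfolding conj_by_def using \<sigma> Uc(1)
    by (intro rank_one_sum_mult) (auto simp: qstate_def unitary_mat_l2_norm[OF U])
  ultimately show ?thesis by (simp add: qstate_def)
qed

lemma qstate_kron: "qstate a A \<Longrightarrow> qstate b B \<Longrightarrow> qstate (a * b) (A \<otimes>\<^sub>k B)"
  using rank_one_sum_kron[of True a A 1 b B 1]
  by (auto simp: qstate_def mat_trace_kron[of A a B b] rank_one_sum_carrier)

lemma qstate_ptrace_last: "qstate (a * b) A \<Longrightarrow> qstate a (ptrace_last a b A)"
  by (auto simp: qstate_def rank_one_sum_ptrace_last mat_trace_ptrace_last rank_one_sum_carrier)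

section \<open>Measurements\<close>

text \<open>The definite description needs existence and uniqueness. The spectral projector gives
  existence. Two projectors with the same fixed vectors absorb each other, and being Hermitian they
  agree.\<close>

lemma eigen_projector_fcalc:
  fixes ev :: "nat \<Rightarrow> real"
  assumes V: "unitary_mat d V"
  shows "eigen_projector d (fcalc d V (\<lambda>m. complex_of_real (ev m))) x
    = fcalc d V (\<lambda>m. if ev m = x then 1 else 0)" (is "_ = ?P")
proof -
  let ?A = "fcalc d V (\<lambda>m. complex_of_real (ev m))"
  define proj where "proj = (\<lambda>P. hermitian_mat d P \<and> P * P = P \<and>
     (\<forall>v \<in> carrier_vec d. P *\<^sub>v v = v \<longleftrightarrow> ?A *\<^sub>v v = complex_of_real x \<cdot>\<^sub>v v))"
  have P: "proj ?P"
    unfolding proj_def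
  proof (intro conjI ballI)
    show "hermitian_mat d ?P"
      by (auto simp: hermitian_mat_def fcalc_adjoint intro!: fcalc_cong)
    show "?P * ?P = ?P" by (auto simp: fcalc_mult[OF V] intro!: fcalc_cong)
    fix v :: "complex Matrix.vec" assume v: "v \<in> carrier_vec d"
    show "?P *\<^sub>v v = v \<longleftrightarrow> ?A *\<^sub>v v = complex_of_real x \<cdot>\<^sub>v v"
    proof
      assume Pv: "?P *\<^sub>v v = v"
      have "?A *\<^sub>v v = ?A *\<^sub>v (?P *\<^sub>v v)" by (simp only: Pv)
      also have "\<dots> = (?A * ?P) *\<^sub>v v" using v by (intro assoc_mult_mat_vec[symmetric]) auto
      also have "?A * ?P = complex_of_real x \<cdot>\<^sub>m ?P"
        by (auto simp: fcalc_mult[OF V] fcalc_smult intro!: fcalc_cong)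
      also have "\<dots> *\<^sub>v v = complex_of_real x \<cdot>\<^sub>v (?P *\<^sub>v v)"
        using v by (intro eq_vecI) (auto simp: smult_scalar_prod_distrib[of _ d])
      finally show "?A *\<^sub>v v = complex_of_real x \<cdot>\<^sub>v v" by (simp only: Pv)
    next
      assume Av: "?A *\<^sub>v v = complex_of_real x \<cdot>\<^sub>v v"
      \<comment> \<open>\<open>?B\<close> is A - x, and \<open>?C\<close> inverts it off the
        eigenspace, so their product is the complementary projector. A vector killed by
        \<open>?B\<close> is therefore fixed by \<open>?P\<close>.\<close>
      let ?B = "fcalc d V (\<lambda>m. complex_of_real (ev m) - complex_of_real x)"
      let ?C = "fcalc d V (\<lambda>m. if ev m = x then 0 else 1 / (complex_of_real (ev m) - complex_of_real x))"
      have "?B = ?A - complex_of_real x \<cdot>\<^sub>m 1\<^sub>m d"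
        unfolding fcalc_one[OF V, symmetric] fcalc_smult fcalc_minus by simp
      then have "?B *\<^sub>v v = ?A *\<^sub>v v - (complex_of_real x \<cdot>\<^sub>m 1\<^sub>m d) *\<^sub>v v"
        using v by (simp add: minus_mult_distrib_mat_vec[of _ d d])
      also have "(complex_of_real x \<cdot>\<^sub>m 1\<^sub>m d) *\<^sub>v v = complex_of_real x \<cdot>\<^sub>v v"
        using v by (intro eq_vecI) (auto simp: smult_scalar_prod_distrib[of _ d])
      finally have Bv: "?B *\<^sub>v v = 0\<^sub>v d" unfolding Av using v by (intro eq_vecI) auto
      have "1\<^sub>m d - ?P = ?C * ?B"
        unfolding fcalc_one[OF V, symmetric] fcalc_minus fcalc_mult[OF V] by (intro fcalc_cong) auto
      then have "(1\<^sub>m d - ?P) *\<^sub>v v = ?C *\<^sub>v (?B *\<^sub>v v)"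
        using v by (simp add: assoc_mult_mat_vec[of _ d d _ d])
      also have "\<dots> = 0\<^sub>v d" unfolding Bv by (intro eq_vecI) auto
      finally have "v - ?P *\<^sub>v v = 0\<^sub>v d"
        using v by (simp add: minus_mult_distrib_mat_vec[of "1\<^sub>m d" d d])
      then have "vec_index (v - ?P *\<^sub>v v) i = 0" if "i < d" for i using that by simp
      then show "?P *\<^sub>v v = v" using v by (intro eq_vecI) auto
    qed
  qed
  \<comment> \<open>Every column of \<open>R\<close> is fixed by \<open>R\<close>, hence solves the
    eigenvalue equation, hence is fixed by \<open>Q\<close>.\<close>
  have absorb: "Q * R = R" if "proj Q" "proj R" for Q R
  proof (rule eq_matI)
    have c: "Q \<in> carrier_mat d d" "R \<in> carrier_mat d d"
      using that by (auto simp: proj_def hermitian_mat_def)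
    fix i j assume ij: "i < dim_row R" "j < dim_col R"
    have "R *\<^sub>v col R j = col R j"
      using that(2) c ij col_mult2[of R d d R d j] by (simp add: proj_def)
    then have "Q *\<^sub>v col R j = col R j" using that c ij by (auto simp: proj_def)
    then have "col (Q * R) j = col R j" using c ij col_mult2[of Q d d R d j] by simp
    then show "(Q * R) $$ (i, j) = R $$ (i, j)"
      using c ij by (metis carrier_matD index_col index_mult_mat(2,3))
  qed (use that in \<open>auto simp: proj_def hermitian_mat_def\<close>)
  have unique: "Q = ?P" if Q: "proj Q" for Q
  proof -
    have c: "Q \<in> carrier_mat d d" "mat_adjoint Q = Q" "mat_adjoint ?P = ?P"
      using Q P by (auto simp: proj_def hermitian_mat_def)
    have "Q = mat_adjoint (?P * Q)" using absorb[OF P Q] c by simp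
    also have "\<dots> = Q * ?P" using c by (simp add: mat_adjoint_mult)
    finally show ?thesis using absorb[OF Q P] by simp
  qed
  show ?thesis unfolding eigen_projector_def proj_def[symmetric] using P unique by (intro the_equality)
qed

text \<open>The m-th diagonal entry of \<open>B\<close> in the basis formed by the columns of V; for
  a state it is the Born probability of the m-th eigenvector.\<close>

definition overlap :: "nat \<Rightarrow> complex mat \<Rightarrow> complex mat \<Rightarrow> nat \<Rightarrow> complex" where
  "overlap d V B m = (\<Sum>i<d. \<Sum>k<d. V $$ (i, m) * cnj (V $$ (k, m)) * B $$ (k, i))"

lemma mat_trace_fcalc_mult:
  assumes B: "B \<in> carrier_mat d d"
  shows "mat_trace (fcalc d V g * B) = (\<Sum>m<d. g m * overlap d V B m)"
proof -
  have "mat_trace (fcalc d V g * B)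
      = (\<Sum>i<d. \<Sum>k<d. \<Sum>m<d. g m * (V $$ (i, m) * cnj (V $$ (k, m)) * B $$ (k, i)))"
    using B unfolding mat_trace_def
    by (auto simp: mult_mat_index fcalc_index sum_distrib_left sum_distrib_right mult_ac
        simp del: index_mult_mat(1) intro!: sum.cong)
  also have "\<dots> = (\<Sum>i<d. \<Sum>m<d. \<Sum>k<d. g m * (V $$ (i, m) * cnj (V $$ (k, m)) * B $$ (k, i)))"
    by (rule sum.cong[OF refl], rule sum.swap)
  also have "\<dots> = (\<Sum>m<d. \<Sum>i<d. \<Sum>k<d. g m * (V $$ (i, m) * cnj (V $$ (k, m)) * B $$ (k, i)))"
    by (rule sum.swap)
  finally show ?thesis by (simp add: overlap_def sum_distrib_left)
qed

text \<open>On |u><u| the overlap is the squared modulus of the scalar product of u with the m-th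
  column.\<close>

lemma overlap_nonneg:
  assumes "rank_one_sum True d B b"
  shows "\<exists>w\<ge>0. overlap d V B m = complex_of_real w"
  using assms
proof (induction rule: rank_one_sum.induct)
  case zero
  then show ?case by (auto simp: overlap_def)
next
  case (rank_one u v)
  let ?z = "\<Sum>k<d. cnj (V $$ (k, m)) * vec_index u k"
  have "overlap d V (rank_one u v) m = (\<Sum>i<d. V $$ (i, m) * cnj (vec_index u i)) * ?z"
    unfolding overlap_def sum_product using rank_one by (auto intro!: sum.cong)
  also have "\<dots> = ?z * cnj ?z" by (simp add: mult.commute)
  also have "\<dots> = complex_of_real ((cmod ?z)\<^sup>2)" by (rule complex_norm_square[symmetric])
  finally show ?case by (intro exI[of _ "(cmod ?z)\<^sup>2"]) auto
next
  case (add B b C e)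
  have c: "B \<in> carrier_mat d d" "C \<in> carrier_mat d d" using add.hyps by (auto intro: rank_one_sum_carrier)
  obtain w w' where w: "w \<ge> 0" "overlap d V B m = complex_of_real w" "w' \<ge> 0" "overlap d V C m = complex_of_real w'"
    using add.IH by auto
  have "overlap d V (B + C) m = overlap d V B m + overlap d V C m"
    unfolding overlap_def sum.distrib[symmetric] using c by (auto intro!: sum.cong simp: distrib_left)
  then show ?case using w by (intro exI[of _ "w + w'"]) auto
qed auto

text \<open>Born's rule at the level of eigenvector indices. The outcome distribution is an image
  measure under \<open>ev\<close>, so degenerate eigenvalues need no separate treatment.\<close>

lemma outcome_pmf_fcalc:
  fixes ev :: "nat \<Rightarrow> real"
  assumes V: "unitary_mat d V" and \<sigma>: "qstate d \<sigma>"
  obtains p where "outcome_pmf d (fcalc d V (\<lambda>m. complex_of_real (ev m))) \<sigma> = map_pmf ev p"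
    and "set_pmf p \<subseteq> {..<d}"
    and "\<And>m. m < d \<Longrightarrow> overlap d V \<sigma> m = complex_of_real (pmf p m)"
proof -
  \<comment> \<open>The default 0 outside the index range extends the weights to a mass function on
    all natural numbers.\<close>
  define w where "w = (\<lambda>m. if m < d then Re (overlap d V \<sigma> m) else 0)"
  have ov: "overlap d V \<sigma> m = complex_of_real (w m)" "w m \<ge> 0" if "m < d" for m
    using overlap_nonneg[of d \<sigma> 1 V m] \<sigma> that by (auto simp: qstate_def w_def)
  have wpos: "w m \<ge> 0" for m using ov(2)[of m] by (cases "m < d") (auto simp: w_def)
  have c: "\<sigma> \<in> carrier_mat d d" by (rule qstate_carrier[OF \<sigma>])
  \<comment> \<open>The weights add up to the trace of the state, because the constant function 1
    yields the identity.\<close>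
  have "mat_trace (fcalc d V (\<lambda>_. 1) * \<sigma>) = 1"
    unfolding fcalc_one[OF V] using \<sigma> c by (simp add: qstate_def)
  then have "complex_of_real (\<Sum>m<d. w m) = 1"
    unfolding mat_trace_fcalc_mult[OF c] by (simp add: ov)
  then have sum1: "(\<Sum>m<d. w m) = 1" by (simp only: of_real_eq_1_iff)
  define p where "p = embed_pmf w"
  have "(\<integral>\<^sup>+ m. ennreal (w m) \<partial>count_space UNIV) = (\<Sum>m<d. ennreal (w m))"
    by (rule nn_integral_count_space') (auto simp: w_def)
  also have "\<dots> = 1" using wpos by (simp add: sum_ennreal sum1)
  finally have pmf_p: "pmf p m = w m" for m
    unfolding p_def using wpos by (intro pmf_embed_pmf) auto
  have set_p: "set_pmf p \<subseteq> {..<d}"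
    by (auto simp: set_pmf_eq pmf_p w_def split: if_splits)
  have "Re (mat_trace (eigen_projector d (fcalc d V (\<lambda>m. complex_of_real (ev m))) x * \<sigma>)) = pmf (map_pmf ev p) x" for x
  proof -
    have "mat_trace (eigen_projector d (fcalc d V (\<lambda>m. complex_of_real (ev m))) x * \<sigma>)
       = (\<Sum>m<d. if ev m = x then complex_of_real (w m) else 0)"
      unfolding eigen_projector_fcalc[OF V] mat_trace_fcalc_mult[OF c]
      by (intro sum.cong) (auto simp: ov)
    then have "Re (mat_trace (eigen_projector d (fcalc d V (\<lambda>m. complex_of_real (ev m))) x * \<sigma>))
       = (\<Sum>m<d. if ev m = x then w m else 0)" by (simp add: if_distrib[of Re] cong: if_cong)
    also have "\<dots> = (\<Sum>m\<in>{m. m < d \<and> ev m = x}. pmf p m)"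
      by (simp add: pmf_p sum.If_cases Int_def)
    also have "\<dots> = measure p {m. m < d \<and> ev m = x}"
      by (rule measure_measure_pmf_finite[symmetric]) simp
    also have "\<dots> = measure p (ev -` {x})"
      using set_p by (subst (1 2) measure_Int_set_pmf[symmetric]) (auto intro!: arg_cong[of _ _ "measure _"])
    also have "\<dots> = pmf (map_pmf ev p) x" by (simp add: pmf_map)
    finally show ?thesis .
  qed
  then have "outcome_pmf d (fcalc d V (\<lambda>m. complex_of_real (ev m))) \<sigma> = embed_pmf (pmf (map_pmf ev p))"
    unfolding outcome_pmf_def by (intro arg_cong[of _ _ embed_pmf] ext)
  also have "\<dots> = map_pmf ev p"
    by (intro pmf_eqI, subst pmf_embed_pmf) (auto simp: nn_integral_pmf_eq_1)
  finally show ?thesis using that set_p ov pmf_p by auto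
qed

text \<open>Outcomes are eigenvalues, and the modulus of an eigenvalue is the factor by which
  \<open>A\<close> stretches a unit eigenvector. The mean is the trace formula written in the
  eigenbasis.\<close>

theorem outcome_pmf_properties:
  assumes A: "hermitian_mat d A" and \<sigma>: "qstate d \<sigma>" and c: "0 \<le> c"
    and Ac: "\<And>v. v \<in> carrier_vec d \<Longrightarrow> l2_norm (A *\<^sub>v v) \<le> c * l2_norm v"
  shows "finite (set_pmf (outcome_pmf d A \<sigma>))"
    and "\<And>x. x \<in> set_pmf (outcome_pmf d A \<sigma>) \<Longrightarrow> \<bar>x\<bar> \<le> c"
    and "complex_of_real (measure_pmf.expectation (outcome_pmf d A \<sigma>) (\<lambda>x. x)) = mat_trace (A * \<sigma>)"
proof -
  obtain V ev where V: "unitary_mat d V" and AV: "A = fcalc d V (\<lambda>m. complex_of_real (ev m))"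
    using hermitian_mat_spectral[OF A] by auto
  obtain p where out: "outcome_pmf d A \<sigma> = map_pmf ev p" and set_p: "set_pmf p \<subseteq> {..<d}"
    and pmf_p: "\<And>m. m < d \<Longrightarrow> overlap d V \<sigma> m = complex_of_real (pmf p m)"
    using outcome_pmf_fcalc[OF V \<sigma>, of ev] unfolding AV by metis
  have Vc: "V \<in> carrier_mat d d" using V by (simp add: unitary_mat_def)
  show "finite (set_pmf (outcome_pmf d A \<sigma>))"
    unfolding out using finite_subset[OF set_p] by simp
  fix x assume "x \<in> set_pmf (outcome_pmf d A \<sigma>)"
  then obtain m where m: "m < d" "x = ev m" using set_p unfolding out by auto
  have "l2_norm (A *\<^sub>v col V m) = \<bar>x\<bar>"
    unfolding AV fcalc_eigenvector[OF V m(1)] l2_norm_smult by (simp add: m unitary_mat_col_l2_norm[OF V])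
  then show "\<bar>x\<bar> \<le> c" using Ac[of "col V m"] Vc m(1) by (simp add: unitary_mat_col_l2_norm[OF V])
next
  obtain V ev where V: "unitary_mat d V" and AV: "A = fcalc d V (\<lambda>m. complex_of_real (ev m))"
    using hermitian_mat_spectral[OF A] by auto
  obtain p where out: "outcome_pmf d A \<sigma> = map_pmf ev p" and set_p: "set_pmf p \<subseteq> {..<d}"
    and pmf_p: "\<And>m. m < d \<Longrightarrow> overlap d V \<sigma> m = complex_of_real (pmf p m)"
    using outcome_pmf_fcalc[OF V \<sigma>, of ev] unfolding AV by metis
  have \<sigma>c: "\<sigma> \<in> carrier_mat d d" by (rule qstate_carrier[OF \<sigma>])
  have "measure_pmf.expectation (outcome_pmf d A \<sigma>) (\<lambda>x. x) = (\<Sum>m<d. ev m * pmf p m)"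
    unfolding out integral_map_pmf using set_p
    by (intro integral_measure_pmf_real) auto
  then show "complex_of_real (measure_pmf.expectation (outcome_pmf d A \<sigma>) (\<lambda>x. x)) = mat_trace (A * \<sigma>)"
    unfolding AV mat_trace_fcalc_mult[OF \<sigma>c] by (simp add: pmf_p)
qed

section \<open>Linear combinations of unitaries\<close>

lemma mat_sum_carrier [simp]: "mat_sum d F I \<in> carrier_mat d d"
  and mat_sum_dim [simp]: "dim_row (mat_sum d F I) = d" "dim_col (mat_sum d F I) = d"
  and mat_sum_index [simp]: "i < d \<Longrightarrow> j < d \<Longrightarrow> mat_sum d F I $$ (i, j) = (\<Sum>x\<in>I. F x $$ (i, j))"
  by (auto simp: mat_sum_def)

lemma mat_sum_cong: "I = J \<Longrightarrow> (\<And>x. x \<in> J \<Longrightarrow> F x = G x) \<Longrightarrow> mat_sum d F I = mat_sum d G J"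
  by (auto simp: mat_sum_def intro!: sum.cong eq_matI)

lemma mat_sum_mult_left:
  assumes A: "A \<in> carrier_mat d d" and F: "\<And>x. x \<in> I \<Longrightarrow> F x \<in> carrier_mat d d"
  shows "A * mat_sum d F I = mat_sum d (\<lambda>x. A * F x) I"
proof (rule eq_matI)
  fix i j assume ij: "i < dim_row (mat_sum d (\<lambda>x. A * F x) I)" "j < dim_col (mat_sum d (\<lambda>x. A * F x) I)"
  have "(A * mat_sum d F I) $$ (i, j) = (\<Sum>k<d. \<Sum>x\<in>I. A $$ (i, k) * F x $$ (k, j))"
    using A ij by (simp add: mult_mat_index sum_distrib_left del: index_mult_mat(1))
  also have "\<dots> = (\<Sum>x\<in>I. \<Sum>k<d. A $$ (i, k) * F x $$ (k, j))" by (rule sum.swap)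
  also have "\<dots> = mat_sum d (\<lambda>x. A * F x) I $$ (i, j)"
    using A F ij by (simp, intro sum.cong refl) (auto simp: mult_mat_index carrier_matD[OF F] simp del: index_mult_mat(1))
  finally show "(A * mat_sum d F I) $$ (i, j) = mat_sum d (\<lambda>x. A * F x) I $$ (i, j)" .
qed (use A in auto)

lemma mat_sum_mult_right:
  assumes A: "A \<in> carrier_mat d d" and F: "\<And>x. x \<in> I \<Longrightarrow> F x \<in> carrier_mat d d"
  shows "mat_sum d F I * A = mat_sum d (\<lambda>x. F x * A) I"
proof (rule eq_matI)
  fix i j assume ij: "i < dim_row (mat_sum d (\<lambda>x. F x * A) I)" "j < dim_col (mat_sum d (\<lambda>x. F x * A) I)"
  have "(mat_sum d F I * A) $$ (i, j) = (\<Sum>k<d. \<Sum>x\<in>I. F x $$ (i, k) * A $$ (k, j))"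
    using A ij by (simp add: mult_mat_index sum_distrib_right del: index_mult_mat(1))
  also have "\<dots> = (\<Sum>x\<in>I. \<Sum>k<d. F x $$ (i, k) * A $$ (k, j))" by (rule sum.swap)
  also have "\<dots> = mat_sum d (\<lambda>x. F x * A) I $$ (i, j)"
    using A F ij by (simp, intro sum.cong refl) (auto simp: mult_mat_index carrier_matD[OF F] simp del: index_mult_mat(1))
  finally show "(mat_sum d F I * A) $$ (i, j) = mat_sum d (\<lambda>x. F x * A) I $$ (i, j)" .
qed (use A in auto)

lemma mat_sum_smult:
  assumes "\<And>x. x \<in> I \<Longrightarrow> F x \<in> carrier_mat d d"
  shows "mat_sum d (\<lambda>x. c \<cdot>\<^sub>m F x) I = c \<cdot>\<^sub>m mat_sum d F I"
  by (rule eq_matI) (auto simp: sum_distrib_left carrier_matD[OF assms] intro!: sum.cong)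

lemma mat_sum_adjoint:
  assumes "\<And>x. x \<in> I \<Longrightarrow> F x \<in> carrier_mat d d"
  shows "mat_adjoint (mat_sum d F I) = mat_sum d (\<lambda>x. mat_adjoint (F x)) I"
  by (rule eq_matI) (auto simp: carrier_matD[OF assms] intro!: sum.cong)

lemma mat_sum_reindex: "inj_on h I \<Longrightarrow> mat_sum d F (h ` I) = mat_sum d (\<lambda>x. F (h x)) I"
  by (rule eq_matI) (auto simp: sum.reindex)

lemma mat_sum_Times:
  "mat_sum d F (I \<times> J) = mat_sum d (\<lambda>x. mat_sum d (\<lambda>y. F (x, y)) J) I"
  by (rule eq_matI) (auto simp: sum.cartesian_product)

lemma mat_sum_insert:
  "finite I \<Longrightarrow> x \<notin> I \<Longrightarrow> F x \<in> carrier_mat d d \<Longrightarrow> mat_sum d F (insert x I) = F x + mat_sum d F I"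
  by (rule eq_matI) auto

lemma mat_sum_fcalc: "mat_sum d (\<lambda>x. fcalc d V (g x)) I = fcalc d V (\<lambda>m. \<Sum>x\<in>I. g x m)"
  by (rule eq_matI) (auto simp: fcalc_index sum_distrib_left sum_distrib_right intro!: sum.swap)

lemma foldr_mat_carrier:
  "(\<And>x. x \<in> set xs \<Longrightarrow> F x \<in> carrier_mat d d) \<Longrightarrow> foldr (*) (map F xs) (1\<^sub>m d) \<in> carrier_mat d d"
  by (induction xs) (auto intro!: mult_carrier_mat)

lemma smult_smult_mat: "c \<cdot>\<^sub>m (b \<cdot>\<^sub>m A) = (c * b) \<cdot>\<^sub>m A" for A :: "complex mat"
  by (rule eq_matI) (auto simp: mult.assoc)

lemma one_smult_mat [simp]: "1 \<cdot>\<^sub>m A = (A :: complex mat)"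
  by (rule eq_matI) auto

lemma foldr_mat_smult:
  fixes c :: "'a \<Rightarrow> complex"
  assumes "\<And>x. x \<in> set xs \<Longrightarrow> F x \<in> carrier_mat d d"
  shows "foldr (*) (map (\<lambda>x. c x \<cdot>\<^sub>m F x) xs) (1\<^sub>m d)
    = prod_list (map c xs) \<cdot>\<^sub>m foldr (*) (map F xs) (1\<^sub>m d)"
  using assms
proof (induction xs)
  case Nil
  then show ?case by (auto intro!: eq_matI)
next
  case (Cons x xs)
  then have c: "F x \<in> carrier_mat d d" "foldr (*) (map F xs) (1\<^sub>m d) \<in> carrier_mat d d"
    by (auto intro: foldr_mat_carrier)
  have IH: "foldr (*) (map (\<lambda>x. c x \<cdot>\<^sub>m F x) xs) (1\<^sub>m d)
      = prod_list (map c xs) \<cdot>\<^sub>m foldr (*) (map F xs) (1\<^sub>m d)"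
    using Cons by simp
  have "(c x \<cdot>\<^sub>m F x) * (prod_list (map c xs) \<cdot>\<^sub>m foldr (*) (map F xs) (1\<^sub>m d))
      = prod_list (map c xs) \<cdot>\<^sub>m ((c x \<cdot>\<^sub>m F x) * foldr (*) (map F xs) (1\<^sub>m d))"
    using c by (intro mult_smult_distrib) auto
  also have "(c x \<cdot>\<^sub>m F x) * foldr (*) (map F xs) (1\<^sub>m d) = c x \<cdot>\<^sub>m (F x * foldr (*) (map F xs) (1\<^sub>m d))"
    using c by (intro mult_smult_assoc_mat)
  finally show ?case by (simp add: IH smult_smult_mat mult.commute)
qed

lemma foldr_mat_unitary:
  "(\<And>x. x \<in> set xs \<Longrightarrow> unitary_mat d (F x)) \<Longrightarrow> unitary_mat d (foldr (*) (map F xs) (1\<^sub>m d))"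
  by (induction xs) (auto intro: unitary_mat_mult unitary_mat_one)

text \<open>Matrix powers grow on the right, products over lists on the left.\<close>

lemma pow_mat_commute: "A \<in> carrier_mat d d \<Longrightarrow> A * A ^\<^sub>m n = A ^\<^sub>m n * A"
proof (induction n)
  case (Suc n)
  then show ?case
    using assoc_mult_mat[of A d d "A ^\<^sub>m n" d A d] by (simp add: pow_carrier_mat)
qed auto

text \<open>The noncommutative multinomial theorem: one term for each word of length
  \<open>n\<close>. It serves for the powers of the Hamiltonian inside a segment and again for the
  power of the whole segment.\<close>

lemma mat_sum_lists:
  assumes S: "finite S" and F: "\<And>x. x \<in> S \<Longrightarrow> F x \<in> carrier_mat d d"
  shows "mat_sum d (\<lambda>xs. foldr (*) (map F xs) (1\<^sub>m d)) {xs. set xs \<subseteq> S \<and> length xs = n} = mat_sum d F S ^\<^sub>m n"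
proof (induction n)
  case 0
  have "{xs. set xs \<subseteq> S \<and> length xs = 0} = {[]}" by auto
  then have "mat_sum d (\<lambda>xs. foldr (*) (map F xs) (1\<^sub>m d)) {xs. set xs \<subseteq> S \<and> length xs = 0} = 1\<^sub>m d"
    by (simp only:) (rule eq_matI, auto)
  then show ?case by (simp only: pow_mat.simps mat_sum_dim)
next
  case (Suc n)
  let ?L = "{xs. set xs \<subseteq> S \<and> length xs = n}"
  let ?P = "\<lambda>xs. foldr (*) (map F xs) (1\<^sub>m d)"
  have P: "?P xs \<in> carrier_mat d d" if "xs \<in> ?L" for xs
    using that F by (intro foldr_mat_carrier) auto
  have "{xs. set xs \<subseteq> S \<and> length xs = Suc n} = (\<lambda>(x, xs). x # xs) ` (S \<times> ?L)"
    by (force simp: length_Suc_conv image_iff)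
  then have "mat_sum d ?P {xs. set xs \<subseteq> S \<and> length xs = Suc n}
      = mat_sum d (\<lambda>y. ?P ((\<lambda>(x, xs). x # xs) y)) (S \<times> ?L)"
    by (simp only:, subst mat_sum_reindex) (auto simp: inj_on_def)
  also have "\<dots> = mat_sum d (\<lambda>x. mat_sum d (\<lambda>xs. F x * ?P xs) ?L) S"
    by (simp add: mat_sum_Times)
  also have "\<dots> = mat_sum d (\<lambda>x. F x * mat_sum d ?P ?L) S"
    using F P by (intro mat_sum_cong refl) (rule mat_sum_mult_left[symmetric], auto)
  also have "\<dots> = mat_sum d F S * mat_sum d ?P ?L"
    using F by (subst mat_sum_mult_right) auto
  also have "\<dots> = mat_sum d F S ^\<^sub>m Suc n"
    by (simp add: Suc.IH pow_mat_commute[of _ d])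
  finally show ?case .
qed

text \<open>The scalar counterpart, which evaluates the total weight of the words.\<close>

lemma sum_prod_list:
  fixes f :: "'a \<Rightarrow> real"
  assumes S: "finite S"
  shows "(\<Sum>xs | set xs \<subseteq> S \<and> length xs = n. prod_list (map f xs)) = (\<Sum>x\<in>S. f x) ^ n"
proof (induction n)
  case 0
  have "{xs. set xs \<subseteq> S \<and> length xs = 0} = {[]}" by auto
  then show ?case by simp
next
  case (Suc n)
  let ?L = "{xs. set xs \<subseteq> S \<and> length xs = n}"
  have "{xs. set xs \<subseteq> S \<and> length xs = Suc n} = (\<lambda>(x, xs). x # xs) ` (S \<times> ?L)"
    by (force simp: length_Suc_conv image_iff)
  then have "(\<Sum>xs | set xs \<subseteq> S \<and> length xs = Suc n. prod_list (map f xs))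
      = (\<Sum>(x, xs)\<in>S \<times> ?L. f x * prod_list (map f xs))"
    by (simp only:, subst sum.reindex) (auto simp: inj_on_def intro!: sum.cong)
  also have "\<dots> = (\<Sum>x\<in>S. f x) * (\<Sum>xs\<in>?L. prod_list (map f xs))"
    by (simp add: sum_product sum.cartesian_product)
  finally show ?case by (simp add: Suc.IH)
qed

section \<open>Rotations generated by Hermitian involutions\<close>

lemma fcalc_inj:
  assumes V: "unitary_mat d V" and eq: "fcalc d V g = fcalc d V h" and m: "m < d"
  shows "g m = h m"
proof -
  have Vc: "V \<in> carrier_mat d d" using V by (simp add: unitary_mat_def)
  have "fcalc d V (\<lambda>m. g m - h m) = 0\<^sub>m d d" unfolding fcalc_minus[symmetric] eq by (intro minus_r_inv_mat) auto
  then have "(g m - h m) \<cdot>\<^sub>v col V m = 0\<^sub>m d d *\<^sub>v col V m" using fcalc_eigenvector[OF V m, of "\<lambda>m. g m - h m"] by simp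
  also have "\<dots> = 0\<^sub>v d" using Vc by (intro eq_vecI) auto
  finally have "l2_norm ((g m - h m) \<cdot>\<^sub>v col V m) = 0" by simp
  then show ?thesis by (simp add: l2_norm_smult unitary_mat_col_l2_norm[OF V m])
qed

text \<open>The eigenvalues are 1 and -1, and at these two points exp(-i \<theta> x) coincides with
  the affine function cos \<theta> - i x sin \<theta>.\<close>

lemma mat_exp_involution:
  assumes P: "hermitian_mat d P" "P * P = 1\<^sub>m d"
  shows "mat_exp ((- \<i> * complex_of_real \<theta>) \<cdot>\<^sub>m P)
      = complex_of_real (cos \<theta>) \<cdot>\<^sub>m 1\<^sub>m d + (- \<i> * complex_of_real (sin \<theta>)) \<cdot>\<^sub>m P"
    and "unitary_mat d (mat_exp ((- \<i> * complex_of_real \<theta>) \<cdot>\<^sub>m P))"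
proof -
  obtain V ev where V: "unitary_mat d V" and PV: "P = fcalc d V (\<lambda>m. complex_of_real (ev m))"
    using hermitian_mat_spectral[OF P(1)] by auto
  have "fcalc d V (\<lambda>m. complex_of_real (ev m) * complex_of_real (ev m)) = fcalc d V (\<lambda>m. 1)"
    using P(2) unfolding PV fcalc_mult[OF V] fcalc_one[OF V] .
  then have "ev m * ev m = 1" if "m < d" for m
    using fcalc_inj[OF V _ that] by (metis of_real_eq_1_iff of_real_mult)
  then have ev: "ev m = 1 \<or> ev m = - 1" if "m < d" for m
    using that by (metis square_eq_1_iff)
  have exp: "exp (- \<i> * complex_of_real \<theta> * complex_of_real (ev m)) = cis (- \<theta> * ev m)" for m
    by (simp add: cis_conv_exp mult_ac)
  have E: "mat_exp ((- \<i> * complex_of_real \<theta>) \<cdot>\<^sub>m P) = fcalc d V (\<lambda>m. cis (- \<theta> * ev m))"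
    unfolding PV fcalc_smult mat_exp_fcalc[OF V] exp ..
  show "unitary_mat d (mat_exp ((- \<i> * complex_of_real \<theta>) \<cdot>\<^sub>m P))"
    unfolding E by (rule fcalc_unitary[OF V]) simp
  show "mat_exp ((- \<i> * complex_of_real \<theta>) \<cdot>\<^sub>m P)
      = complex_of_real (cos \<theta>) \<cdot>\<^sub>m 1\<^sub>m d + (- \<i> * complex_of_real (sin \<theta>)) \<cdot>\<^sub>m P"
    unfolding E unfolding PV fcalc_one[OF V, symmetric] fcalc_smult fcalc_add
    by (intro fcalc_cong) (use ev in \<open>force simp: complex_eq_iff\<close>)
qed

lemma unitary_mat_smult:
  assumes U: "unitary_mat d U" and c: "cmod c = 1"
  shows "unitary_mat d (c \<cdot>\<^sub>m U)"
proof -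
  have "cnj c * c = 1" using c by (metis complex_norm_square mult.commute of_real_1 power_one)
  moreover have Uc: "U \<in> carrier_mat d d" using U by (simp add: unitary_mat_def)
  ultimately show ?thesis
    using U by (simp add: unitary_mat_def mat_adjoint_smult mult_smult_distrib[of _ d d]
        mult_smult_assoc_mat[of _ d d] smult_smult_mat mult.commute)
qed

lemma hermitian_involution_unitary:
  "hermitian_mat d P \<Longrightarrow> P * P = 1\<^sub>m d \<Longrightarrow> unitary_mat d P"
  by (simp add: hermitian_mat_def unitary_mat_def)

lemma inverse_ge_1_bounds: "1 \<le> s \<Longrightarrow> 0 \<le> 1 / s" "1 \<le> s \<Longrightarrow> 1 / s \<le> 1" for s :: real
  by auto

text \<open>With s the square root and \<rho> the ratio, the angle has cosine 1/s and sine \<rho>/s.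
  Hence s times the rotation about an involution P is I - i \<rho> P, which pairs two consecutive
  Taylor orders.\<close>

lemma lcu_angle_cos: "sqrt (1 + (lcu_ratio \<tau> r k)\<^sup>2) * cos (lcu_angle \<tau> r k) = 1"
proof -
  let ?s = "sqrt (1 + (lcu_ratio \<tau> r k)\<^sup>2)"
  have "1 \<le> ?s" by simp
  then have "0 \<le> 1 / ?s" "1 / ?s \<le> 1" by (rule inverse_ge_1_bounds)+
  then have "cos (lcu_angle \<tau> r k) = 1 / ?s"
    unfolding lcu_angle_def by (intro cos_arccos) linarith+
  moreover have "?s \<noteq> 0" using \<open>1 \<le> ?s\<close> by linarith
  ultimately show ?thesis by (metis divide_self mult_1_right times_divide_eq_right)
qed

lemma lcu_angle_sin:
  assumes "0 \<le> lcu_ratio \<tau> r k"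
  shows "sqrt (1 + (lcu_ratio \<tau> r k)\<^sup>2) * sin (lcu_angle \<tau> r k) = lcu_ratio \<tau> r k"
proof -
  let ?\<rho> = "lcu_ratio \<tau> r k"
  let ?s = "sqrt (1 + ?\<rho>\<^sup>2)"
  have s: "1 \<le> ?s" by simp
  have s2: "?s\<^sup>2 = 1 + ?\<rho>\<^sup>2" by (simp add: add_nonneg_nonneg)
  have "0 \<le> 1 / ?s" "1 / ?s \<le> 1" using s by (rule inverse_ge_1_bounds)+
  then have "sin (lcu_angle \<tau> r k) = sqrt (1 - (1 / ?s)\<^sup>2)"
    unfolding lcu_angle_def by (intro sin_arccos) linarith+
  also have "1 - (1 / ?s)\<^sup>2 = (?\<rho> / ?s)\<^sup>2"
  proof -
    have frac: "1 - 1 / (1 + t) = t / (1 + t)" if "0 \<le> t" for t :: real using that by (simp add: field_simps)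
    show ?thesis unfolding power_divide s2 power_one by (rule frac) simp
  qed
  finally have "sin (lcu_angle \<tau> r k) = ?\<rho> / ?s" using assms s by (simp only: real_sqrt_abs abs_of_nonneg divide_nonneg_nonneg)
  moreover have "?s \<noteq> 0" using s by linarith
  ultimately show ?thesis by (metis nonzero_mult_div_cancel_left times_divide_eq_right)
qed

lemma lcu_blocks_eq:
  "lcu_blocks L q = (\<Union>k\<in>{k. k \<le> q \<and> even k}. {ls. set ls \<subseteq> {..<L} \<and> length ls = k}) \<times> {..<L}"
  by (auto simp: lcu_blocks_def)

lemma finite_lcu_blocks: "finite (lcu_blocks L q)"
  unfolding lcu_blocks_eq by (auto intro!: finite_lists_length_eq)

lemma mat_sum_UNION:
  assumes "finite K" "\<And>k. k \<in> K \<Longrightarrow> finite (B k)" "\<And>k l. k \<in> K \<Longrightarrow> l \<in> K \<Longrightarrow> k \<noteq> l \<Longrightarrow> B k \<inter> B l = {}"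
  shows "mat_sum d F (\<Union>k\<in>K. B k) = mat_sum d (\<lambda>k. mat_sum d F (B k)) K"
  using assms by (intro eq_matI) (auto simp: sum.UNION_disjoint)

lemma prod_list_of_real: "prod_list (map (\<lambda>x. complex_of_real (f x)) xs) = complex_of_real (prod_list (map f xs))"
  by (induction xs) auto

text \<open>Every even order carries its odd successor, so the even truncation order 2n produces the
  Taylor polynomial of degree 2n + 1.\<close>

lemma sum_even_pairs: "(\<Sum>k | k \<le> 2 * n \<and> even k. a k + a (Suc k)) = (\<Sum>k\<le>Suc (2 * n). a k)"
  for a :: "nat \<Rightarrow> 'a::comm_monoid_add"
proof (induction n)
  case 0
  have "{k. k \<le> 2 * 0 \<and> even k} = {0::nat}" by auto
  then show ?case by simp
next
  case (Suc n)
  have eq: "{k. k \<le> 2 * Suc n \<and> even k} = insert (2 * Suc n) {k. k \<le> 2 * n \<and> even k}"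
    by (auto simp: le_Suc_eq)
  show ?case unfolding eq
    by (subst sum.insert) (simp_all add: Suc.IH add_ac)
qed

text \<open>Telescoping, one factor at a time. The exponent \<open>n\<close> in place of n - 1 only
  loosens the bound, since M is at least 1.\<close>

lemma norm_power_diff_le:
  fixes a b :: complex
  assumes "cmod a \<le> M" "cmod b \<le> M" "1 \<le> M"
  shows "cmod (a ^ n - b ^ n) \<le> real n * M ^ n * cmod (a - b)"
proof (induction n)
  case (Suc n)
  have "cmod (a ^ Suc n - b ^ Suc n) = cmod (a * (a ^ n - b ^ n) + b ^ n * (a - b))"
    by (simp add: algebra_simps)
  also have "\<dots> \<le> cmod a * cmod (a ^ n - b ^ n) + cmod b ^ n * cmod (a - b)"
    by (rule order_trans[OF norm_triangle_ineq]) (simp add: norm_mult norm_power)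
  also have "\<dots> \<le> M * (real n * M ^ n * cmod (a - b)) + M ^ n * cmod (a - b)"
    using assms by (intro add_mono mult_mono Suc.IH mult_right_mono power_mono) auto
  also have "M ^ n * cmod (a - b) \<le> M * M ^ n * cmod (a - b)"
    using assms by (intro mult_right_mono) auto
  finally show ?case by (simp add: algebra_simps)
qed simp

text \<open>The Taylor remainder \<eta> of one segment is amplified by r and by (1 + \<eta>)^r,
  which stays below 2. The power x^(2n+2) is weakened to x^2, not to 1: the numerator r x^2 will be
  \<tau>^2/r.\<close>

lemma truncated_exp_power_error:
  fixes x y :: real
  assumes y: "\<bar>y\<bar> \<le> x" and x: "x \<le> 1" and r: "real r * x\<^sup>2 \<le> 1"
  shows "cmod ((\<Sum>k\<le>Suc (2 * n). (- \<i> * complex_of_real y) ^ k / fact k) ^ r - exp (- \<i> * complex_of_real (real r * y)))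
    \<le> 2 * (real r * x\<^sup>2) / fact (2 * n + 2)"
proof -
  let ?p = "\<Sum>k\<le>Suc (2 * n). (- \<i> * complex_of_real y) ^ k / fact k"
  let ?z = "exp (- \<i> * complex_of_real y)"
  define \<eta> where "\<eta> = x\<^sup>2 / fact (2 * n + 2)"
  have x0: "0 \<le> x" using y by linarith
  have \<eta>0: "0 \<le> \<eta>" by (simp add: \<eta>_def)
  have "cmod (?z - ?p) \<le> \<bar>y\<bar> ^ (2 * n + 2) / fact (2 * n + 2)"
    using iexp_approx1[of "- y" "Suc (2 * n)"] by simp
  also have "\<dots> \<le> \<eta>"
  proof -
    have "\<bar>y\<bar> ^ (2 * n + 2) \<le> x ^ (2 * n + 2)" using y by (intro power_mono) auto
    also have "\<dots> \<le> x ^ 2" using x x0 by (intro power_decreasing) auto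
    finally show ?thesis unfolding \<eta>_def by (intro divide_right_mono) auto
  qed
  finally have diff: "cmod (?p - ?z) \<le> \<eta>" by (simp add: norm_minus_commute)
  have z: "cmod ?z = 1" using norm_exp_i_times[of "- y"] by simp
  have "cmod ?p \<le> 1 + \<eta>" using norm_triangle_sub[of ?p ?z] diff z by linarith
  then have "cmod (?p ^ r - ?z ^ r) \<le> real r * (1 + \<eta>) ^ r * cmod (?p - ?z)"
    using z \<eta>0 by (intro norm_power_diff_le) auto
  also have "\<dots> \<le> real r * 2 * \<eta>"
  proof (intro mult_mono diff mult_left_mono)
    \<comment> \<open>A factorial of at least 2 gives r \<eta> \<le> 1/2, and exp(1/2) is at most 1
      + 1/2 + 1/4.\<close>
    have "2 \<le> (fact (2 * n + 2) :: real)" using fact_mono[of 2 "2 * n + 2", where 'a=real] by (simp add: fact_2)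
    then have "\<eta> \<le> x\<^sup>2 / 2" unfolding \<eta>_def by (intro divide_left_mono) auto
    then have "real r * \<eta> \<le> real r * (x\<^sup>2 / 2)" by (intro mult_left_mono) auto
    then have r\<eta>: "real r * \<eta> \<le> 1 / 2" using r by simp
    have "(1 + \<eta>) ^ r \<le> exp \<eta> ^ r" using \<eta>0 exp_ge_add_one_self[of \<eta>] by (intro power_mono) auto
    also have "\<dots> = exp (real r * \<eta>)" by (simp add: exp_of_nat_mult)
    also have "\<dots> \<le> exp (1 / 2)" using r\<eta> by simp
    also have "\<dots> \<le> 1 + 1 / 2 + (1 / 2)\<^sup>2" by (rule exp_bound) auto
    also have "\<dots> \<le> 2" by (simp add: power2_eq_square)
    finally show "(1 + \<eta>) ^ r \<le> 2" .
  qed (use \<eta>0 in auto)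
  also have "\<dots> = 2 * (real r * x\<^sup>2) / fact (2 * n + 2)" by (simp add: \<eta>_def)
  also have "?z ^ r = exp (- \<i> * complex_of_real (real r * y))"
    by (simp add: mult_ac flip: exp_of_nat_mult)
  finally show ?thesis .
qed

lemma l2_norm_mat_sum_le:
  assumes "finite I" "\<And>x. x \<in> I \<Longrightarrow> F x \<in> carrier_mat d d" and v: "v \<in> carrier_vec d"
  shows "l2_norm (mat_sum d F I *\<^sub>v v) \<le> (\<Sum>x\<in>I. l2_norm (F x *\<^sub>v v))"
  using assms(1,2)
proof (induction I rule: finite_induct)
  case empty
  have "mat_sum d F {} = 0\<^sub>m d d" by (intro eq_matI) auto
  moreover have "0\<^sub>m d d *\<^sub>v v = 0\<^sub>v d" using v by (intro eq_vecI) auto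
  ultimately show ?case by simp
next
  case (insert x I)
  have "mat_sum d F (insert x I) *\<^sub>v v = F x *\<^sub>v v + mat_sum d F I *\<^sub>v v"
    using insert v by (simp add: mat_sum_insert add_mult_distrib_mat_vec[of _ d d])
  then have "l2_norm (mat_sum d F (insert x I) *\<^sub>v v) \<le> l2_norm (F x *\<^sub>v v) + l2_norm (mat_sum d F I *\<^sub>v v)"
    using insert by (simp, intro l2_norm_triangle) auto
  also have "\<dots> \<le> l2_norm (F x *\<^sub>v v) + (\<Sum>x\<in>I. l2_norm (F x *\<^sub>v v))"
    using insert by (intro add_left_mono insert.IH) auto
  finally show ?case using insert by simp
qed

text \<open>These properties of normalised signed Pauli strings are all that the analysis of the
  series uses: convex weights and Hermitian matrices with square one. The positive dimension is what
  \<open>spectral_norm_le\<close> asks for.\<close>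

locale lcu_terms =
  fixes d :: nat and ts :: "(real \<times> complex mat) list"
  assumes dim_pos: "0 < d"
    and terms: "\<And>p P. (p, P) \<in> set ts \<Longrightarrow> 0 \<le> p \<and> hermitian_mat d P \<and> P * P = 1\<^sub>m d"
    and sum_terms: "sum_list (map fst ts) = 1"
begin

definition ham :: "complex mat" where
  "ham = mat_sum d (\<lambda>l. complex_of_real (fst (ts ! l)) \<cdot>\<^sub>m snd (ts ! l)) {..<length ts}"

lemma term_nth:
  assumes "l < length ts"
  shows "0 \<le> fst (ts ! l)" "hermitian_mat d (snd (ts ! l))" "snd (ts ! l) * snd (ts ! l) = 1\<^sub>m d"
    "snd (ts ! l) \<in> carrier_mat d d" "unitary_mat d (snd (ts ! l))"
  using terms[of "fst (ts ! l)" "snd (ts ! l)"] nth_mem[OF assms] hermitian_involution_unitary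
  by (auto simp: hermitian_mat_def)

lemma sum_term: "(\<Sum>l<length ts. fst (ts ! l)) = 1"
  using sum_terms by (simp add: sum_list_sum_nth atLeast0LessThan)

text \<open>The weights have sum 1, so the identity parts of the rotations combine to one identity
  and the remaining parts to the Hamiltonian.\<close>

lemma rotations_sum:
  "mat_sum d (\<lambda>m. complex_of_real (fst (ts ! m)) \<cdot>\<^sub>m
      mat_exp ((- \<i> * complex_of_real \<theta>) \<cdot>\<^sub>m snd (ts ! m))) {..<length ts}
   = complex_of_real (cos \<theta>) \<cdot>\<^sub>m 1\<^sub>m d + (- \<i> * complex_of_real (sin \<theta>)) \<cdot>\<^sub>m ham" (is "?A = ?B")
proof (rule eq_matI)
  fix i j assume "i < dim_row ?B" "j < dim_col ?B"
  then have ij: "i < d" "j < d" by (auto simp: ham_def)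
  have c: "dim_row (snd (ts ! m)) = d" "dim_col (snd (ts ! m)) = d" if "m < length ts" for m
    using term_nth(4)[OF that] by auto
  have entry: "(complex_of_real (fst (ts ! m)) \<cdot>\<^sub>m mat_exp ((- \<i> * complex_of_real \<theta>) \<cdot>\<^sub>m snd (ts ! m))) $$ (i, j)
      = complex_of_real (fst (ts ! m)) * (complex_of_real (cos \<theta>) * (1\<^sub>m d) $$ (i, j))
      + (- \<i> * complex_of_real (sin \<theta>)) * (complex_of_real (fst (ts ! m)) * snd (ts ! m) $$ (i, j))"
    if "m \<in> {..<length ts}" for m
  proof -
    have m: "m < length ts" using that by simp
    show ?thesis unfolding mat_exp_involution(1)[OF term_nth(2,3)[OF m]]
      using ij c[OF m] by (simp add: algebra_simps)
  qed
  have "?A $$ (i, j) = (\<Sum>m<length ts. complex_of_real (fst (ts ! m)) * (complex_of_real (cos \<theta>) * (1\<^sub>m d) $$ (i, j))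
      + (- \<i> * complex_of_real (sin \<theta>)) * (complex_of_real (fst (ts ! m)) * snd (ts ! m) $$ (i, j)))"
    unfolding mat_sum_index[OF ij] by (rule sum.cong[OF refl entry])
  also have "\<dots> = complex_of_real (\<Sum>m<length ts. fst (ts ! m)) * (complex_of_real (cos \<theta>) * (1\<^sub>m d) $$ (i, j))
      + (- \<i> * complex_of_real (sin \<theta>)) * (\<Sum>m<length ts. complex_of_real (fst (ts ! m)) * snd (ts ! m) $$ (i, j))"
    by (simp only: sum.distrib sum_distrib_left sum_distrib_right of_real_sum)
  also have "\<dots> = ?B $$ (i, j)"
    unfolding sum_term using ij c by (simp add: ham_def)
  finally show "?A $$ (i, j) = ?B $$ (i, j)" .
qed (auto simp: ham_def)

text \<open>The segment is a polynomial in \<open>ham\<close>, hence diagonal in its eigenbasis. For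
  fixed word length k, the sum over words gives the k-th power of \<open>ham\<close>, the sum over m
  the mean rotation, and their product the Taylor terms of orders k and k + 1.\<close>

lemma lcu_segment_fcalc:
  assumes V: "unitary_mat d V" and H: "ham = fcalc d V g" and \<tau>: "0 \<le> \<tau>"
  shows "lcu_segment d ts \<tau> r (2 * n)
    = fcalc d V (\<lambda>m. \<Sum>k\<le>Suc (2 * n). (- \<i> * complex_of_real (\<tau> / real r) * g m) ^ k / fact k)"
proof -
  let ?x = "\<tau> / real r"
  let ?L = "length ts"
  let ?P = "\<lambda>ls. foldr (*) (map (\<lambda>l. snd (ts ! l)) ls) (1\<^sub>m d)"
  let ?p = "\<lambda>ls. complex_of_real (prod_list (map (\<lambda>l. fst (ts ! l)) ls))"
  let ?E = "\<lambda>k m. mat_exp ((- \<i> * complex_of_real (lcu_angle \<tau> r k)) \<cdot>\<^sub>m snd (ts ! m))"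
  let ?w = "\<lambda>k. (- \<i>) ^ k * complex_of_real (?x ^ k / fact k * sqrt (1 + (lcu_ratio \<tau> r k)\<^sup>2))"
  let ?F = "\<lambda>b. complex_of_real (block_coeff ts \<tau> r b) \<cdot>\<^sub>m block_unitary d ts \<tau> r b"
  let ?lists = "\<lambda>k. {ls. set ls \<subseteq> {..<?L} \<and> length ls = k}"
  let ?R = "\<lambda>k. fcalc d V (\<lambda>m. complex_of_real (cos (lcu_angle \<tau> r k)) - \<i> * complex_of_real (sin (lcu_angle \<tau> r k)) * g m)"
  have P: "?P ls \<in> carrier_mat d d" if "set ls \<subseteq> {..<?L}" for ls
    using that by (intro foldr_mat_carrier term_nth(4)) auto
  have E: "?E k m \<in> carrier_mat d d" if "m < ?L" for k m
    using mat_exp_involution(2)[OF term_nth(2,3)[OF that]] by (auto simp: unitary_mat_def)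
  have R: "mat_sum d (\<lambda>m. complex_of_real (fst (ts ! m)) \<cdot>\<^sub>m ?E k m) {..<?L} = ?R k" for k
    unfolding rotations_sum H fcalc_one[OF V, symmetric] fcalc_smult fcalc_add by (intro fcalc_cong) simp
  have inner: "mat_sum d (\<lambda>m. ?F (ls, m)) {..<?L} = ?w k \<cdot>\<^sub>m ((?p ls \<cdot>\<^sub>m ?P ls) * ?R k)"
    if ls: "ls \<in> ?lists k" for ls k
  proof -
    have "mat_sum d (\<lambda>m. ?F (ls, m)) {..<?L}
        = mat_sum d (\<lambda>m. ?w k \<cdot>\<^sub>m ((?p ls \<cdot>\<^sub>m ?P ls) * (complex_of_real (fst (ts ! m)) \<cdot>\<^sub>m ?E k m))) {..<?L}"
    proof (intro mat_sum_cong refl)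
      fix m assume m: "m \<in> {..<?L}"
      then show "?F (ls, m) = ?w k \<cdot>\<^sub>m ((?p ls \<cdot>\<^sub>m ?P ls) * (complex_of_real (fst (ts ! m)) \<cdot>\<^sub>m ?E k m))"
        using ls P[of ls] E[of m k]
        by (simp add: mult_smult_distrib[of _ d d] mult_smult_assoc_mat[of _ d d] smult_smult_mat mult_ac)
    qed
    also have "\<dots> = ?w k \<cdot>\<^sub>m mat_sum d (\<lambda>m. (?p ls \<cdot>\<^sub>m ?P ls) * (complex_of_real (fst (ts ! m)) \<cdot>\<^sub>m ?E k m)) {..<?L}"
      using ls P[of ls] E by (intro mat_sum_smult mult_carrier_mat[of _ d d]) auto
    also have "mat_sum d (\<lambda>m. (?p ls \<cdot>\<^sub>m ?P ls) * (complex_of_real (fst (ts ! m)) \<cdot>\<^sub>m ?E k m)) {..<?L}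
        = (?p ls \<cdot>\<^sub>m ?P ls) * ?R k"
      unfolding R[symmetric] using ls P[of ls] E by (intro mat_sum_mult_left[symmetric]) auto
    finally show ?thesis .
  qed
  have pow: "mat_sum d (\<lambda>ls. ?p ls \<cdot>\<^sub>m ?P ls) (?lists k) = ham ^\<^sub>m k" for k
    unfolding ham_def
    by (subst mat_sum_lists[symmetric], simp, use term_nth(4) in force, intro mat_sum_cong refl,
        subst foldr_mat_smult) (use term_nth(4) in \<open>auto simp: prod_list_of_real\<close>)
  have outer: "mat_sum d (\<lambda>ls. mat_sum d (\<lambda>m. ?F (ls, m)) {..<?L}) (?lists k)
      = fcalc d V (\<lambda>m. (- \<i> * complex_of_real ?x * g m) ^ k / fact k
          + (- \<i> * complex_of_real ?x * g m) ^ Suc k / fact (Suc k))" for k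
  proof -
    let ?\<theta> = "lcu_angle \<tau> r k" and ?s = "sqrt (1 + (lcu_ratio \<tau> r k)\<^sup>2)"
    have "mat_sum d (\<lambda>ls. mat_sum d (\<lambda>m. ?F (ls, m)) {..<?L}) (?lists k)
        = mat_sum d (\<lambda>ls. ?w k \<cdot>\<^sub>m ((?p ls \<cdot>\<^sub>m ?P ls) * ?R k)) (?lists k)"
      by (intro mat_sum_cong refl inner)
    also have "\<dots> = ?w k \<cdot>\<^sub>m (mat_sum d (\<lambda>ls. ?p ls \<cdot>\<^sub>m ?P ls) (?lists k) * ?R k)"
      using P by (subst mat_sum_smult, force intro!: mult_carrier_mat[of _ d d], subst mat_sum_mult_right) auto
    also have "\<dots> = fcalc d V (\<lambda>m. ?w k * (g m ^ k *
        (complex_of_real (cos ?\<theta>) - \<i> * complex_of_real (sin ?\<theta>) * g m)))"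
      unfolding pow unfolding H fcalc_pow[OF V] fcalc_mult[OF V] fcalc_smult ..
    also have "\<dots> = fcalc d V (\<lambda>m. (- \<i> * complex_of_real ?x * g m) ^ k / fact k
          + (- \<i> * complex_of_real ?x * g m) ^ Suc k / fact (Suc k))"
    proof (rule fcalc_cong)
      fix m
      \<comment> \<open>The square root turns the cosine into 1 and the sine into x/(k + 1), the
        factor that leads from Taylor order k to order k + 1.\<close>
      have c: "complex_of_real ?s * complex_of_real (cos ?\<theta>) = 1"
        unfolding of_real_mult[symmetric] lcu_angle_cos by simp
      have s: "complex_of_real ?s * complex_of_real (sin ?\<theta>) = complex_of_real (?x / real (Suc k))"
        unfolding of_real_mult[symmetric] using \<tau> by (subst lcu_angle_sin) (auto simp: lcu_ratio_def)
      have "?w k * (g m ^ k * (complex_of_real (cos ?\<theta>) - \<i> * complex_of_real (sin ?\<theta>) * g m))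
          = ((- \<i>) ^ k * complex_of_real (?x ^ k / fact k) * g m ^ k)
            * (complex_of_real ?s * complex_of_real (cos ?\<theta>)
               - \<i> * (complex_of_real ?s * complex_of_real (sin ?\<theta>)) * g m)"
        by (simp only: of_real_mult) (simp only: algebra_simps)
      also have "\<dots> = (- \<i> * complex_of_real ?x * g m) ^ k / fact k
          * (1 + (- \<i> * complex_of_real ?x * g m) / of_nat (Suc k))"
        unfolding c s by (simp only: power_mult_distrib) (simp add: mult_ac del: of_nat_Suc)
      also have "\<dots> = (- \<i> * complex_of_real ?x * g m) ^ k / fact k
          + (- \<i> * complex_of_real ?x * g m) ^ Suc k / fact (Suc k)"
        by (simp only: distrib_left mult_1_right power_Suc2 fact_Suc times_divide_times_eq mult.commute[of "of_nat (Suc k)"])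
      finally show "?w k * (g m ^ k * (complex_of_real (cos ?\<theta>) - \<i> * complex_of_real (sin ?\<theta>) * g m))
        = (- \<i> * complex_of_real ?x * g m) ^ k / fact k
          + (- \<i> * complex_of_real ?x * g m) ^ Suc k / fact (Suc k)" .
    qed
    finally show ?thesis .
  qed
  \<comment> \<open>The blocks are grouped by word length, the Taylor order.\<close>
  have "lcu_segment d ts \<tau> r (2 * n)
      = mat_sum d (\<lambda>k. mat_sum d (\<lambda>ls. mat_sum d (\<lambda>m. ?F (ls, m)) {..<?L}) (?lists k)) {k. k \<le> 2 * n \<and> even k}"
    unfolding lcu_segment_def lcu_blocks_eq mat_sum_Times
    by (rule mat_sum_UNION) (auto intro: finite_lists_length_eq)
  also have "\<dots> = fcalc d V (\<lambda>m. \<Sum>k | k \<le> 2 * n \<and> even k. (- \<i> * complex_of_real ?x * g m) ^ k / fact k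
          + (- \<i> * complex_of_real ?x * g m) ^ Suc k / fact (Suc k))"
    unfolding outer mat_sum_fcalc ..
  finally show ?thesis unfolding sum_even_pairs[of "\<lambda>k. (- \<i> * complex_of_real ?x * g _) ^ k / fact k"] .
qed

lemma lcu_approx_fcalc:
  assumes V: "unitary_mat d V" and H: "ham = fcalc d V g" and \<tau>: "0 \<le> \<tau>"
  shows "lcu_approx d ts \<tau> r (2 * n)
    = fcalc d V (\<lambda>m. (\<Sum>k\<le>Suc (2 * n). (- \<i> * complex_of_real (\<tau> / real r) * g m) ^ k / fact k) ^ r)"
  unfolding lcu_approx_def lcu_segment_fcalc[OF assms] fcalc_pow[OF V] ..

lemma block_unitary_unitary:
  assumes b: "b \<in> lcu_blocks (length ts) q"
  shows "unitary_mat d (block_unitary d ts \<tau> r b)"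
proof -
  obtain ls m where bl: "b = (ls, m)" by (cases b)
  have lm: "set ls \<subseteq> {..<length ts}" "m < length ts" using b by (auto simp: bl lcu_blocks_def)
  show ?thesis unfolding bl block_unitary.simps
    using lm by (intro unitary_mat_smult unitary_mat_mult foldr_mat_unitary term_nth(5)
        mat_exp_involution(2) term_nth(2,3)) (auto simp: norm_power)
qed

lemma block_unitary_carrier:
  "b \<in> lcu_blocks (length ts) q \<Longrightarrow> block_unitary d ts \<tau> r b \<in> carrier_mat d d"
  using block_unitary_unitary by (simp add: unitary_mat_def)

lemma lcu_unitary_unitary:
  "bs \<in> lcu_indices (length ts) r' q \<Longrightarrow> unitary_mat d (lcu_unitary d ts \<tau> r bs)"
  unfolding lcu_unitary_def lcu_indices_def
  by (intro foldr_mat_unitary block_unitary_unitary) auto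

lemma lcu_indices_eq: "lcu_indices L r q = {bs. set bs \<subseteq> lcu_blocks L q \<and> length bs = r}"
  by (auto simp: lcu_indices_def)

lemma finite_lcu_indices: "finite (lcu_indices L r q)"
  unfolding lcu_indices_eq by (intro finite_lists_length_eq finite_lcu_blocks)

text \<open>Along a word of blocks the scalars and the unitaries multiply separately; this
  identifies the expanded power with the combination of the sampled unitaries.\<close>

lemma lcu_approx_expansion:
  "lcu_approx d ts \<tau> r q = mat_sum d
     (\<lambda>bs. complex_of_real (lcu_coeff ts \<tau> r bs) \<cdot>\<^sub>m lcu_unitary d ts \<tau> r bs) (lcu_indices (length ts) r q)"
proof -
  let ?F = "\<lambda>b. complex_of_real (block_coeff ts \<tau> r b) \<cdot>\<^sub>m block_unitary d ts \<tau> r b"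
  have c: "?F b \<in> carrier_mat d d" if "b \<in> lcu_blocks (length ts) q" for b
    using block_unitary_carrier[OF that] by simp
  have "lcu_approx d ts \<tau> r q
      = mat_sum d (\<lambda>bs. foldr (*) (map ?F bs) (1\<^sub>m d)) {bs. set bs \<subseteq> lcu_blocks (length ts) q \<and> length bs = r}"
    unfolding lcu_approx_def lcu_segment_def using mat_sum_lists[OF finite_lcu_blocks c] by simp
  also have "\<dots> = mat_sum d (\<lambda>bs. complex_of_real (lcu_coeff ts \<tau> r bs) \<cdot>\<^sub>m lcu_unitary d ts \<tau> r bs)
      (lcu_indices (length ts) r q)"
  proof (rule mat_sum_cong[OF lcu_indices_eq[symmetric]])
    fix bs assume "bs \<in> lcu_indices (length ts) r q"
    then have "foldr (*) (map ?F bs) (1\<^sub>m d)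
        = prod_list (map (\<lambda>b. complex_of_real (block_coeff ts \<tau> r b)) bs) \<cdot>\<^sub>m foldr (*) (map (block_unitary d ts \<tau> r) bs) (1\<^sub>m d)"
      by (intro foldr_mat_smult) (auto simp: lcu_indices_def intro: block_unitary_carrier)
    then show "foldr (*) (map ?F bs) (1\<^sub>m d) = complex_of_real (lcu_coeff ts \<tau> r bs) \<cdot>\<^sub>m lcu_unitary d ts \<tau> r bs"
      by (simp add: lcu_coeff_def lcu_unitary_def prod_list_of_real)
  qed
  finally show ?thesis .
qed

lemma block_coeff_nonneg:
  assumes b: "b \<in> lcu_blocks (length ts) q" and \<tau>: "0 \<le> \<tau>"
  shows "0 \<le> block_coeff ts \<tau> r b"
proof -
  obtain ls m where bl: "b = (ls, m)" by (cases b)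
  have lm: "set ls \<subseteq> {..<length ts}" "m < length ts" using b by (auto simp: bl lcu_blocks_def)
  have "0 \<le> prod_list (map (\<lambda>l. fst (ts ! l)) ls)"
    using lm term_nth(1) by (intro prod_list_nonneg) auto
  then show ?thesis using term_nth(1)[OF lm(2)] \<tau> by (simp add: bl)
qed

lemma lcu_coeff_nonneg:
  "bs \<in> lcu_indices (length ts) r' q \<Longrightarrow> 0 \<le> \<tau> \<Longrightarrow> 0 \<le> lcu_coeff ts \<tau> r bs"
  unfolding lcu_coeff_def lcu_indices_def by (intro prod_list_nonneg) (auto intro: block_coeff_nonneg)

text \<open>Words of length k have total weight 1, and so has the final index, so only the
  dependence on the order k is left.\<close>

lemma sum_block_coeff:
  "(\<Sum>b\<in>lcu_blocks (length ts) q. block_coeff ts \<tau> r b)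
   = (\<Sum>k | k \<le> q \<and> even k. (\<tau> / real r) ^ k / fact k * sqrt (1 + (lcu_ratio \<tau> r k)\<^sup>2))"
proof -
  let ?w = "\<lambda>k. (\<tau> / real r) ^ k / fact k * sqrt (1 + (lcu_ratio \<tau> r k)\<^sup>2)"
  let ?lists = "\<lambda>k. {ls. set ls \<subseteq> {..<length ts} \<and> length ls = k}"
  let ?p = "\<lambda>ls. prod_list (map (\<lambda>l. fst (ts ! l)) ls)"
  have "(\<Sum>b\<in>lcu_blocks (length ts) q. block_coeff ts \<tau> r b)
      = (\<Sum>ls\<in>(\<Union>k\<in>{k. k \<le> q \<and> even k}. ?lists k). \<Sum>m<length ts. block_coeff ts \<tau> r (ls, m))"
    unfolding lcu_blocks_eq sum.cartesian_product by (intro sum.cong) auto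
  also have "\<dots> = (\<Sum>ls\<in>(\<Union>k\<in>{k. k \<le> q \<and> even k}. ?lists k). ?w (length ls) * ?p ls)"
    by (simp only: block_coeff.simps sum_distrib_left[symmetric] sum_term mult_1_right)
  also have "\<dots> = (\<Sum>k | k \<le> q \<and> even k. \<Sum>ls\<in>?lists k. ?w (length ls) * ?p ls)"
    by (rule sum.UNION_disjoint) (auto intro: finite_lists_length_eq)
  also have "\<dots> = (\<Sum>k | k \<le> q \<and> even k. ?w k * (\<Sum>ls\<in>?lists k. ?p ls))"
    unfolding sum_distrib_left by (intro sum.cong refl) auto
  also have "\<dots> = (\<Sum>k | k \<le> q \<and> even k. ?w k)"
    by (simp add: sum_prod_list sum_term)
  finally show ?thesis .
qed

lemma lcu_weight_eq:
  assumes \<tau>: "0 \<le> \<tau>"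
  shows "lcu_weight ts \<tau> r q
    = (\<Sum>k | k \<le> q \<and> even k. (\<tau> / real r) ^ k / fact k * sqrt (1 + (lcu_ratio \<tau> r k)\<^sup>2)) ^ r"
proof -
  have "lcu_weight ts \<tau> r q = (\<Sum>bs\<in>lcu_indices (length ts) r q. lcu_coeff ts \<tau> r bs)"
    unfolding lcu_weight_def using \<tau> by (intro sum.cong refl abs_of_nonneg lcu_coeff_nonneg)
  also have "\<dots> = (\<Sum>b\<in>lcu_blocks (length ts) q. block_coeff ts \<tau> r b) ^ r"
    unfolding lcu_indices_eq lcu_coeff_def by (rule sum_prod_list[OF finite_lcu_blocks])
  finally show ?thesis unfolding sum_block_coeff .
qed

text \<open>The term of order 0 is already at least 1. For the upper bound let x be the time of a
  segment: the square roots are at most exp(x^2/2), the even series is at most cosh x and thus also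
  at most exp(x^2/2), and the r-th power of exp(x^2) is exp(\<tau>^2/r).\<close>

lemma lcu_weight_bounds:
  assumes \<tau>: "0 \<le> \<tau>" and r: "0 < r"
  shows "1 \<le> lcu_weight ts \<tau> r q" and "lcu_weight ts \<tau> r q \<le> exp (\<tau>\<^sup>2 / real r)"
proof -
  let ?x = "\<tau> / real r"
  let ?w = "\<lambda>k. ?x ^ k / fact k * sqrt (1 + (lcu_ratio \<tau> r k)\<^sup>2)"
  let ?K = "{k. k \<le> q \<and> even k}"
  have x: "0 \<le> ?x" using \<tau> by simp
  have fin: "finite ?K" by (rule finite_subset[of _ "{..q}"]) auto
  have "1 \<le> ?w 0" by simp
  also have "\<dots> \<le> (\<Sum>k\<in>?K. ?w k)"
    using x fin by (intro member_le_sum) auto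
  finally show "1 \<le> lcu_weight ts \<tau> r q" unfolding lcu_weight_eq[OF \<tau>] by (rule one_le_power)
  have sq: "sqrt (1 + (lcu_ratio \<tau> r k)\<^sup>2) \<le> exp (?x\<^sup>2 / 2)" for k
  proof -
    have "lcu_ratio \<tau> r k \<le> ?x"
      using divide_left_mono[of 1 "real (k + 1)" ?x] x by (simp add: lcu_ratio_def)
    moreover have "0 \<le> lcu_ratio \<tau> r k" using \<tau> by (simp add: lcu_ratio_def)
    ultimately have "1 + (lcu_ratio \<tau> r k)\<^sup>2 \<le> 1 + ?x\<^sup>2" by (intro add_left_mono power_mono)
    also have "\<dots> \<le> exp (?x\<^sup>2)" by (rule exp_ge_add_one_self)
    also have "\<dots> = (exp (?x\<^sup>2 / 2))\<^sup>2" by (simp add: power2_eq_square flip: exp_add)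
    finally have "sqrt (1 + (lcu_ratio \<tau> r k)\<^sup>2) \<le> sqrt ((exp (?x\<^sup>2 / 2))\<^sup>2)" by (rule real_sqrt_le_mono)
    then show ?thesis by simp
  qed
  have cosh: "(\<Sum>k\<in>?K. ?x ^ k / fact k) \<le> exp (?x\<^sup>2 / 2)"
  proof -
    have "(\<Sum>k\<in>?K. ?x ^ k / fact k) = (\<Sum>j\<le>q div 2. ?x ^ (2 * j) / fact (2 * j))"
      by (rule sum.reindex_bij_witness[of _ "\<lambda>j. 2 * j" "\<lambda>k. k div 2"]) auto
    also have "\<dots> \<le> (\<Sum>j\<le>q div 2. (?x\<^sup>2 / 2) ^ j /\<^sub>R fact j)"
    proof (rule sum_mono)
      fix j :: nat
      \<comment> \<open>This inequality compares the series of cosh x and of exp(x^2/2) term by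
        term.\<close>
      have f: "(2 ^ j * fact j :: real) \<le> fact (2 * j)"
      proof (induction j)
        case (Suc j)
        have "(2 ^ Suc j * fact (Suc j) :: real) = (2 * real j + 2) * (2 ^ j * fact j)"
          by (simp add: algebra_simps)
        also have "\<dots> \<le> (2 * real j + 2) * ((2 * real j + 1) * fact (2 * j))"
          using Suc.IH fact_ge_zero[of "2 * j", where 'a=real]
          by (intro mult_left_mono order_trans[OF Suc.IH]) (auto simp: distrib_right)
        also have "\<dots> = fact (2 * Suc j)" by (simp add: algebra_simps)
        finally show ?case .
      qed simp
      have "?x ^ (2 * j) / fact (2 * j) \<le> ?x ^ (2 * j) / (2 ^ j * fact j)"
        using x f by (intro divide_left_mono) auto
      moreover have "(y\<^sup>2 / 2) ^ j /\<^sub>R fact j = y ^ (2 * j) / (2 ^ j * fact j)" for y :: real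
        by (simp add: power_divide field_simps flip: power_mult)
      ultimately show "?x ^ (2 * j) / fact (2 * j) \<le> (?x\<^sup>2 / 2) ^ j /\<^sub>R fact j" by (simp only:)
    qed
    also have "\<dots> \<le> (\<Sum>j. (?x\<^sup>2 / 2) ^ j /\<^sub>R fact j)"
      by (rule sum_le_suminf[OF summable_exp_generic]) (auto simp: field_simps)
    finally show ?thesis by (simp add: exp_def)
  qed
  have "(\<Sum>k\<in>?K. ?w k) \<le> (\<Sum>k\<in>?K. ?x ^ k / fact k * exp (?x\<^sup>2 / 2))"
    using x by (intro sum_mono mult_left_mono sq) auto
  also have "\<dots> \<le> exp (?x\<^sup>2 / 2) * exp (?x\<^sup>2 / 2)"
    unfolding sum_distrib_right[symmetric] by (intro mult_right_mono cosh) auto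
  also have "\<dots> = exp (?x\<^sup>2)" by (simp flip: exp_add)
  finally have "(\<Sum>k\<in>?K. ?w k) ^ r \<le> exp (?x\<^sup>2) ^ r"
    using x by (intro power_mono sum_nonneg) auto
  also have "\<dots> = exp (\<tau>\<^sup>2 / real r)"
    using r by (simp add: power2_eq_square flip: exp_of_nat_mult)
  finally show "lcu_weight ts \<tau> r q \<le> exp (\<tau>\<^sup>2 / real r)" unfolding lcu_weight_eq[OF \<tau>] .
qed

lemma ham_carrier: "ham \<in> carrier_mat d d"
  by (simp add: ham_def)

lemma hermitian_ham: "hermitian_mat d ham"
proof -
  have "mat_adjoint ham = mat_sum d (\<lambda>l. mat_adjoint (complex_of_real (fst (ts ! l)) \<cdot>\<^sub>m snd (ts ! l))) {..<length ts}"
    unfolding ham_def using term_nth(4) by (intro mat_sum_adjoint) auto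
  also have "\<dots> = ham" unfolding ham_def
    using term_nth(2) by (intro mat_sum_cong refl) (auto simp: mat_adjoint_smult hermitian_mat_def)
  finally show ?thesis by (simp add: hermitian_mat_def ham_carrier)
qed

text \<open>A convex combination of unitaries is a contraction. It follows that all eigenvalues lie
  in [-1, 1].\<close>

lemma l2_norm_ham_le:
  assumes v: "v \<in> carrier_vec d"
  shows "l2_norm (ham *\<^sub>v v) \<le> l2_norm v"
proof -
  have "l2_norm (ham *\<^sub>v v) \<le> (\<Sum>l<length ts. l2_norm ((complex_of_real (fst (ts ! l)) \<cdot>\<^sub>m snd (ts ! l)) *\<^sub>v v))"
    unfolding ham_def using term_nth(4) v by (intro l2_norm_mat_sum_le) auto
  also have "\<dots> = (\<Sum>l<length ts. fst (ts ! l) * l2_norm v)"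
  proof (intro sum.cong refl)
    fix l assume "l \<in> {..<length ts}"
    then have l: "l < length ts" by simp
    have "(complex_of_real (fst (ts ! l)) \<cdot>\<^sub>m snd (ts ! l)) *\<^sub>v v = complex_of_real (fst (ts ! l)) \<cdot>\<^sub>v (snd (ts ! l) *\<^sub>v v)"
      using term_nth(4)[OF l] v by (intro eq_vecI) (auto simp: smult_scalar_prod_distrib[of _ d])
    then show "l2_norm ((complex_of_real (fst (ts ! l)) \<cdot>\<^sub>m snd (ts ! l)) *\<^sub>v v) = fst (ts ! l) * l2_norm v"
      using term_nth(1)[OF l] unitary_mat_l2_norm[OF term_nth(5)[OF l] v] by (simp add: l2_norm_smult)
  qed
  also have "\<dots> = l2_norm v" by (simp add: sum_term flip: sum_distrib_right)
  finally show ?thesis .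
qed

lemma evolution_unitary: "unitary_mat d (mat_exp ((- \<i> * complex_of_real \<tau>) \<cdot>\<^sub>m ham))"
proof -
  obtain V ev where V: "unitary_mat d V" and H: "ham = fcalc d V (\<lambda>m. complex_of_real (ev m))"
    using hermitian_mat_spectral[OF hermitian_ham] by auto
  have "cmod (exp (- \<i> * complex_of_real \<tau> * complex_of_real (ev m))) = 1" for m
    using norm_exp_i_times[of "- \<tau> * ev m"] by (simp add: mult_ac)
  then show ?thesis unfolding H fcalc_smult mat_exp_fcalc[OF V] by (intro fcalc_unitary[OF V])
qed

text \<open>Approximation and evolution are both functions of \<open>ham\<close>, so the operator
  error is bounded by the scalar error at its eigenvalues, which lie in [-1, 1].\<close>

lemma lcu_approx_error:
  assumes \<tau>: "0 \<le> \<tau>" and r: "0 < r" "\<tau> / real r \<le> 1" "\<tau>\<^sup>2 / real r \<le> 1"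
  shows "spectral_norm (lcu_approx d ts \<tau> r (2 * n) - mat_exp ((- \<i> * complex_of_real \<tau>) \<cdot>\<^sub>m ham))
    \<le> 2 * (\<tau>\<^sup>2 / real r) / fact (2 * n + 2)"
proof -
  obtain V ev where V: "unitary_mat d V" and H: "ham = fcalc d V (\<lambda>m. complex_of_real (ev m))"
    using hermitian_mat_spectral[OF hermitian_ham] by auto
  have Vc: "V \<in> carrier_mat d d" using V by (simp add: unitary_mat_def)
  have ev: "\<bar>ev m\<bar> \<le> 1" if "m < d" for m
  proof -
    have "l2_norm (ham *\<^sub>v col V m) = \<bar>ev m\<bar>"
      unfolding H fcalc_eigenvector[OF V that] l2_norm_smult by (simp add: unitary_mat_col_l2_norm[OF V that])
    then show ?thesis using l2_norm_ham_le[of "col V m"] Vc that by (simp add: unitary_mat_col_l2_norm[OF V that])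
  qed
  let ?x = "\<tau> / real r"
  let ?g = "\<lambda>m. (\<Sum>k\<le>Suc (2 * n). (- \<i> * complex_of_real ?x * complex_of_real (ev m)) ^ k / fact k) ^ r
      - exp (- \<i> * complex_of_real \<tau> * complex_of_real (ev m))"
  have eq: "lcu_approx d ts \<tau> r (2 * n) - mat_exp ((- \<i> * complex_of_real \<tau>) \<cdot>\<^sub>m ham) = fcalc d V ?g"
    unfolding lcu_approx_fcalc[OF V H \<tau>] unfolding H fcalc_smult mat_exp_fcalc[OF V] fcalc_minus ..
  have rx: "real r * ?x\<^sup>2 = \<tau>\<^sup>2 / real r" using r by (simp add: power2_eq_square)
  have g: "cmod (?g m) \<le> 2 * (\<tau>\<^sup>2 / real r) / fact (2 * n + 2)" if "m < d" for m
  proof -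
    have "\<bar>?x * ev m\<bar> \<le> ?x" using mult_left_mono[OF ev[OF that], of ?x] \<tau> by (simp add: abs_mult)
    from truncated_exp_power_error[OF this r(2), of r n] r rx
    show ?thesis by (simp add: mult_ac)
  qed
  show ?thesis unfolding eq
    by (intro spectral_norm_le[of _ d d] fcalc_l2_norm_le[OF V g] dim_pos) auto
qed

text \<open>\<open>embed_pmf\<close> has the intended values only for a nonnegative function of
  total mass 1. Here all coefficients are nonnegative, so their sum is the weight by which they are
  divided.\<close>

lemma pmf_lcu_pmf:
  assumes \<tau>: "0 \<le> \<tau>" and r: "0 < r"
  shows "pmf (lcu_pmf ts \<tau> r q) bs =
     (if bs \<in> lcu_indices (length ts) r q then lcu_coeff ts \<tau> r bs / lcu_weight ts \<tau> r q else 0)"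
proof -
  let ?I = "lcu_indices (length ts) r q"
  let ?f = "\<lambda>bs. if bs \<in> ?I then lcu_coeff ts \<tau> r bs / lcu_weight ts \<tau> r q else 0"
  have w: "lcu_weight ts \<tau> r q > 0" using lcu_weight_bounds(1)[OF assms, of q] by linarith
  have f: "0 \<le> ?f bs" for bs using lcu_coeff_nonneg[of bs r q] \<tau> w by auto
  have weight: "lcu_weight ts \<tau> r q = (\<Sum>bs\<in>?I. lcu_coeff ts \<tau> r bs)"
    unfolding lcu_weight_def using \<tau> by (intro sum.cong refl abs_of_nonneg lcu_coeff_nonneg)
  have "(\<integral>\<^sup>+ bs. ennreal (?f bs) \<partial>count_space UNIV) = (\<Sum>bs\<in>?I. ennreal (?f bs))"
    by (rule nn_integral_count_space') (auto simp: finite_lcu_indices)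
  also have "\<dots> = ennreal (\<Sum>bs\<in>?I. ?f bs)" by (rule sum_ennreal) (rule f)
  also have "(\<Sum>bs\<in>?I. ?f bs) = 1" using w by (simp add: weight flip: sum_divide_distrib)
  finally show ?thesis unfolding lcu_pmf_def using f by (intro pmf_embed_pmf) auto
qed

lemma set_lcu_pmf:
  assumes \<tau>: "0 \<le> \<tau>" and r: "0 < r"
  shows "set_pmf (lcu_pmf ts \<tau> r q) \<subseteq> lcu_indices (length ts) r q"
  by (auto simp: set_pmf_eq pmf_lcu_pmf[OF assms] split: if_splits)

text \<open>The sampling probabilities are the coefficients up to one common factor, so the mean of
  the sampled unitaries restores the linear combination up to that factor.\<close>

lemma lcu_pmf_mean:
  assumes \<tau>: "0 \<le> \<tau>" and r: "0 < r"
  shows "mat_sum d (\<lambda>bs. complex_of_real (pmf (lcu_pmf ts \<tau> r q) bs) \<cdot>\<^sub>m lcu_unitary d ts \<tau> r bs)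
      (lcu_indices (length ts) r q)
    = complex_of_real (1 / lcu_weight ts \<tau> r q) \<cdot>\<^sub>m lcu_approx d ts \<tau> r q"
  unfolding lcu_approx_expansion
  using lcu_unitary_unitary[of _ r q \<tau> r]
  by (subst mat_sum_smult[symmetric])
    (auto simp: unitary_mat_def pmf_lcu_pmf[OF assms] smult_smult_mat intro!: mat_sum_cong)

lemma lcu_depth_le:
  assumes bs: "bs \<in> lcu_indices L r q"
  shows "lcu_depth bs \<le> r * (q + 1)"
proof -
  have "lcu_depth bs \<le> (\<Sum>b\<leftarrow>bs. q + 1)"
    unfolding lcu_depth_def using bs
    by (intro sum_list_mono) (auto simp: lcu_indices_def lcu_blocks_def)
  also have "\<dots> = r * (q + 1)" using bs by (simp add: sum_list_triv lcu_indices_def)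
  finally show ?thesis .
qed

end

section \<open>The collision model\<close>

lemma pauli_mat_carrier [simp]: "pauli_mat p \<in> carrier_mat 2 2"
  by (cases p) (auto simp: mat_of_rows_list_def)

lemma pauli_mat_adjoint: "mat_adjoint (pauli_mat p) = pauli_mat p"
proof (rule eq_matI)
  fix i j assume "i < dim_row (pauli_mat p)" "j < dim_col (pauli_mat p)"
  then have "i < 2" "j < 2" using pauli_mat_carrier[of p] by (simp_all only: carrier_matD)
  then have "i = 0 \<or> i = 1" "j = 0 \<or> j = 1" by auto
  then show "mat_adjoint (pauli_mat p) $$ (i, j) = pauli_mat p $$ (i, j)"
    by (cases p) (auto simp: mat_of_rows_list_def)
qed (use pauli_mat_carrier[of p] in \<open>simp_all only: mat_adjoint_dim carrier_matD\<close>)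

lemma pauli_mat_square: "pauli_mat p * pauli_mat p = 1\<^sub>m 2"
  by (rule eq_matI; cases p) (auto simp: mat_of_rows_list_def less_2_cases_iff scalar_prod_def)

lemma pauli_string_properties:
  fixes ps :: "pauli list"
  defines "P \<equiv> foldr (\<otimes>\<^sub>k) (map pauli_mat ps) (1\<^sub>m 1)"
  shows "hermitian_mat (2 ^ length ps) P \<and> P * P = 1\<^sub>m (2 ^ length ps)"
  unfolding P_def
proof (induction ps)
  case Nil
  then show ?case by (simp add: hermitian_mat_def)
next
  case (Cons p ps)
  define Q where "Q = foldr (\<otimes>\<^sub>k) (map pauli_mat ps) (1\<^sub>m 1)"
  have step: "foldr (\<otimes>\<^sub>k) (map pauli_mat (p # ps)) (1\<^sub>m 1) = pauli_mat p \<otimes>\<^sub>k Q" by (simp add: Q_def)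
  have Q: "Q \<in> carrier_mat (2 ^ length ps) (2 ^ length ps)" "mat_adjoint Q = Q" "Q * Q = 1\<^sub>m (2 ^ length ps)"
    using Cons.IH unfolding Q_def hermitian_mat_def by auto
  show ?case
    using Q kron_carrier[OF pauli_mat_carrier[of p] Q(1)] unfolding step
    by (simp add: hermitian_mat_def kron_adjoint pauli_mat_adjoint pauli_mat_square kron_one
        kron_mult[OF pauli_mat_carrier Q(1) pauli_mat_carrier Q(1)])
qed

lemma signed_pauli_mat_properties:
  "hermitian_mat (2 ^ length ps) (signed_pauli_mat (neg, ps))"
  "signed_pauli_mat (neg, ps) * signed_pauli_mat (neg, ps) = 1\<^sub>m (2 ^ length ps)"
proof -
  define P where "P = foldr (\<otimes>\<^sub>k) (map pauli_mat ps) (1\<^sub>m 1)"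
  have P: "P \<in> carrier_mat (2 ^ length ps) (2 ^ length ps)" "mat_adjoint P = P" "P * P = 1\<^sub>m (2 ^ length ps)"
    using pauli_string_properties[of ps] unfolding P_def hermitian_mat_def by auto
  have eq: "signed_pauli_mat (neg, ps) = (if neg then - 1 else 1) \<cdot>\<^sub>m P" by (simp add: P_def)
  show "hermitian_mat (2 ^ length ps) (signed_pauli_mat (neg, ps))"
    unfolding eq using P by (simp add: hermitian_mat_def mat_adjoint_smult)
  have "(c \<cdot>\<^sub>m P) * (c \<cdot>\<^sub>m P) = (c * c) \<cdot>\<^sub>m (P * P)" for c
    using P(1) by (simp add: mult_smult_distrib[OF smult_carrier_mat[OF P(1)] P(1)]
        mult_smult_assoc_mat[OF P(1) P(1)] smult_smult_mat)
  then show "signed_pauli_mat (neg, ps) * signed_pauli_mat (neg, ps) = 1\<^sub>m (2 ^ length ps)"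
    unfolding eq using P by (simp split: if_splits)
qed

section \<open>The reduced collision step and chains of arbitrary operators\<close>

lemma ptrace_mid_carrier [simp]: "ptrace_mid a b c X \<in> carrier_mat (a * c) (a * c)"
  by (simp add: ptrace_mid_def)

lemma ptrace_mid_linear:
  assumes "X \<in> carrier_mat (a * b * c) (a * b * c)" "Y \<in> carrier_mat (a * b * c) (a * b * c)"
  shows "ptrace_mid a b c (x \<cdot>\<^sub>m X + y \<cdot>\<^sub>m Y) = x \<cdot>\<^sub>m ptrace_mid a b c X + y \<cdot>\<^sub>m ptrace_mid a b c Y"
proof (rule eq_mat_pairI[of _ a c a c])
  fix x' y' z w assume *: "x' < a" "y' < c" "z < a" "w < c"
  have **: "(x' * b + k) * c + y' < a * b * c" "(z * b + k) * c + w < a * b * c" if "k < b" for k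
    using * that by (auto intro: triple_index_less)
  show "ptrace_mid a b c (x \<cdot>\<^sub>m X + y \<cdot>\<^sub>m Y) $$ (x' * c + y', z * c + w)
      = (x \<cdot>\<^sub>m ptrace_mid a b c X + y \<cdot>\<^sub>m ptrace_mid a b c Y) $$ (x' * c + y', z * c + w)"
    using * ** carrier_matD[OF assms(1)] carrier_matD[OF assms(2)]
    by (simp add: ptrace_mid_def pair_index_less sum.distrib sum_distrib_left)
qed auto

text \<open>The two branches of the partial swap, after the first register has been discarded: either
  the register is replaced by a fresh one, or the old one survives.\<close>

definition relax :: "collision_model \<Rightarrow> nat \<Rightarrow> complex mat \<Rightarrow> complex mat" where
  "relax M j B = complex_of_real (1 - swap_prob M) \<cdot>\<^sub>m (ptrace_last (sys_dim M) (env_dim M) B \<otimes>\<^sub>k env_state M (Suc j))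
     + complex_of_real (swap_prob M) \<cdot>\<^sub>m B"

text \<open>The operators \<open>V j\<close> are left free. The exact unitaries give the collision
  model, and \<open>coll_approx\<close> gives, up to a scalar, the mean of an off-diagonal ancilla
  block, so that both can be compared inside one recursion.\<close>

primrec chain_state :: "collision_model \<Rightarrow> (nat \<Rightarrow> complex mat) \<Rightarrow> complex mat \<Rightarrow> nat \<Rightarrow> complex mat" where
  "chain_state M V \<rho> 0 = \<rho> \<otimes>\<^sub>k env_state M 1"
| "chain_state M V \<rho> (Suc j) = relax M (Suc j) (conj_by (V (Suc j)) (chain_state M V \<rho> j))"

definition chain_value :: "collision_model \<Rightarrow> nat \<Rightarrow> (nat \<Rightarrow> complex mat) \<Rightarrow> complex mat \<Rightarrow> complex mat \<Rightarrow> complex" where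
  "chain_value M K V \<rho> A =
     mat_trace (A * ptrace_last (sys_dim M) (env_dim M) (conj_by (V K) (chain_state M V \<rho> (K - 1))))"

text \<open>The ancilla is the most significant digit, so this is the block of an operator between
  ancilla states a and b, acting on system and environment.\<close>

definition ancilla_block :: "nat \<Rightarrow> nat \<Rightarrow> nat \<Rightarrow> complex mat \<Rightarrow> complex mat" where
  "ancilla_block D a b \<sigma> = Matrix.mat D D (\<lambda>(i, j). \<sigma> $$ (a * D + i, b * D + j))"

lemma ancilla_block_carrier [simp]: "ancilla_block D a b \<sigma> \<in> carrier_mat D D"
  and ancilla_block_dim [simp]: "dim_row (ancilla_block D a b \<sigma>) = D" "dim_col (ancilla_block D a b \<sigma>) = D"
  and ancilla_block_index: "i < D \<Longrightarrow> j < D \<Longrightarrow> ancilla_block D a b \<sigma> $$ (i, j) = \<sigma> $$ (a * D + i, b * D + j)"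
  by (auto simp: ancilla_block_def)

lemma conj_by_carrier: "V \<in> carrier_mat d d \<Longrightarrow> X \<in> carrier_mat d d \<Longrightarrow> conj_by V X \<in> carrier_mat d d"
  by (auto simp: conj_by_def intro!: mult_carrier_mat[of _ d d])

lemma proj_carrier [simp]: "proj0 \<in> carrier_mat 2 2" "proj1 \<in> carrier_mat 2 2"
  and proj_index: "a < 2 \<Longrightarrow> b < 2 \<Longrightarrow> proj0 $$ (a, b) = (if a = 0 \<and> b = 0 then 1 else 0)"
    "a < 2 \<Longrightarrow> b < 2 \<Longrightarrow> proj1 $$ (a, b) = (if a = 1 \<and> b = 1 then 1 else 0)"
  by (auto simp: proj0_def proj1_def mat_of_rows_list_def less_2_cases_iff)

lemma proj_dim [simp]: "dim_row proj0 = 2" "dim_col proj0 = 2" "dim_row proj1 = 2" "dim_col proj1 = 2"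
  by (auto simp: proj0_def proj1_def mat_of_rows_list_def)

lemma controlled_sum_carrier:
  assumes "G0 \<in> carrier_mat D D" "G1 \<in> carrier_mat D D"
  shows "proj0 \<otimes>\<^sub>k G0 + proj1 \<otimes>\<^sub>k G1 \<in> carrier_mat (2 * D) (2 * D)"
  using kron_carrier[OF proj_carrier(1) assms(1)] kron_carrier[OF proj_carrier(2) assms(2)] by simp

lemma controlled_sum_index:
  assumes "G0 \<in> carrier_mat D D" "G1 \<in> carrier_mat D D" "a < 2" "b < 2" "i < D" "j < D"
  shows "(proj0 \<otimes>\<^sub>k G0 + proj1 \<otimes>\<^sub>k G1) $$ (a * D + i, b * D + j)
    = (if a = b then (if a = 0 then G0 else G1) $$ (i, j) else 0)"
  using assms pair_index_less[of a 2 i D] pair_index_less[of b 2 j D]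
    kron_index_pair[OF proj_carrier(1) assms(1), of a i b j] kron_index_pair[OF proj_carrier(2) assms(2), of a i b j]
  by (auto simp: proj_index less_2_cases_iff)

text \<open>The gate is block diagonal in the ancilla, so blocks do not mix: the gate of the row
  ancilla acts from the left and the adjoint of that of the column ancilla from the right.\<close>

lemma ancilla_block_conj:
  assumes G: "G0 \<in> carrier_mat D D" "G1 \<in> carrier_mat D D" and \<sigma>: "\<sigma> \<in> carrier_mat (2 * D) (2 * D)"
    and ab: "a < 2" "b < 2"
  shows "ancilla_block D a b (conj_by (proj0 \<otimes>\<^sub>k G0 + proj1 \<otimes>\<^sub>k G1) \<sigma>)
    = (if a = 0 then G0 else G1) * ancilla_block D a b \<sigma> * mat_adjoint (if b = 0 then G0 else G1)"
proof (rule eq_matI)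
  let ?G = "proj0 \<otimes>\<^sub>k G0 + proj1 \<otimes>\<^sub>k G1"
  let ?g = "\<lambda>a. if a = (0::nat) then G0 else G1"
  have Gc: "?G \<in> carrier_mat (2 * D) (2 * D)" by (rule controlled_sum_carrier[OF G])
  have gc: "?g c \<in> carrier_mat D D" for c using G by simp
  have left: "(?G * X) $$ (c * D + i, l) = (\<Sum>k<D. ?g c $$ (i, k) * X $$ (c * D + k, l))"
    if "X \<in> carrier_mat (2 * D) (2 * D)" "c < 2" "i < D" "l < 2 * D" for X c i l
  proof -
    have "(?G * X) $$ (c * D + i, l) = (\<Sum>b<2. \<Sum>k<D. ?G $$ (c * D + i, b * D + k) * X $$ (b * D + k, l))"
      using that Gc pair_index_less[of c 2 i D]
      by (subst mult_mat_index) (auto simp: sum_lessThan_mult carrier_matD[OF Gc] simp del: kron_dim)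
    also have "\<dots> = (\<Sum>b<2. if b = c then (\<Sum>k<D. ?g c $$ (i, k) * X $$ (c * D + k, l)) else 0)"
      using that G by (intro sum.cong refl) (auto simp: controlled_sum_index[OF G])
    finally show ?thesis using that by simp
  qed
  fix i j assume "i < dim_row (?g a * ancilla_block D a b \<sigma> * mat_adjoint (?g b))"
    "j < dim_col (?g a * ancilla_block D a b \<sigma> * mat_adjoint (?g b))"
  then have ij: "i < D" "j < D" using G by (auto split: if_splits)
  have G\<sigma>: "?G * \<sigma> \<in> carrier_mat (2 * D) (2 * D)" using Gc \<sigma> by (rule mult_carrier_mat)
  \<comment> \<open>Multiplication from the right is rewritten as multiplication from the left
    between two adjoints, so that \<open>left\<close> serves twice.\<close>
  have "conj_by ?G \<sigma> = mat_adjoint (?G * mat_adjoint (?G * \<sigma>))"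
    unfolding conj_by_def using mat_adjoint_mult[of ?G "mat_adjoint (?G * \<sigma>)"] Gc G\<sigma>
    by (simp only: carrier_matD mat_adjoint_dim mat_adjoint_adjoint)
  then have "conj_by ?G \<sigma> $$ (a * D + i, b * D + j) = cnj ((?G * mat_adjoint (?G * \<sigma>)) $$ (b * D + j, a * D + i))"
    using pair_index_less[OF ab(1) ij(1)] pair_index_less[OF ab(2) ij(2)] carrier_matD[OF Gc] carrier_matD[OF G\<sigma>]
    by (simp only:, subst mat_adjoint_index) (simp_all only: index_mult_mat(2,3) mat_adjoint_dim)
  also have "\<dots> = (\<Sum>k<D. cnj (?g b $$ (j, k)) * (?G * \<sigma>) $$ (a * D + i, b * D + k))"
    using left[of "mat_adjoint (?G * \<sigma>)" b j "a * D + i"] G\<sigma> ab ij pair_index_less[OF ab(1) ij(1)] pair_index_less[OF ab(2)]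
    by (simp add: carrier_matD[OF G\<sigma>] del: index_mult_mat kron_dim)
  also have "\<dots> = (\<Sum>k<D. (\<Sum>l<D. ?g a $$ (i, l) * ancilla_block D a b \<sigma> $$ (l, k)) * cnj (?g b $$ (j, k)))"
    using left[OF \<sigma> ab(1) ij(1)] pair_index_less[OF ab(2)]
    by (intro sum.cong refl) (auto simp: ancilla_block_index)
  also have "\<dots> = (?g a * ancilla_block D a b \<sigma> * mat_adjoint (?g b)) $$ (i, j)"
    using gc[of a] gc[of b] ij by (subst mult_mat_index) (auto simp: mult_mat_index simp del: index_mult_mat(1))
  finally show "ancilla_block D a b (conj_by ?G \<sigma>) $$ (i, j)
      = (?g a * ancilla_block D a b \<sigma> * mat_adjoint (?g b)) $$ (i, j)"
    using ij by (simp add: ancilla_block_index)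
qed (use G in auto)

lemma unitary_controlled_sum:
  assumes U: "unitary_mat D G0" "unitary_mat D G1"
  shows "unitary_mat (2 * D) (proj0 \<otimes>\<^sub>k G0 + proj1 \<otimes>\<^sub>k G1)"
proof -
  have G: "G0 \<in> carrier_mat D D" "G1 \<in> carrier_mat D D" using U by (auto simp: unitary_mat_def)
  let ?G = "proj0 \<otimes>\<^sub>k G0 + proj1 \<otimes>\<^sub>k G1"
  have Gc: "?G \<in> carrier_mat (2 * D) (2 * D)" by (rule controlled_sum_carrier[OF G])
  show ?thesis
  proof (rule unitary_matI[OF Gc])
    fix k l assume kl: "k < 2 * D" "l < 2 * D"
    define a i b j where "a = k div D" and "i = k mod D" and "b = l div D" and "j = l mod D"
    have ab: "a < 2" "b < 2" "i < D" "j < D" and k: "k = a * D + i" and l: "l = b * D + j"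
      using kl by (auto simp: a_def i_def b_def j_def div_less_of_less_mult mod_less_of_less_mult)
    have eq: "k = l \<longleftrightarrow> a = b \<and> i = j" using k l a_def i_def b_def j_def by metis
    have "(\<Sum>h<2 * D. cnj (?G $$ (h, k)) * ?G $$ (h, l))
        = (\<Sum>c<2. \<Sum>h<D. cnj (?G $$ (c * D + h, a * D + i)) * ?G $$ (c * D + h, b * D + j))"
      unfolding sum_lessThan_mult k l ..
    also have "\<dots> = (\<Sum>c<2. if c = a then (if a = b then
        (\<Sum>h<D. cnj ((if a = 0 then G0 else G1) $$ (h, i)) * (if a = 0 then G0 else G1) $$ (h, j)) else 0) else 0)"
      using ab by (intro sum.cong refl) (auto simp: controlled_sum_index[OF G])
    also have "\<dots> = (if a = b then
        (\<Sum>h<D. cnj ((if a = 0 then G0 else G1) $$ (h, i)) * (if a = 0 then G0 else G1) $$ (h, j)) else 0)"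
      using ab by simp
    also have "\<dots> = (if k = l then 1 else 0)"
      unfolding eq using unitary_mat_cols[OF U(1) ab(3,4)] unitary_mat_cols[OF U(2) ab(3,4)] by auto
    finally show "(\<Sum>h<2 * D. cnj (?G $$ (h, k)) * ?G $$ (h, l)) = (if k = l then 1 else 0)" .
  qed
qed

text \<open>Tracing out the environment does not touch the ancilla digit; only the three digits
  ancilla, system and environment are bracketed differently.\<close>

lemma ptrace_last_ancilla_block:
  assumes "a < 2" "b < 2" "x < s" "z < s"
  shows "ptrace_last (2 * s) e \<sigma> $$ (a * s + x, b * s + z) = ptrace_last s e (ancilla_block (s * e) a b \<sigma>) $$ (x, z)"
proof -
  have idx: "c * (s * e) + (x * e + y) = (c * s + x) * e + y" for c x y :: nat by (simp add: algebra_simps)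
  show ?thesis
    using assms pair_index_less[of a 2 x s] pair_index_less[of b 2 z s]
    by (simp add: ptrace_last_def ancilla_block_index pair_index_less idx)
qed

lemma ancilla_block_ptrace_kron:
  assumes \<sigma>: "\<sigma> \<in> carrier_mat (2 * (s * e)) (2 * (s * e))" and E: "E \<in> carrier_mat e e" and ab: "a < 2" "b < 2"
  shows "ancilla_block (s * e) a b (ptrace_last (2 * s) e \<sigma> \<otimes>\<^sub>k E)
    = ptrace_last s e (ancilla_block (s * e) a b \<sigma>) \<otimes>\<^sub>k E"
proof (rule eq_mat_pairI[of _ s e s e])
  fix x y z w assume *: "x < s" "y < e" "z < s" "w < e"
  have idx: "c * (s * e) + (x * e + y) = (c * s + x) * e + y" for c x y :: nat by (simp add: algebra_simps)
  have "ancilla_block (s * e) a b (ptrace_last (2 * s) e \<sigma> \<otimes>\<^sub>k E) $$ (x * e + y, z * e + w)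
      = (ptrace_last (2 * s) e \<sigma> \<otimes>\<^sub>k E) $$ ((a * s + x) * e + y, (b * s + z) * e + w)"
    using * by (simp add: ancilla_block_index pair_index_less idx)
  also have "\<dots> = ptrace_last (2 * s) e \<sigma> $$ (a * s + x, b * s + z) * E $$ (y, w)"
    using * ab E by (intro kron_index_pair) (auto intro: pair_index_less)
  also have "ptrace_last (2 * s) e \<sigma> $$ (a * s + x, b * s + z) = ptrace_last s e (ancilla_block (s * e) a b \<sigma>) $$ (x, z)"
    using ab * by (intro ptrace_last_ancilla_block)
  finally show "ancilla_block (s * e) a b (ptrace_last (2 * s) e \<sigma> \<otimes>\<^sub>k E) $$ (x * e + y, z * e + w)
      = (ptrace_last s e (ancilla_block (s * e) a b \<sigma>) \<otimes>\<^sub>k E) $$ (x * e + y, z * e + w)"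
    using * E by (subst kron_index_pair[of _ s s _ e e]) auto
qed (use E in auto)

text \<open>All four entries of the plus state are 1/2, so the two off-diagonal blocks together
  start with total weight 1.\<close>

lemma ancilla_block_plus:
  assumes B: "B \<in> carrier_mat D D" and ab: "a < 2" "b < 2"
  shows "ancilla_block D a b (plus_state \<otimes>\<^sub>k B) = (1 / 2) \<cdot>\<^sub>m B"
proof (rule eq_matI)
  have P: "plus_state \<in> carrier_mat 2 2" by (intro carrier_matI) (auto simp: plus_state_def mat_of_rows_list_def)
  fix i j assume "i < dim_row ((1 / 2) \<cdot>\<^sub>m B)" "j < dim_col ((1 / 2) \<cdot>\<^sub>m B)"
  then show "ancilla_block D a b (plus_state \<otimes>\<^sub>k B) $$ (i, j) = ((1 / 2) \<cdot>\<^sub>m B) $$ (i, j)"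
    using B ab kron_index_pair[OF P B, of a i b j]
    by (auto simp: ancilla_block_index plus_state_def mat_of_rows_list_def less_2_cases_iff)
qed (use B in auto)

text \<open>Pauli X has no diagonal entries, so the measured mean sees just the two off-diagonal
  ancilla blocks.\<close>

lemma mat_trace_pauli_X:
  assumes A: "A \<in> carrier_mat s s" and \<sigma>: "\<sigma> \<in> carrier_mat (2 * (s * e)) (2 * (s * e))"
  shows "mat_trace ((pauli_mat Pauli_X \<otimes>\<^sub>k A) * ptrace_last (2 * s) e \<sigma>)
    = mat_trace (A * ptrace_last s e (ancilla_block (s * e) 0 1 \<sigma>))
      + mat_trace (A * ptrace_last s e (ancilla_block (s * e) 1 0 \<sigma>))"
proof -
  let ?X = "pauli_mat Pauli_X" and ?R = "ptrace_last (2 * s) e \<sigma>"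
  have X: "?X \<in> carrier_mat 2 2" by (rule pauli_mat_carrier)
  have Xi: "?X $$ (0, 0) = 0" "?X $$ (0, Suc 0) = 1" "?X $$ (Suc 0, 0) = 1" "?X $$ (Suc 0, Suc 0) = 0"
    by (auto simp: mat_of_rows_list_def)
  have XA: "?X \<otimes>\<^sub>k A \<in> carrier_mat (2 * s) (2 * s)" by (rule kron_carrier[OF X A])
  have "mat_trace ((?X \<otimes>\<^sub>k A) * ?R)
      = (\<Sum>i<2 * s. \<Sum>k<2 * s. (?X \<otimes>\<^sub>k A) $$ (i, k) * ?R $$ (k, i))"
    unfolding mat_trace_def using XA by (auto simp: mult_mat_index simp del: index_mult_mat(1) kron_dim)
  also have "\<dots> = (\<Sum>c<2. \<Sum>x<s. \<Sum>c'<2. \<Sum>x'<s.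
      ?X $$ (c, c') * A $$ (x, x') * ptrace_last s e (ancilla_block (s * e) c' c \<sigma>) $$ (x', x))"
    unfolding sum_lessThan_mult
    by (intro sum.cong refl) (auto simp: kron_index_pair[OF X A] ptrace_last_ancilla_block simp del: pauli_mat.simps)
  also have "\<dots> = (\<Sum>x<s. \<Sum>x'<s. A $$ (x, x') * ptrace_last s e (ancilla_block (s * e) 1 0 \<sigma>) $$ (x', x))
      + (\<Sum>x<s. \<Sum>x'<s. A $$ (x, x') * ptrace_last s e (ancilla_block (s * e) 0 1 \<sigma>) $$ (x', x))"
    by (simp add: numeral_2_eq_2 Xi del: pauli_mat.simps)
  also have "\<dots> = mat_trace (A * ptrace_last s e (ancilla_block (s * e) 1 0 \<sigma>))
      + mat_trace (A * ptrace_last s e (ancilla_block (s * e) 0 1 \<sigma>))"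
    using A unfolding mat_trace_def by (auto simp: mult_mat_index simp del: index_mult_mat(1))
  finally show ?thesis by (simp add: add.commute)
qed

text \<open>Pauli X exchanges the two halves of the vector and \<open>A\<close> acts on each, so the
  ancilla does not enlarge the bound. It will bound the measured values by the norm of the
  observable.\<close>

lemma l2_norm_pauli_X_kron:
  assumes A: "A \<in> carrier_mat s s" and c: "0 \<le> c"
    and Ac: "\<And>v. v \<in> carrier_vec s \<Longrightarrow> l2_norm (A *\<^sub>v v) \<le> c * l2_norm v" and v: "v \<in> carrier_vec (2 * s)"
  shows "l2_norm ((pauli_mat Pauli_X \<otimes>\<^sub>k A) *\<^sub>v v) \<le> c * l2_norm v"
proof -
  let ?X = "pauli_mat Pauli_X"
  have X: "?X \<in> carrier_mat 2 2" by (rule pauli_mat_carrier)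
  have Xi: "?X $$ (0, 0) = 0" "?X $$ (0, Suc 0) = 1" "?X $$ (Suc 0, 0) = 1" "?X $$ (Suc 0, Suc 0) = 0"
    by (auto simp: mat_of_rows_list_def)
  have XA: "?X \<otimes>\<^sub>k A \<in> carrier_mat (2 * s) (2 * s)" by (rule kron_carrier[OF X A])
  define half where "half = (\<lambda>b. Matrix.vec s (\<lambda>i. vec_index v (b * s + i)))"
  have half: "half b \<in> carrier_vec s" for b by (simp add: half_def)
  have entry: "vec_index ((?X \<otimes>\<^sub>k A) *\<^sub>v v) (b * s + i) = vec_index (A *\<^sub>v half (1 - b)) i" if "b < 2" "i < s" for b i
  proof -
    have "vec_index ((?X \<otimes>\<^sub>k A) *\<^sub>v v) (b * s + i) = (\<Sum>c<2. \<Sum>k<s. (?X \<otimes>\<^sub>k A) $$ (b * s + i, c * s + k) * vec_index v (c * s + k))"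
      using XA v pair_index_less[OF that]
      by (subst mult_vec_index) (auto simp: sum_lessThan_mult carrier_matD[OF XA] simp del: kron_dim)
    also have "\<dots> = (\<Sum>c<2. \<Sum>k<s. ?X $$ (b, c) * (A $$ (i, k) * vec_index v (c * s + k)))"
      using that by (intro sum.cong refl) (auto simp: kron_index_pair[OF X A] simp del: pauli_mat.simps)
    also have "\<dots> = (\<Sum>k<s. A $$ (i, k) * vec_index v ((1 - b) * s + k))"
      using that by (auto simp: numeral_2_eq_2 Xi less_Suc_eq simp del: pauli_mat.simps)
    also have "\<dots> = vec_index (A *\<^sub>v half (1 - b)) i"
      using A that by (simp add: mult_vec_index half_def del: index_mult_mat_vec)
    finally show ?thesis .
  qed
  have "(l2_norm ((?X \<otimes>\<^sub>k A) *\<^sub>v v))\<^sup>2 = (\<Sum>b<2. \<Sum>i<s. (cmod (vec_index ((?X \<otimes>\<^sub>k A) *\<^sub>v v) (b * s + i)))\<^sup>2)"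
    unfolding l2_norm_sq using carrier_matD[OF XA]
    by (simp add: sum_lessThan_mult del: index_mult_mat_vec kron_dim pauli_mat.simps)
  also have "\<dots> = (\<Sum>b<2. (l2_norm (A *\<^sub>v half (1 - b)))\<^sup>2)"
    unfolding l2_norm_sq dim_mult_mat_vec carrier_matD(1)[OF A]
    by (intro sum.cong refl) (simp add: entry del: index_mult_mat_vec pauli_mat.simps)
  also have "\<dots> \<le> (\<Sum>b<2. (c * l2_norm (half (1 - b)))\<^sup>2)"
    by (intro sum_mono power_mono Ac half) auto
  also have "\<dots> = c\<^sup>2 * (\<Sum>b<2. (l2_norm (half b))\<^sup>2)"
    by (simp add: numeral_2_eq_2 power_mult_distrib distrib_left)
  also have "(\<Sum>b<2. (l2_norm (half b))\<^sup>2) = (l2_norm v)\<^sup>2"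
    unfolding l2_norm_sq using v by (simp add: sum_lessThan_mult half_def)
  finally have "(l2_norm ((?X \<otimes>\<^sub>k A) *\<^sub>v v))\<^sup>2 \<le> (c * l2_norm v)\<^sup>2" by (simp add: power_mult_distrib)
  then show ?thesis by (rule power2_le_imp_le) (simp add: c)
qed

section \<open>Conjugation by nearly unitary operators\<close>

lemma mult_mat_vec_minus:
  fixes X Y :: "complex mat"
  assumes "X \<in> carrier_mat d d" "Y \<in> carrier_mat d d" "v \<in> carrier_vec d"
  shows "X *\<^sub>v v = (X - Y) *\<^sub>v v + Y *\<^sub>v v"
  using assms by (subst add_mult_distrib_mat_vec[symmetric, of _ d d]) (auto intro!: arg_cong2[of _ _ _ _ "(*\<^sub>v)"])

lemma conj_by_add:
  assumes "V \<in> carrier_mat d d" "X \<in> carrier_mat d d" "Y \<in> carrier_mat d d"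
  shows "conj_by V (X + Y) = conj_by V X + conj_by V Y"
  using assms unfolding conj_by_def
  by (simp add: mult_add_distrib_mat[of _ d d] add_mult_distrib_mat[of _ d d] mult_carrier_mat[of _ d d])

text \<open>Telescoping through the mixed product of \<open>U\<close>, \<open>X\<close> and the
  adjoint of \<open>V\<close>; each correction contains the difference V - U once.\<close>

lemma conj_by_diff:
  assumes V: "V \<in> carrier_mat d d" and U: "U \<in> carrier_mat d d" and X: "X \<in> carrier_mat d d"
  shows "conj_by V X = conj_by U X + ((V - U) * X * mat_adjoint V + U * X * mat_adjoint (V - U))"
proof -
  have c: "V * X \<in> carrier_mat d d" "U * X \<in> carrier_mat d d" "mat_adjoint V \<in> carrier_mat d d" "mat_adjoint U \<in> carrier_mat d d"
    using assms by (auto intro: mult_carrier_mat)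
  have "(V - U) * X = V * X - U * X" using assms by (intro minus_mult_distrib_mat)
  moreover have "(V * X - U * X) * mat_adjoint V = V * X * mat_adjoint V - U * X * mat_adjoint V"
    using c by (intro minus_mult_distrib_mat)
  moreover have "U * X * mat_adjoint (V - U) = U * X * mat_adjoint V - U * X * mat_adjoint U"
  proof -
    have "mat_adjoint (V - U) = mat_adjoint V - mat_adjoint U" using V U by (intro mat_adjoint_minus) auto
    then show ?thesis using mult_minus_distrib_mat[OF c(2) c(3) c(4)] by simp
  qed
  moreover have "V * X * mat_adjoint V \<in> carrier_mat d d" "U * X * mat_adjoint V \<in> carrier_mat d d" "U * X * mat_adjoint U \<in> carrier_mat d d"
    using c by (auto intro: mult_carrier_mat[of _ d d _ d])
  moreover have "P = R + ((P - Q) + (Q - R))"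
    if "P \<in> carrier_mat d d" "Q \<in> carrier_mat d d" "R \<in> carrier_mat d d" for P Q R :: "complex mat"
    using that by (intro eq_matI) auto
  ultimately show ?thesis unfolding conj_by_def by (simp only:)
qed

lemma l2_norm_le_of_near_unitary:
  assumes U: "unitary_mat d U" and V: "V \<in> carrier_mat d d" and v: "v \<in> carrier_vec d"
    and VU: "l2_norm ((V - U) *\<^sub>v v) \<le> \<eta> * l2_norm v"
  shows "l2_norm (V *\<^sub>v v) \<le> (1 + \<eta>) * l2_norm v"
proof -
  have Uc: "U \<in> carrier_mat d d" using U by (simp add: unitary_mat_def)
  have "l2_norm (V *\<^sub>v v) \<le> l2_norm ((V - U) *\<^sub>v v) + l2_norm (U *\<^sub>v v)"
    unfolding mult_mat_vec_minus[OF V Uc v] using V Uc by (intro l2_norm_triangle) simp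
  then show ?thesis using VU unitary_mat_l2_norm[OF U v] by (simp add: distrib_right)
qed

section \<open>The exact chain of a well-formed model and its perturbation\<close>

locale collision =
  fixes M :: collision_model and K :: nat
  assumes wf: "collision_model_wf K M" and K: "1 \<le> K"
begin

abbreviation "s \<equiv> sys_dim M"
abbreviation "e \<equiv> env_dim M"
abbreviation "D \<equiv> total_dim M"
abbreviation "p \<equiv> swap_prob M"
abbreviation "U \<equiv> coll_unitary M"

lemma dims: "0 < s" "0 < e" "0 < D" "D = s * e" "D = 2 ^ (sys_qubits M + env_qubits M)"
  by (auto simp: sys_dim_def env_dim_def total_dim_def power_add)

lemma swap_prob: "0 \<le> p" "p \<le> 1" and coll_time_pos: "0 < coll_time M"
  using wf by (auto simp: collision_model_wf_def)

lemma env_state: "j \<in> {1..K} \<Longrightarrow> qstate e (env_state M j)"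
  using wf by (auto simp: collision_model_wf_def intro: density_mat_qstate)

lemma env_state_carrier: "j \<in> {1..K} \<Longrightarrow> env_state M j \<in> carrier_mat e e"
  using env_state by (rule qstate_carrier)

lemma pauli_term:
  assumes "j \<in> {1..K}" "(h, P) \<in> set (pauli_terms M j)"
  shows "0 < h" "hermitian_mat D (signed_pauli_mat P)" "signed_pauli_mat P * signed_pauli_mat P = 1\<^sub>m D"
proof -
  obtain neg ps where P: "P = (neg, ps)" by (cases P)
  have len: "length ps = sys_qubits M + env_qubits M" and "0 < h"
    using wf assms unfolding collision_model_wf_def P by fastforce+
  then show "0 < h" by simp
  show "hermitian_mat D (signed_pauli_mat P)" "signed_pauli_mat P * signed_pauli_mat P = 1\<^sub>m D"
    using signed_pauli_mat_properties[where ps = ps and neg = neg] unfolding P dims(5) len by auto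
qed

lemma coll_beta_pos:
  assumes j: "j \<in> {1..K}"
  shows "0 < coll_beta M j"
proof -
  obtain h P l where l: "pauli_terms M j = (h, P) # l"
    using wf j unfolding collision_model_wf_def by (metis list.exhaust surj_pair)
  have "0 \<le> sum_list (map fst l)"
    using pauli_term(1)[OF j] l by (intro sum_list_nonneg) (fastforce intro: less_imp_le)
  then show ?thesis using pauli_term(1)[OF j, of h P] l by (simp add: coll_beta_def)
qed

lemma coll_tau_pos: "j \<in> {1..K} \<Longrightarrow> 0 < coll_tau M j"
  using coll_beta_pos coll_time_pos by (simp add: coll_tau_def)

lemma lcu_terms_normalized:
  assumes j: "j \<in> {1..K}"
  shows "lcu_terms D (normalized_terms M j)"
proof
  fix q P assume "(q, P) \<in> set (normalized_terms M j)"
  then obtain h P' where h: "(h, P') \<in> set (pauli_terms M j)" "q = h / coll_beta M j" "P = signed_pauli_mat P'"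
    unfolding normalized_terms_def by fastforce
  show "0 \<le> q \<and> hermitian_mat D P \<and> P * P = 1\<^sub>m D"
    unfolding h(2,3) using pauli_term[OF j h(1)] coll_beta_pos[OF j] by (simp del: signed_pauli_mat.simps)
next
  have "map fst (normalized_terms M j) = map (\<lambda>x. x / coll_beta M j) (map fst (pauli_terms M j))"
    by (auto simp: normalized_terms_def)
  moreover have "sum_list (map (\<lambda>x. x / c) xs) = sum_list xs / c" for c :: real and xs
    by (induction xs) (auto simp: add_divide_distrib)
  ultimately have "sum_list (map fst (normalized_terms M j)) = coll_beta M j / coll_beta M j"
    by (simp only: coll_beta_def)
  then show "sum_list (map fst (normalized_terms M j)) = 1" using coll_beta_pos[OF j] by simp
qed (rule dims)

text \<open>Here the assumed Pauli decomposition of the total Hamiltonian enters and links the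
  abstract series to the unitary of the collision.\<close>

lemma ham_normalized:
  assumes j: "j \<in> {1..K}"
  shows "lcu_terms.ham D (normalized_terms M j) = normalized_ham M j"
proof -
  interpret lcu_terms D "normalized_terms M j" by (rule lcu_terms_normalized[OF j])
  have len: "length (normalized_terms M j) = length (pauli_terms M j)" by (simp add: normalized_terms_def)
  have c: "signed_pauli_mat (snd (pauli_terms M j ! l)) \<in> carrier_mat D D" if "l < length (pauli_terms M j)" for l
    using pauli_term(2)[OF j, of "fst (pauli_terms M j ! l)" "snd (pauli_terms M j ! l)"] that
    by (simp add: hermitian_mat_def)
  have "ham = mat_sum D (\<lambda>l. complex_of_real (1 / coll_beta M j) \<cdot>\<^sub>m (complex_of_real (fst (pauli_terms M j ! l)) \<cdot>\<^sub>m
      signed_pauli_mat (snd (pauli_terms M j ! l)))) {..<length (pauli_terms M j)}"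
    unfolding ham_def len
    by (intro mat_sum_cong refl) (auto simp: normalized_terms_def smult_smult_mat split: prod.splits)
  also have "\<dots> = complex_of_real (1 / coll_beta M j) \<cdot>\<^sub>m pauli_sum M j"
    unfolding pauli_sum_def using c by (intro mat_sum_smult) auto
  also have "pauli_sum M j = total_ham M j" using wf j by (auto simp: collision_model_wf_def)
  finally show ?thesis by (simp add: normalized_ham_def)
qed

lemma coll_unitary_unitary:
  assumes j: "j \<in> {1..K}"
  shows "unitary_mat D (U j)"
  using lcu_terms.evolution_unitary[OF lcu_terms_normalized[OF j]] unfolding ham_normalized[OF j] coll_unitary_def .

lemma coll_unitary_carrier: "j \<in> {1..K} \<Longrightarrow> U j \<in> carrier_mat D D"
  using coll_unitary_unitary by (simp add: unitary_mat_def)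

lemma coll_approx_carrier:
  assumes j: "j \<in> {1..K}"
  shows "coll_approx M j r q \<in> carrier_mat D D"
  unfolding coll_approx_def lcu_approx_def lcu_segment_def by (simp add: pow_carrier_mat)

lemma relax_carrier:
  assumes "Suc j \<in> {1..K}" "B \<in> carrier_mat D D"
  shows "relax M j B \<in> carrier_mat D D"
  using assms kron_carrier[OF ptrace_last_carrier[of s e B] env_state_carrier[OF assms(1)]]
  by (simp add: relax_def dims(4))

lemma relax_add:
  assumes j: "Suc j \<in> {1..K}" and A: "A \<in> carrier_mat D D" and B: "B \<in> carrier_mat D D"
  shows "relax M j (A + B) = relax M j A + relax M j B"
proof -
  let ?k = "\<lambda>B. ptrace_last s e B \<otimes>\<^sub>k env_state M (Suc j)"
  have c: "?k B \<in> carrier_mat D D" for B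
    using kron_carrier[OF ptrace_last_carrier[of s e B] env_state_carrier[OF j]] by (simp add: dims(4))
  have "?k (A + B) = ?k A + ?k B"
    using A B by (simp add: dims(4) ptrace_last_add kron_add_left[OF ptrace_last_carrier ptrace_last_carrier])
  then show ?thesis
    using c[of A] c[of B] A B unfolding relax_def by (intro eq_matI) (auto simp: distrib_left simp del: kron_dim)
qed

lemma relax_smult:
  assumes j: "Suc j \<in> {1..K}" and A: "A \<in> carrier_mat D D"
  shows "relax M j (c \<cdot>\<^sub>m A) = c \<cdot>\<^sub>m relax M j A"
proof -
  let ?k = "\<lambda>B. ptrace_last s e B \<otimes>\<^sub>k env_state M (Suc j)"
  have c: "?k B \<in> carrier_mat D D" for B
    using kron_carrier[OF ptrace_last_carrier[of s e B] env_state_carrier[OF j]] by (simp add: dims(4))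
  have "?k (c \<cdot>\<^sub>m A) = c \<cdot>\<^sub>m ?k A"
    using A by (simp add: dims(4) ptrace_last_smult kron_smult_left)
  then show ?thesis
    using c[of A] A unfolding relax_def by (intro eq_matI) (auto simp: distrib_left simp del: kron_dim)
qed

text \<open>A convex combination of two maps that do not increase the bound: the identity, and the
  partial trace followed by a fresh state of weight 1.\<close>

lemma relax_rank_one_sum:
  assumes j: "Suc j \<in> {1..K}" and B: "rank_one_sum t D B b"
  shows "rank_one_sum t D (relax M j B) b"
proof -
  have "rank_one_sum True e (env_state M (Suc j)) 1" using env_state[OF j] by (simp add: qstate_def)
  then have E: "rank_one_sum t e (env_state M (Suc j)) 1" by (cases t) (auto intro: rank_one_sum_False)
  have "rank_one_sum t D (ptrace_last s e B \<otimes>\<^sub>k env_state M (Suc j)) (1 * b)"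
    using rank_one_sum_kron[OF rank_one_sum_ptrace_last E] B by (simp add: dims(4))
  from rank_one_sum.add[OF rank_one_sum_smult[OF this, of "1 - p"] rank_one_sum_smult[OF B, of p]]
  show ?thesis using swap_prob by (simp add: relax_def algebra_simps)
qed

text \<open>The fresh environment is in a product state with the rest, so both branches of the
  partial swap can be evaluated, and the space with two environment registers disappears from the
  argument.\<close>

lemma nm_step_relax:
  assumes j: "j \<in> {1..K}" "Suc j \<in> {1..K}" and \<sigma>: "\<sigma> \<in> carrier_mat D D"
  shows "nm_step M j \<sigma> = relax M j (conj_by (U j) \<sigma>)"
proof -
  let ?E = "env_state M (Suc j)"
  have E: "?E \<in> carrier_mat e e" and trE: "mat_trace ?E = 1"
    using env_state[OF j(2)] by (auto simp: qstate_def intro: rank_one_sum_carrier)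
  have Uc: "U j \<in> carrier_mat D D" by (rule coll_unitary_carrier[OF j(1)])
  let ?B = "conj_by (U j) \<sigma>"
  have B: "?B \<in> carrier_mat (s * e) (s * e)" using conj_by_carrier[OF Uc \<sigma>] by (simp add: dims(4))
  have "conj_by (U j \<otimes>\<^sub>k 1\<^sub>m e) (\<sigma> \<otimes>\<^sub>k ?E) = ?B \<otimes>\<^sub>k ?E"
  proof -
    have U\<sigma>: "U j * \<sigma> \<in> carrier_mat D D" and Ua: "mat_adjoint (U j) \<in> carrier_mat D D"
      using Uc \<sigma> by (auto intro: mult_carrier_mat)
    have "(U j \<otimes>\<^sub>k 1\<^sub>m e) * (\<sigma> \<otimes>\<^sub>k ?E) = (U j * \<sigma>) \<otimes>\<^sub>k ?E"
      using kron_mult[OF Uc one_carrier_mat \<sigma> E] E by simp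
    moreover have "((U j * \<sigma>) \<otimes>\<^sub>k ?E) * (mat_adjoint (U j) \<otimes>\<^sub>k 1\<^sub>m e) = (U j * \<sigma> * mat_adjoint (U j)) \<otimes>\<^sub>k ?E"
      using kron_mult[OF U\<sigma> E Ua one_carrier_mat] E by simp
    ultimately show ?thesis unfolding conj_by_def kron_adjoint mat_adjoint_one by (simp only:)
  qed
  moreover have X: "?B \<otimes>\<^sub>k ?E \<in> carrier_mat (s * e * e) (s * e * e)" by (rule kron_carrier[OF B E])
  moreover have "1\<^sub>m s \<otimes>\<^sub>k swap_mat e \<in> carrier_mat (s * e * e) (s * e * e)"
    using kron_carrier[of "1\<^sub>m s" s s "swap_mat e" "e * e" "e * e"] by (simp add: mult.assoc)
  then have "conj_by (1\<^sub>m s \<otimes>\<^sub>k swap_mat e) (?B \<otimes>\<^sub>k ?E) \<in> carrier_mat (s * e * e) (s * e * e)"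
    using X by (rule conj_by_carrier)
  ultimately show ?thesis
    unfolding nm_step_def partial_swap_def relax_def
    by (simp add: ptrace_mid_linear ptrace_mid_kron[OF B E] ptrace_mid_swap_kron[OF B E] trE)
qed

lemma chain_state_carrier:
  assumes V: "\<And>i. i \<in> {1..K} \<Longrightarrow> V i \<in> carrier_mat D D" and \<rho>: "\<rho> \<in> carrier_mat s s" and "j < K"
  shows "chain_state M V \<rho> j \<in> carrier_mat D D"
  using \<open>j < K\<close>
proof (induction j)
  case 0
  then show ?case using kron_carrier[OF \<rho> env_state_carrier[of 1]] K by (simp add: dims(4))
next
  case (Suc j)
  then show ?case using V[of "Suc j"] by (auto intro!: relax_carrier conj_by_carrier)
qed

lemma nm_state_chain:
  assumes \<rho>: "\<rho> \<in> carrier_mat s s" and "j < K"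
  shows "nm_state M \<rho> j = chain_state M U \<rho> j"
  using \<open>j < K\<close>
proof (induction j)
  case (Suc j)
  then show ?case using chain_state_carrier[OF coll_unitary_carrier \<rho>, where j = j] by (simp add: nm_step_relax)
qed simp

lemma nm_collision_map_chain:
  "\<rho> \<in> carrier_mat s s \<Longrightarrow> mat_trace (A * nm_collision_map M K \<rho>) = chain_value M K U \<rho> A"
  using K by (simp add: nm_collision_map_def chain_value_def nm_state_chain)

text \<open>The new error has three parts: two telescoped differences applied to \<open>B\<close>,
  of size \<eta> (1 + \<eta>) and \<eta>, and the old error conjugated by \<open>V j\<close>, of
  size (1 + \<eta>)^2 c. Written as (1 + \<eta>)^2 (1 + c) - 1, the sum multiplies up under
  iteration.\<close>

lemma conj_by_perturbation:
  assumes j: "j \<in> {1..K}" and V: "V j \<in> carrier_mat D D"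
    and VU: "\<And>v. v \<in> carrier_vec D \<Longrightarrow> l2_norm ((V j - U j) *\<^sub>v v) \<le> \<eta> * l2_norm v" and \<eta>: "0 \<le> \<eta>"
    and B: "rank_one_sum False D B 1" and R: "rank_one_sum False D R c"
  shows "\<exists>R'. conj_by (V j) (B + R) = conj_by (U j) B + R' \<and>
    rank_one_sum False D R' ((1 + \<eta>)\<^sup>2 * (1 + c) - 1)"
proof -
  have Uu: "unitary_mat D (U j)" by (rule coll_unitary_unitary[OF j])
  have Uc: "U j \<in> carrier_mat D D" by (rule coll_unitary_carrier[OF j])
  have Bc: "B \<in> carrier_mat D D" and Rc: "R \<in> carrier_mat D D" using B R by (auto intro: rank_one_sum_carrier)
  have VUc: "V j - U j \<in> carrier_mat D D" using V Uc by auto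
  have Vn: "l2_norm (V j *\<^sub>v v) \<le> (1 + \<eta>) * l2_norm v" if "v \<in> carrier_vec D" for v
    by (rule l2_norm_le_of_near_unitary[OF Uu V that VU[OF that]])
  have Un: "l2_norm (U j *\<^sub>v v) \<le> 1 * l2_norm v" if "v \<in> carrier_vec D" for v
    using unitary_mat_l2_norm[OF Uu that] by simp
  let ?R1 = "(V j - U j) * B * mat_adjoint (V j)" and ?R2 = "U j * B * mat_adjoint (V j - U j)"
  have R1: "rank_one_sum False D ?R1 (\<eta> * (1 + \<eta>) * 1)"
    using \<eta> by (intro rank_one_sum_mult[OF B VUc V] VU Vn) auto
  have R2: "rank_one_sum False D ?R2 (1 * \<eta> * 1)"
    using \<eta> by (intro rank_one_sum_mult[OF B Uc VUc] VU Un) auto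
  have R3: "rank_one_sum False D (conj_by (V j) R) ((1 + \<eta>) * (1 + \<eta>) * c)"
    unfolding conj_by_def using \<eta> by (intro rank_one_sum_mult[OF R V V] Vn) auto
  have "conj_by (V j) (B + R) = conj_by (U j) B + ((?R1 + ?R2) + conj_by (V j) R)"
    unfolding conj_by_add[OF V Bc Rc] conj_by_diff[OF V Uc Bc]
    using rank_one_sum_carrier[OF R1] rank_one_sum_carrier[OF R2] rank_one_sum_carrier[OF R3] conj_by_carrier[OF Uc Bc]
    by (simp add: assoc_add_mat[of _ D D])
  moreover have "rank_one_sum False D ((?R1 + ?R2) + conj_by (V j) R) ((1 + \<eta>)\<^sup>2 * (1 + c) - 1)"
    using rank_one_sum.add[OF rank_one_sum.add[OF R1 R2] R3] by (simp add: power2_eq_square algebra_simps)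
  ultimately show ?thesis by blast
qed

lemma chain_state_rank_one_sum:
  assumes \<rho>: "qstate s \<rho>" and "j < K"
  shows "rank_one_sum False D (chain_state M U \<rho> j) 1"
  using \<open>j < K\<close>
proof (induction j)
  case 0
  then show ?case
    using rank_one_sum_kron[of True s \<rho> 1 e "env_state M 1" 1] \<rho> env_state[of 1] K
    by (auto simp: qstate_def dims(4) intro: rank_one_sum_False)
next
  case (Suc j)
  have j: "Suc j \<in> {1..K}" using Suc by simp
  have Uu: "unitary_mat D (U (Suc j))" by (rule coll_unitary_unitary[OF j])
  have "rank_one_sum False D (conj_by (U (Suc j)) (chain_state M U \<rho> j)) (1 * 1 * 1)"
    unfolding conj_by_def using Suc unitary_mat_l2_norm[OF Uu] coll_unitary_carrier[OF j]
    by (intro rank_one_sum_mult) auto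
  then show ?case using Suc by (auto intro: relax_rank_one_sum)
qed

text \<open>The relaxation adds nothing to the error, so each collision contributes one factor (1 +
  \<eta>)^2.\<close>

lemma chain_state_perturbation:
  assumes \<rho>: "qstate s \<rho>" and V: "\<And>i. i \<in> {1..K} \<Longrightarrow> V i \<in> carrier_mat D D"
    and VU: "\<And>i v. i \<in> {1..K} \<Longrightarrow> v \<in> carrier_vec D \<Longrightarrow> l2_norm ((V i - U i) *\<^sub>v v) \<le> \<eta> * l2_norm v"
    and \<eta>: "0 \<le> \<eta>" and "j < K"
  shows "\<exists>R. chain_state M V \<rho> j = chain_state M U \<rho> j + R \<and> rank_one_sum False D R ((1 + \<eta>) ^ (2 * j) - 1)"
  using \<open>j < K\<close>
proof (induction j)
  case 0
  have "\<rho> \<otimes>\<^sub>k env_state M 1 \<in> carrier_mat D D"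
    using kron_carrier[OF qstate_carrier[OF \<rho>] env_state_carrier[of 1]] K by (simp add: dims(4))
  then show ?case by (intro exI[of _ "0\<^sub>m D D"]) (auto simp: rank_one_sum.zero)
next
  case (Suc j)
  then obtain R where R: "chain_state M V \<rho> j = chain_state M U \<rho> j + R" "rank_one_sum False D R ((1 + \<eta>) ^ (2 * j) - 1)"
    by auto
  have j: "Suc j \<in> {1..K}" "Suc (Suc j) \<in> {1..K}" using Suc.prems by auto
  obtain R' where R': "conj_by (V (Suc j)) (chain_state M U \<rho> j + R) = conj_by (U (Suc j)) (chain_state M U \<rho> j) + R'"
    "rank_one_sum False D R' ((1 + \<eta>)\<^sup>2 * (1 + ((1 + \<eta>) ^ (2 * j) - 1)) - 1)"
    using conj_by_perturbation[where V = V, OF j(1) V[OF j(1)] VU[OF j(1)] \<eta> chain_state_rank_one_sum[OF \<rho>, of j] R(2)] Suc.prems by auto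
  have "conj_by (U (Suc j)) (chain_state M U \<rho> j) \<in> carrier_mat D D"
    using chain_state_carrier[OF coll_unitary_carrier qstate_carrier[OF \<rho>], where j = j] coll_unitary_carrier[OF j(1)] Suc.prems
    by (intro conj_by_carrier) auto
  then have "chain_state M V \<rho> (Suc j) = chain_state M U \<rho> (Suc j) + relax M (Suc j) R'"
    using R(1) R'(1) relax_add[OF j(2)] rank_one_sum_carrier[OF R'(2)] by simp
  moreover have "rank_one_sum False D (relax M (Suc j) R') ((1 + \<eta>) ^ (2 * Suc j) - 1)"
    using relax_rank_one_sum[OF j(2) R'(2)] by (simp add: power2_eq_square power_add mult_ac)
  ultimately show ?case by blast
qed

text \<open>The last collision is followed by a trace in place of a relaxation and is therefore
  treated outside the recursion. The bound on the exact value serves the case of a small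
  observable.\<close>

lemma chain_value_perturbation:
  assumes \<rho>: "qstate s \<rho>" and V: "\<And>i. i \<in> {1..K} \<Longrightarrow> V i \<in> carrier_mat D D"
    and VU: "\<And>i v. i \<in> {1..K} \<Longrightarrow> v \<in> carrier_vec D \<Longrightarrow> l2_norm ((V i - U i) *\<^sub>v v) \<le> \<eta> * l2_norm v"
    and \<eta>: "0 \<le> \<eta>" and A: "A \<in> carrier_mat s s"
  shows "cmod (chain_value M K V \<rho> A - chain_value M K U \<rho> A) \<le> spectral_norm A * ((1 + \<eta>) ^ (2 * K) - 1)"
    and "cmod (chain_value M K U \<rho> A) \<le> spectral_norm A"
proof -
  have K1: "K - 1 < K" "K \<in> {1..K}" using K by auto
  have An: "l2_norm (A *\<^sub>v v) \<le> spectral_norm A * l2_norm v" if "v \<in> carrier_vec s" for v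
    by (rule l2_norm_le_spectral_norm[OF A that])
  have A0: "0 \<le> spectral_norm A" by (rule spectral_norm_ge_0[OF A dims(1)])
  obtain R where R: "chain_state M V \<rho> (K - 1) = chain_state M U \<rho> (K - 1) + R"
      "rank_one_sum False D R ((1 + \<eta>) ^ (2 * (K - 1)) - 1)"
    using chain_state_perturbation[OF \<rho> V VU \<eta> K1(1)] by auto
  let ?B = "chain_state M U \<rho> (K - 1)"
  have B: "rank_one_sum False D ?B 1" by (rule chain_state_rank_one_sum[OF \<rho> K1(1)])
  obtain R' where R': "conj_by (V K) (?B + R) = conj_by (U K) ?B + R'"
    "rank_one_sum False D R' ((1 + \<eta>)\<^sup>2 * (1 + ((1 + \<eta>) ^ (2 * (K - 1)) - 1)) - 1)"
    using conj_by_perturbation[where V = V, OF K1(2) V[OF K1(2)] VU[OF K1(2)] \<eta> B R(2)] by auto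
  have pow: "(1 + \<eta>)\<^sup>2 * (1 + ((1 + \<eta>) ^ (2 * (K - 1)) - 1)) - 1 = (1 + \<eta>) ^ (2 * K) - 1"
    using K by (cases K) (simp_all add: power2_eq_square mult.assoc)
  have UBc: "conj_by (U K) ?B \<in> carrier_mat (s * e) (s * e)" and R'c: "R' \<in> carrier_mat (s * e) (s * e)"
    using conj_by_carrier[OF coll_unitary_carrier[OF K1(2)] rank_one_sum_carrier[OF B]] rank_one_sum_carrier[OF R'(2)]
    by (auto simp: dims(4))
  have "chain_value M K V \<rho> A = chain_value M K U \<rho> A + mat_trace (A * ptrace_last s e R')"
    unfolding chain_value_def R(1) R'(1) ptrace_last_add[OF UBc R'c]
      mult_add_distrib_mat[OF A ptrace_last_carrier ptrace_last_carrier]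
    by (rule mat_trace_add) (rule mult_carrier_mat[OF A ptrace_last_carrier])+
  moreover have "cmod (mat_trace (A * ptrace_last s e R')) \<le> spectral_norm A * ((1 + \<eta>) ^ (2 * K) - 1)"
    using R'(2) unfolding pow
    by (intro mat_trace_mult_bound[of False s] rank_one_sum_ptrace_last A A0 An) (simp add: dims(4))
  ultimately show "cmod (chain_value M K V \<rho> A - chain_value M K U \<rho> A) \<le> spectral_norm A * ((1 + \<eta>) ^ (2 * K) - 1)"
    by simp
  have "rank_one_sum False D (conj_by (U K) ?B) (1 * 1 * 1)"
    unfolding conj_by_def using B unitary_mat_l2_norm[OF coll_unitary_unitary[OF K1(2)]] coll_unitary_carrier[OF K1(2)]
    by (intro rank_one_sum_mult) auto
  then have "cmod (mat_trace (A * ptrace_last s e (conj_by (U K) ?B))) \<le> spectral_norm A * 1"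
    by (intro mat_trace_mult_bound[of False s] rank_one_sum_ptrace_last A A0 An) (simp add: dims(4))
  then show "cmod (chain_value M K U \<rho> A) \<le> spectral_norm A" by (simp add: chain_value_def)
qed

text \<open>After a swap, the register that is traced out holds the fresh state of trace 1, so the
  joint state survives unchanged.\<close>

lemma refresh_eq:
  assumes j: "Suc j \<in> {1..K}" and \<sigma>: "\<sigma> \<in> carrier_mat (2 * D) (2 * D)"
  shows "refresh M j b \<sigma> = (if b then \<sigma> else ptrace_last (2 * s) e \<sigma> \<otimes>\<^sub>k env_state M (Suc j))"
proof -
  have E: "env_state M (Suc j) \<in> carrier_mat e e" and trE: "mat_trace (env_state M (Suc j)) = 1"
    using env_state[OF j] by (auto simp: qstate_def intro: rank_one_sum_carrier)
  have \<sigma>': "\<sigma> \<in> carrier_mat (2 * s * e) (2 * s * e)" using \<sigma> by (simp add: dims(4) mult.assoc)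
  show ?thesis
    unfolding refresh_def Let_def using ptrace_mid_kron[OF \<sigma>' E] ptrace_mid_swap_kron[OF \<sigma>' E] trE by simp
qed

lemma qstate_refresh:
  assumes j: "Suc j \<in> {1..K}" and \<sigma>: "qstate (2 * D) \<sigma>"
  shows "qstate (2 * D) (refresh M j b \<sigma>)"
proof -
  have "qstate (2 * s * e) (ptrace_last (2 * s) e \<sigma> \<otimes>\<^sub>k env_state M (Suc j))"
    using \<sigma> by (intro qstate_kron qstate_ptrace_last env_state[OF j]) (simp add: dims(4) mult.assoc)
  then show ?thesis unfolding refresh_eq[OF j qstate_carrier[OF \<sigma>]] using \<sigma> by (simp add: dims(4) mult.assoc)
qed

text \<open>The coin of the algorithm reproduces the partial swap channel on average, separately on
  each ancilla block.\<close>

lemma refresh_block_relax: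
  assumes j: "Suc j \<in> {1..K}" and \<sigma>: "\<sigma> \<in> carrier_mat (2 * D) (2 * D)" and ab: "a < 2" "b < 2"
  shows "complex_of_real (1 - p) \<cdot>\<^sub>m ancilla_block D a b (refresh M j False \<sigma>)
      + complex_of_real p \<cdot>\<^sub>m ancilla_block D a b (refresh M j True \<sigma>) = relax M j (ancilla_block D a b \<sigma>)"
  using ancilla_block_ptrace_kron[OF _ env_state_carrier[OF j] ab, of \<sigma> s] \<sigma>
  by (simp add: refresh_eq[OF j \<sigma>] relax_def dims(4))

end

section \<open>The mean outcome of a coherent run\<close>

text \<open>Finite supports make every function integrable, so the tower rule needs no integrability
  conditions.\<close>

lemma expectation_bind_pmf_finite:
  fixes h :: "'b \<Rightarrow> 'c::{banach, second_countable_topology}"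
  assumes "finite (set_pmf P)" "\<And>x. x \<in> set_pmf P \<Longrightarrow> finite (set_pmf (f x))"
  shows "measure_pmf.expectation (P \<bind> f) h = measure_pmf.expectation P (\<lambda>x. measure_pmf.expectation (f x) h)"
  using assms by (subst pmf_expectation_bind[of "set_pmf P"]) (auto simp: integral_measure_pmf[of "set_pmf P"])

lemma expectation_pmf_cong:
  assumes "\<And>x. x \<in> set_pmf P \<Longrightarrow> f x = g x"
  shows "measure_pmf.expectation P f = measure_pmf.expectation P g"
  using assms by (intro integral_cong_AE) (auto simp: AE_measure_pmf_iff)

text \<open>Linearity is demanded on matrices of size d only, because \<open>complex mat\<close>
  contains all sizes and sums across sizes carry no meaning.\<close>

definition linear_functional :: "nat \<Rightarrow> (complex mat \<Rightarrow> complex) \<Rightarrow> bool" where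
  "linear_functional d \<phi> \<longleftrightarrow>
     (\<forall>A\<in>carrier_mat d d. \<forall>B\<in>carrier_mat d d. \<phi> (A + B) = \<phi> A + \<phi> B) \<and>
     (\<forall>c. \<forall>A\<in>carrier_mat d d. \<phi> (c \<cdot>\<^sub>m A) = c * \<phi> A)"

lemma linear_functional_mat_sum:
  assumes \<phi>: "linear_functional d \<phi>" and "finite I" and "\<And>x. x \<in> I \<Longrightarrow> F x \<in> carrier_mat d d"
  shows "\<phi> (mat_sum d F I) = (\<Sum>x\<in>I. \<phi> (F x))"
  using assms(2,3)
proof (induction I rule: finite_induct)
  case empty
  have "mat_sum d F {} = 0 \<cdot>\<^sub>m 0\<^sub>m d d" by (intro eq_matI) auto
  then have "\<phi> (mat_sum d F {}) = \<phi> (0 \<cdot>\<^sub>m 0\<^sub>m d d)" by (simp only:)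
  also have "\<dots> = 0 * \<phi> (0\<^sub>m d d)" using \<phi> unfolding linear_functional_def by (metis zero_carrier_mat)
  finally show ?case by simp
next
  case (insert x I)
  then show ?case using \<phi> by (simp add: mat_sum_insert linear_functional_def)
qed

text \<open>Turns the mean of scalar values into the value at one averaged matrix; this is the only
  form in which matrices are averaged.\<close>

lemma linear_functional_expectation:
  assumes \<phi>: "linear_functional d \<phi>" and I: "finite I" "set_pmf P \<subseteq> I"
    and F: "\<And>x. x \<in> I \<Longrightarrow> F x \<in> carrier_mat d d"
  shows "measure_pmf.expectation P (\<lambda>x. \<phi> (F x)) = \<phi> (mat_sum d (\<lambda>x. complex_of_real (pmf P x) \<cdot>\<^sub>m F x) I)"
proof -
  have "measure_pmf.expectation P (\<lambda>x. \<phi> (F x)) = (\<Sum>x\<in>I. pmf P x *\<^sub>R \<phi> (F x))"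
    using I by (intro integral_measure_pmf) auto
  also have "\<dots> = (\<Sum>x\<in>I. \<phi> (complex_of_real (pmf P x) \<cdot>\<^sub>m F x))"
    using \<phi> F by (intro sum.cong refl) (simp add: linear_functional_def scaleR_conv_of_real)
  also have "\<dots> = \<phi> (mat_sum d (\<lambda>x. complex_of_real (pmf P x) \<cdot>\<^sub>m F x) I)"
    using F by (intro linear_functional_mat_sum[symmetric, OF \<phi> I(1)]) auto
  finally show ?thesis .
qed

section \<open>Averaging over the sampled gates\<close>

locale lcu_run = collision +
  fixes r q :: "nat \<Rightarrow> nat"
  assumes r_pos: "\<And>j. j \<in> {1..K} \<Longrightarrow> 0 < r j"
begin

abbreviation "weight j \<equiv> coll_weight M j (r j) (q j)"
abbreviation "approx j \<equiv> coll_approx M j (r j) (q j)"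
abbreviation "sample j \<equiv> coll_sample M j (r j) (q j)"
abbreviation "gate j \<equiv> coll_gate M j (r j)"
abbreviation "indices j \<equiv> lcu_indices (length (normalized_terms M j)) (r j) (q j)"

text \<open>The expectation of a sampled gate, as \<open>mean_gate_sum\<close> shows; it need not be
  unitary.\<close>

definition mean_gate :: "nat \<Rightarrow> complex mat" where
  "mean_gate j = complex_of_real (1 / weight j) \<cdot>\<^sub>m approx j"

lemma weight_bounds:
  assumes j: "j \<in> {1..K}"
  shows "1 \<le> weight j" "weight j \<le> exp ((coll_tau M j)\<^sup>2 / real (r j))"
  using lcu_terms.lcu_weight_bounds[OF lcu_terms_normalized[OF j], of "coll_tau M j" "r j" "q j"]
    coll_tau_pos[OF j] r_pos[OF j] by (auto simp: coll_weight_def)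

lemma set_sample:
  assumes j: "j \<in> {1..K}"
  shows "set_pmf (sample j) \<subseteq> indices j"
  using lcu_terms.set_lcu_pmf[OF lcu_terms_normalized[OF j], of "coll_tau M j" "r j" "q j"]
    coll_tau_pos[OF j] r_pos[OF j] by (auto simp: coll_sample_def)

lemma finite_indices: "j \<in> {1..K} \<Longrightarrow> finite (indices j)"
  using lcu_terms.finite_lcu_indices[OF lcu_terms_normalized] by auto

lemma finite_sample: "j \<in> {1..K} \<Longrightarrow> finite (set_pmf (sample j))"
  using finite_subset[OF set_sample finite_indices] by auto

lemma gate_unitary:
  assumes j: "j \<in> {1..K}" and X: "X \<in> indices j"
  shows "unitary_mat D (gate j X)"
  using lcu_terms.lcu_unitary_unitary[OF lcu_terms_normalized[OF j] X] by (auto simp: coll_gate_def)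

lemma gate_carrier: "j \<in> {1..K} \<Longrightarrow> X \<in> indices j \<Longrightarrow> gate j X \<in> carrier_mat D D"
  using gate_unitary by (simp add: unitary_mat_def)

lemma mean_gate_carrier: "j \<in> {1..K} \<Longrightarrow> mean_gate j \<in> carrier_mat D D"
  using coll_approx_carrier by (simp add: mean_gate_def)

lemma mean_gate_sum:
  assumes j: "j \<in> {1..K}"
  shows "mat_sum D (\<lambda>X. complex_of_real (pmf (sample j) X) \<cdot>\<^sub>m gate j X) (indices j) = mean_gate j"
  using lcu_terms.lcu_pmf_mean[OF lcu_terms_normalized[OF j], of "coll_tau M j" "r j" "q j"]
    coll_tau_pos[OF j] r_pos[OF j]
  by (simp add: coll_sample_def coll_gate_def mean_gate_def coll_weight_def coll_approx_def)

lemma expectation_gate_left: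
  assumes j: "j \<in> {1..K}" and \<phi>: "linear_functional D \<phi>" and C: "C \<in> carrier_mat D D"
  shows "measure_pmf.expectation (sample j) (\<lambda>X. \<phi> (gate j X * C)) = \<phi> (mean_gate j * C)"
proof -
  have g: "gate j X \<in> carrier_mat D D" if "X \<in> indices j" for X using gate_carrier[OF j that] .
  have "measure_pmf.expectation (sample j) (\<lambda>X. \<phi> (gate j X * C))
      = \<phi> (mat_sum D (\<lambda>X. complex_of_real (pmf (sample j) X) \<cdot>\<^sub>m (gate j X * C)) (indices j))"
    using g C by (intro linear_functional_expectation \<phi> finite_indices j set_sample mult_carrier_mat)
  also have "mat_sum D (\<lambda>X. complex_of_real (pmf (sample j) X) \<cdot>\<^sub>m (gate j X * C)) (indices j)
      = mat_sum D (\<lambda>X. (complex_of_real (pmf (sample j) X) \<cdot>\<^sub>m gate j X) * C) (indices j)"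
    using g C by (intro mat_sum_cong refl) (simp add: mult_smult_assoc_mat[OF g C])
  also have "\<dots> = mean_gate j * C"
    unfolding mean_gate_sum[OF j, symmetric] using g C by (intro mat_sum_mult_right[symmetric]) auto
  finally show ?thesis .
qed

lemma expectation_gate_right:
  assumes j: "j \<in> {1..K}" and \<phi>: "linear_functional D \<phi>" and C: "C \<in> carrier_mat D D"
  shows "measure_pmf.expectation (sample j) (\<lambda>X. \<phi> (C * mat_adjoint (gate j X))) = \<phi> (C * mat_adjoint (mean_gate j))"
proof -
  have g: "gate j X \<in> carrier_mat D D" if "X \<in> indices j" for X using gate_carrier[OF j that] .
  have ga: "mat_adjoint (gate j X) \<in> carrier_mat D D" if "X \<in> indices j" for X using g[OF that] by simp
  have "measure_pmf.expectation (sample j) (\<lambda>X. \<phi> (C * mat_adjoint (gate j X)))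
      = \<phi> (mat_sum D (\<lambda>X. complex_of_real (pmf (sample j) X) \<cdot>\<^sub>m (C * mat_adjoint (gate j X))) (indices j))"
    using ga C by (intro linear_functional_expectation \<phi> finite_indices j set_sample mult_carrier_mat[OF C])
  also have "mat_sum D (\<lambda>X. complex_of_real (pmf (sample j) X) \<cdot>\<^sub>m (C * mat_adjoint (gate j X))) (indices j)
      = mat_sum D (\<lambda>X. C * mat_adjoint (complex_of_real (pmf (sample j) X) \<cdot>\<^sub>m gate j X)) (indices j)"
    using ga C by (intro mat_sum_cong refl) (simp add: mat_adjoint_smult mult_smult_distrib[OF C ga])
  also have "\<dots> = C * mat_sum D (\<lambda>X. mat_adjoint (complex_of_real (pmf (sample j) X) \<cdot>\<^sub>m gate j X)) (indices j)"
    using g C by (intro mat_sum_mult_left[symmetric]) auto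
  also have "mat_sum D (\<lambda>X. mat_adjoint (complex_of_real (pmf (sample j) X) \<cdot>\<^sub>m gate j X)) (indices j)
      = mat_adjoint (mean_gate j)"
    unfolding mean_gate_sum[OF j, symmetric] using g by (intro mat_sum_adjoint[symmetric]) auto
  finally show ?thesis .
qed

lemma conj_by_mean_gate:
  assumes j: "j \<in> {1..K}" and B: "B \<in> carrier_mat D D"
  shows "mean_gate j * B * mat_adjoint (mean_gate j) = complex_of_real (1 / (weight j)\<^sup>2) \<cdot>\<^sub>m conj_by (approx j) B"
proof -
  let ?c = "complex_of_real (1 / weight j)"
  have V: "approx j \<in> carrier_mat D D" "mat_adjoint (approx j) \<in> carrier_mat D D" using coll_approx_carrier[OF j] by auto
  have VB: "approx j * B \<in> carrier_mat D D" using V B by auto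
  have "mean_gate j * B * mat_adjoint (mean_gate j) = (?c \<cdot>\<^sub>m (approx j * B)) * (?c \<cdot>\<^sub>m mat_adjoint (approx j))"
    unfolding mean_gate_def mat_adjoint_smult mult_smult_assoc_mat[OF V(1) B] by simp
  also have "\<dots> = ?c \<cdot>\<^sub>m ((?c \<cdot>\<^sub>m (approx j * B)) * mat_adjoint (approx j))"
    using VB by (intro mult_smult_distrib[OF _ V(2)]) (rule smult_carrier_mat)
  also have "(?c \<cdot>\<^sub>m (approx j * B)) * mat_adjoint (approx j) = ?c \<cdot>\<^sub>m conj_by (approx j) B"
    unfolding conj_by_def by (rule mult_smult_assoc_mat[OF VB V(2)])
  finally show ?thesis by (simp add: smult_smult_mat power2_eq_square)
qed

text \<open>Independence appears as an iterated expectation: the inner sample is averaged while the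
  outer one is fixed. There are two versions because X acts from the left in one off-diagonal block
  and Y in the other.\<close>

lemma expectation_gate_pair:
  assumes j: "j \<in> {1..K}" and \<phi>: "linear_functional D \<phi>" and B: "B \<in> carrier_mat D D"
  shows "measure_pmf.expectation (sample j) (\<lambda>X. measure_pmf.expectation (sample j) (\<lambda>Y.
      \<phi> (gate j X * B * mat_adjoint (gate j Y)))) = complex_of_real (1 / (weight j)\<^sup>2) * \<phi> (conj_by (approx j) B)" (is ?A)
    and "measure_pmf.expectation (sample j) (\<lambda>X. measure_pmf.expectation (sample j) (\<lambda>Y.
      \<phi> (gate j Y * B * mat_adjoint (gate j X)))) = complex_of_real (1 / (weight j)\<^sup>2) * \<phi> (conj_by (approx j) B)" (is ?B)
proof -
  let ?G = "mean_gate j"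
  have G: "?G \<in> carrier_mat D D" "mat_adjoint ?G \<in> carrier_mat D D" using mean_gate_carrier[OF j] by auto
  have g: "gate j X \<in> carrier_mat D D" if "X \<in> set_pmf (sample j)" for X
    using gate_carrier[OF j] set_sample[OF j] that by auto
  have c: "conj_by (approx j) B \<in> carrier_mat D D" by (rule conj_by_carrier[OF coll_approx_carrier[OF j] B])
  have final: "\<phi> (?G * B * mat_adjoint ?G) = complex_of_real (1 / (weight j)\<^sup>2) * \<phi> (conj_by (approx j) B)"
    unfolding conj_by_mean_gate[OF j B] using \<phi> c by (simp add: linear_functional_def)
  have "measure_pmf.expectation (sample j) (\<lambda>X. measure_pmf.expectation (sample j) (\<lambda>Y.
      \<phi> (gate j X * B * mat_adjoint (gate j Y)))) = measure_pmf.expectation (sample j) (\<lambda>X. \<phi> (gate j X * (B * mat_adjoint ?G)))"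
  proof (rule expectation_pmf_cong)
    fix X assume "X \<in> set_pmf (sample j)"
    then show "measure_pmf.expectation (sample j) (\<lambda>Y. \<phi> (gate j X * B * mat_adjoint (gate j Y))) = \<phi> (gate j X * (B * mat_adjoint ?G))"
      using expectation_gate_right[OF j \<phi>, of "gate j X * B"] g[of X] B G assoc_mult_mat[of "gate j X" D D B D "mat_adjoint ?G" D] by auto
  qed
  also have "\<dots> = \<phi> (?G * (B * mat_adjoint ?G))"
    using B G by (intro expectation_gate_left[OF j \<phi>]) auto
  also have "?G * (B * mat_adjoint ?G) = ?G * B * mat_adjoint ?G"
    using B G by (intro assoc_mult_mat[symmetric])
  finally show ?A unfolding final .
  have "measure_pmf.expectation (sample j) (\<lambda>X. measure_pmf.expectation (sample j) (\<lambda>Y.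
      \<phi> (gate j Y * B * mat_adjoint (gate j X)))) = measure_pmf.expectation (sample j) (\<lambda>X. \<phi> ((?G * B) * mat_adjoint (gate j X)))"
  proof (rule expectation_pmf_cong)
    fix X assume X: "X \<in> set_pmf (sample j)"
    have Xa: "mat_adjoint (gate j X) \<in> carrier_mat D D" using g[OF X] by simp
    have "measure_pmf.expectation (sample j) (\<lambda>Y. \<phi> (gate j Y * B * mat_adjoint (gate j X)))
        = measure_pmf.expectation (sample j) (\<lambda>Y. \<phi> (gate j Y * (B * mat_adjoint (gate j X))))"
      by (intro expectation_pmf_cong, subst assoc_mult_mat[OF g B Xa]) auto
    also have "\<dots> = \<phi> (?G * (B * mat_adjoint (gate j X)))"
      using B Xa by (intro expectation_gate_left[OF j \<phi>]) auto
    also have "?G * (B * mat_adjoint (gate j X)) = ?G * B * mat_adjoint (gate j X)"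
      using B G Xa by (intro assoc_mult_mat[symmetric])
    finally show "measure_pmf.expectation (sample j) (\<lambda>Y. \<phi> (gate j Y * B * mat_adjoint (gate j X)))
        = \<phi> ((?G * B) * mat_adjoint (gate j X))" .
  qed
  also have "\<dots> = \<phi> (?G * B * mat_adjoint ?G)"
    using B G by (intro expectation_gate_right[OF j \<phi>]) auto
  finally show ?B unfolding final .
qed

lemma interact_qstate:
  assumes j: "j \<in> {1..K}" and XY: "X \<in> indices j" "Y \<in> indices j" and \<sigma>: "qstate (2 * D) \<sigma>"
  shows "qstate (2 * D) (interact M j (r j) X Y \<sigma>)"
  unfolding interact_def controlled_def anti_controlled_def
  by (intro qstate_conj_by unitary_controlled_sum gate_unitary[OF j] unitary_mat_one XY \<sigma>)

text \<open>The controlled gate acts where the ancilla is 1, the anti-controlled gate where it is 0.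
  An off-diagonal block thus receives one sample from the left and the adjoint of the other from the
  right.\<close>

lemma interact_block:
  assumes j: "j \<in> {1..K}" and XY: "X \<in> indices j" "Y \<in> indices j" and \<sigma>: "\<sigma> \<in> carrier_mat (2 * D) (2 * D)"
  shows "ancilla_block D 0 1 (interact M j (r j) X Y \<sigma>) = gate j Y * ancilla_block D 0 1 \<sigma> * mat_adjoint (gate j X)"
    and "ancilla_block D 1 0 (interact M j (r j) X Y \<sigma>) = gate j X * ancilla_block D 1 0 \<sigma> * mat_adjoint (gate j Y)"
proof -
  have X: "gate j X \<in> carrier_mat D D" and Y: "gate j Y \<in> carrier_mat D D" using gate_carrier[OF j] XY by auto
  have \<sigma>': "conj_by (proj0 \<otimes>\<^sub>k 1\<^sub>m D + proj1 \<otimes>\<^sub>k gate j X) \<sigma> \<in> carrier_mat (2 * D) (2 * D)"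
    using X \<sigma> by (intro conj_by_carrier controlled_sum_carrier) auto
  have c: "mat_adjoint (gate j X) \<in> carrier_mat D D" "mat_adjoint (gate j Y) \<in> carrier_mat D D" using X Y by auto
  have lt: "(0::nat) < 2" "(1::nat) < 2" by auto
  have "ancilla_block D 0 1 (interact M j (r j) X Y \<sigma>)
      = gate j Y * (1\<^sub>m D * ancilla_block D 0 1 \<sigma> * mat_adjoint (gate j X)) * mat_adjoint (1\<^sub>m D)"
    unfolding interact_def controlled_def anti_controlled_def
      ancilla_block_conj[OF Y one_carrier_mat \<sigma>' lt] ancilla_block_conj[OF one_carrier_mat X \<sigma> lt] by simp
  also have "\<dots> = gate j Y * (ancilla_block D 0 1 \<sigma> * mat_adjoint (gate j X))"
    using c Y by (simp add: mult_carrier_mat[of _ D D] left_mult_one_mat[of _ D D] right_mult_one_mat[of _ D D])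
  also have "\<dots> = gate j Y * ancilla_block D 0 1 \<sigma> * mat_adjoint (gate j X)"
    using c Y by (intro assoc_mult_mat[symmetric]) auto
  finally show "ancilla_block D 0 1 (interact M j (r j) X Y \<sigma>) = gate j Y * ancilla_block D 0 1 \<sigma> * mat_adjoint (gate j X)" .
  have "ancilla_block D 1 0 (interact M j (r j) X Y \<sigma>)
      = 1\<^sub>m D * (gate j X * ancilla_block D 1 0 \<sigma> * mat_adjoint (1\<^sub>m D)) * mat_adjoint (gate j Y)"
    unfolding interact_def controlled_def anti_controlled_def
      ancilla_block_conj[OF Y one_carrier_mat \<sigma>' lt(2,1)] ancilla_block_conj[OF one_carrier_mat X \<sigma> lt(2,1)] by simp
  also have "\<dots> = gate j X * ancilla_block D 1 0 \<sigma> * mat_adjoint (gate j Y)"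
    using c X by (simp add: mult_carrier_mat[of _ D D] left_mult_one_mat[of _ D D] right_mult_one_mat[of _ D D])
  finally show "ancilla_block D 1 0 (interact M j (r j) X Y \<sigma>) = gate j X * ancilla_block D 1 0 \<sigma> * mat_adjoint (gate j Y)" .
qed

lemma linear_functional_relax:
  assumes j: "Suc j \<in> {1..K}" and \<phi>: "linear_functional D \<phi>"
  shows "linear_functional D (\<lambda>B. \<phi> (relax M j B))"
  using \<phi> relax_carrier[OF j] unfolding linear_functional_def
  by (auto simp: relax_add[OF j] relax_smult[OF j])

lemma linear_functional_conj_by:
  assumes V: "V \<in> carrier_mat D D" and \<phi>: "linear_functional D \<phi>"
  shows "linear_functional D (\<lambda>B. \<phi> (conj_by V B))"
proof -
  have Va: "mat_adjoint V \<in> carrier_mat D D" using V by simp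
  have "conj_by V (c \<cdot>\<^sub>m B) = c \<cdot>\<^sub>m conj_by V B" if B: "B \<in> carrier_mat D D" for c B
    unfolding conj_by_def mult_smult_distrib[OF V B] by (rule mult_smult_assoc_mat[OF mult_carrier_mat[OF V B] Va])
  then show ?thesis
    using \<phi> conj_by_carrier[OF V] unfolding linear_functional_def by (auto simp: conj_by_add[OF V])
qed

section \<open>The run as a Markov chain of collisions\<close>

lemma finite_bind_pmf: "finite (set_pmf P) \<Longrightarrow> (\<And>x. x \<in> set_pmf P \<Longrightarrow> finite (set_pmf (f x))) \<Longrightarrow> finite (set_pmf (P \<bind> f))"
  by (auto simp: set_bind_pmf)

lemma finite_bernoulli_pmf: "finite (set_pmf (bernoulli_pmf x))"
  by (rule finite_subset[of _ UNIV]) auto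

text \<open>One pass of the loop as a Markov kernel, so that the run is an iterated
  \<open>bind\<close> and each property of the run reduces to one of the kernel.\<close>

definition collide :: "nat \<Rightarrow> complex mat \<times> nat \<Rightarrow> (complex mat \<times> nat) pmf" where
  "collide j x = do {
     X \<leftarrow> sample j;
     Y \<leftarrow> sample j;
     b \<leftarrow> bernoulli_pmf p;
     return_pmf (refresh M j b (interact M j (r j) X Y (fst x)),
       snd x + lcu_depth X + lcu_depth Y + prep_depth M (Suc j) + (if b then 1 else 0))
   }"

lemma run_state_Suc: "run_state M \<rho> r q (Suc j) = run_state M \<rho> r q j \<bind> collide (Suc j)"
  unfolding run_state.simps(2) collide_def by (intro arg_cong2[of _ _ _ _ bind_pmf] refl ext) (simp add: split_beta)

lemma finite_collide: "j \<in> {1..K} \<Longrightarrow> finite (set_pmf (collide j x))"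
  unfolding collide_def by (intro finite_bind_pmf finite_sample finite_bernoulli_pmf) auto

lemma set_collide:
  assumes j: "j \<in> {1..K}" and y: "y \<in> set_pmf (collide j x)"
  obtains X Y b where "X \<in> indices j" "Y \<in> indices j"
    "y = (refresh M j b (interact M j (r j) X Y (fst x)),
       snd x + lcu_depth X + lcu_depth Y + prep_depth M (Suc j) + (if b then 1 else 0))"
  using y set_sample[OF j] unfolding collide_def by (auto simp: set_bind_pmf)

lemma finite_run_state: "j < K \<Longrightarrow> finite (set_pmf (run_state M \<rho> r q j))"
proof (induction j)
  case (Suc j)
  then show ?case unfolding run_state_Suc by (intro finite_bind_pmf finite_collide) auto
qed simp

lemma qstate_plus: "qstate 2 plus_state"
proof (rule density_mat_qstate)
  have entries: "plus_state $$ (i, k) = 1 / 2" if "i < 2" "k < 2" for i k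
    using that by (auto simp: plus_state_def mat_of_rows_list_def less_2_cases_iff)
  have c: "plus_state \<in> carrier_mat 2 2"
    by (intro carrier_matI) (auto simp: plus_state_def mat_of_rows_list_def)
  have "0 \<le> Re ((plus_state *\<^sub>v v) \<bullet>c v)" if v: "v \<in> carrier_vec 2" for v
  proof -
    let ?z = "vec_index v 0 + vec_index v 1"
    have "(plus_state *\<^sub>v v) \<bullet>c v = (\<Sum>k<2. (\<Sum>l<2. 1 / 2 * vec_index v l) * cnj (vec_index v k))"
      using c v by (simp add: cscalar_prod_sum mult_vec_index entries del: index_mult_mat_vec)
    also have "\<dots> = 1 / 2 * (?z * cnj ?z)" by (simp add: numeral_2_eq_2 algebra_simps)
    also have "\<dots> = complex_of_real (1 / 2 * (cmod ?z)\<^sup>2)" by (simp only: of_real_mult complex_norm_square) simp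
    finally show ?thesis by (simp only: Re_complex_of_real) simp
  qed
  moreover have "mat_adjoint plus_state = plus_state" using c by (intro eq_matI) (auto simp: entries)
  moreover have "mat_trace plus_state = 1" using c by (simp add: mat_trace_def numeral_2_eq_2 entries)
  ultimately show "density_mat 2 plus_state" using c by (auto simp: density_mat_def hermitian_mat_def)
qed

lemma run_state_qstate:
  assumes \<rho>: "qstate s \<rho>" and "j < K" and "x \<in> set_pmf (run_state M \<rho> r q j)"
  shows "qstate (2 * D) (fst x)"
  using assms(2,3)
proof (induction j arbitrary: x)
  case 0
  then have "fst x = plus_state \<otimes>\<^sub>k (\<rho> \<otimes>\<^sub>k env_state M 1)" by simp
  moreover have "qstate (2 * (s * e)) (plus_state \<otimes>\<^sub>k (\<rho> \<otimes>\<^sub>k env_state M 1))"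
    using K by (intro qstate_kron qstate_plus \<rho> env_state) auto
  ultimately show ?case by (simp add: dims(4))
next
  case (Suc j)
  have j: "Suc j \<in> {1..K}" "Suc (Suc j) \<in> {1..K}" using Suc.prems by auto
  obtain y where y: "y \<in> set_pmf (run_state M \<rho> r q j)" "x \<in> set_pmf (collide (Suc j) y)"
    using Suc.prems(2) unfolding run_state_Suc by (auto simp: set_bind_pmf)
  from y(2) obtain X Y b where XY: "X \<in> indices (Suc j)" "Y \<in> indices (Suc j)"
    "fst x = refresh M (Suc j) b (interact M (Suc j) (r (Suc j)) X Y (fst y))"
    using set_collide[OF j(1)] by (metis fst_conv)
  show ?case unfolding XY(3) using Suc.IH[OF _ y(1)] Suc.prems(1)
    by (intro qstate_refresh[OF j(2)] interact_qstate[OF j(1) XY(1,2)]) auto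
qed

text \<open>A collision costs two words of depth at most \<open>R\<close>, at most one swap and one
  preparation; the initial preparation explains the factor j + 1.\<close>

lemma run_state_depth:
  assumes R: "\<And>i. i \<in> {1..K} \<Longrightarrow> r i * (q i + 1) \<le> R" and P: "\<And>i. i \<in> {1..K} \<Longrightarrow> prep_depth M i \<le> P"
    and "j < K" and "x \<in> set_pmf (run_state M \<rho> r q j)"
  shows "snd x \<le> j * (2 * R + 1) + (j + 1) * P"
  using assms(3,4)
proof (induction j arbitrary: x)
  case 0
  then show ?case using P[of 1] K by simp
next
  case (Suc j)
  have j: "Suc j \<in> {1..K}" "Suc (Suc j) \<in> {1..K}" using Suc.prems by auto
  obtain y where y: "y \<in> set_pmf (run_state M \<rho> r q j)" "x \<in> set_pmf (collide (Suc j) y)"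
    using Suc.prems(2) unfolding run_state_Suc by (auto simp: set_bind_pmf)
  from y(2) obtain X Y and b :: bool where XY: "X \<in> indices (Suc j)" "Y \<in> indices (Suc j)"
    "snd x = snd y + lcu_depth X + lcu_depth Y + prep_depth M (Suc (Suc j)) + (if b then 1 else 0)"
    using set_collide[OF j(1)] by (metis snd_conv)
  have "lcu_depth X \<le> R" "lcu_depth Y \<le> R"
    using lcu_terms.lcu_depth_le[OF lcu_terms_normalized[OF j(1)] XY(1)] lcu_terms.lcu_depth_le[OF lcu_terms_normalized[OF j(1)] XY(2)]
      R[OF j(1)] by linarith+
  moreover have "snd y \<le> j * (2 * R + 1) + (j + 1) * P" using Suc.IH[OF _ y(1)] Suc.prems(1) by simp
  ultimately show ?case unfolding XY(3) using P[OF j(2)] by (auto simp: algebra_simps)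
qed

lemma expectation_interact:
  assumes j: "j \<in> {1..K}" and \<phi>: "linear_functional D \<phi>" and \<sigma>: "\<sigma> \<in> carrier_mat (2 * D) (2 * D)"
    and ab: "(a, b) = (0, 1) \<or> (a, b) = (1, 0)"
  shows "measure_pmf.expectation (sample j) (\<lambda>X. measure_pmf.expectation (sample j) (\<lambda>Y.
      \<phi> (ancilla_block D a b (interact M j (r j) X Y \<sigma>))))
    = complex_of_real (1 / (weight j)\<^sup>2) * \<phi> (conj_by (approx j) (ancilla_block D a b \<sigma>))"
  using ab
proof (elim disjE)
  assume ab: "(a, b) = (0, 1)"
  have "measure_pmf.expectation (sample j) (\<lambda>X. measure_pmf.expectation (sample j) (\<lambda>Y.
      \<phi> (ancilla_block D a b (interact M j (r j) X Y \<sigma>))))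
    = measure_pmf.expectation (sample j) (\<lambda>X. measure_pmf.expectation (sample j) (\<lambda>Y.
      \<phi> (gate j Y * ancilla_block D a b \<sigma> * mat_adjoint (gate j X))))"
    using interact_block(1)[OF j _ _ \<sigma>] set_sample[OF j] ab by (intro expectation_pmf_cong arg_cong[of _ _ \<phi>]) auto
  then show ?thesis using expectation_gate_pair(2)[OF j \<phi> ancilla_block_carrier] by simp
next
  assume ab: "(a, b) = (1, 0)"
  have "measure_pmf.expectation (sample j) (\<lambda>X. measure_pmf.expectation (sample j) (\<lambda>Y.
      \<phi> (ancilla_block D a b (interact M j (r j) X Y \<sigma>))))
    = measure_pmf.expectation (sample j) (\<lambda>X. measure_pmf.expectation (sample j) (\<lambda>Y.
      \<phi> (gate j X * ancilla_block D a b \<sigma> * mat_adjoint (gate j Y))))"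
    using interact_block(2)[OF j _ _ \<sigma>] set_sample[OF j] ab by (intro expectation_pmf_cong arg_cong[of _ _ \<phi>]) auto
  then show ?thesis using expectation_gate_pair(1)[OF j \<phi> ancilla_block_carrier] by simp
qed

text \<open>The draws are averaged from the inside out: the coin produces \<open>relax\<close>, and
  the two samples then produce the conjugation by the truncated operator, with one factor 1/weight
  each.\<close>

lemma expectation_collide:
  assumes j: "j \<in> {1..K}" "Suc j \<in> {1..K}" and \<phi>: "linear_functional D \<phi>" and \<sigma>: "qstate (2 * D) (fst x)"
    and ab: "(a, b) = (0, 1) \<or> (a, b) = (1, 0)"
  shows "measure_pmf.expectation (collide j x) (\<lambda>y. \<phi> (ancilla_block D a b (fst y)))
    = complex_of_real (1 / (weight j)\<^sup>2) * \<phi> (relax M j (conj_by (approx j) (ancilla_block D a b (fst x))))"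
proof -
  let ?h = "\<lambda>y :: complex mat \<times> nat. \<phi> (ancilla_block D a b (fst y))"
  let ?I = "\<lambda>X Y. interact M j (r j) X Y (fst x)"
  have ab2: "a < 2" "b < 2" using ab by auto
  have "measure_pmf.expectation (collide j x) ?h
      = measure_pmf.expectation (sample j) (\<lambda>X. measure_pmf.expectation (sample j) (\<lambda>Y.
          measure_pmf.expectation (bernoulli_pmf p) (\<lambda>c. \<phi> (ancilla_block D a b (refresh M j c (?I X Y))))))"
    unfolding collide_def using j
    by (simp add: expectation_bind_pmf_finite finite_bind_pmf finite_sample finite_bernoulli_pmf del: integral_bernoulli_pmf)
  also have "\<dots> = measure_pmf.expectation (sample j) (\<lambda>X. measure_pmf.expectation (sample j) (\<lambda>Y.
      \<phi> (relax M j (ancilla_block D a b (?I X Y)))))"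
  proof (intro expectation_pmf_cong)
    fix X Y assume "X \<in> set_pmf (sample j)" "Y \<in> set_pmf (sample j)"
    then have I: "?I X Y \<in> carrier_mat (2 * D) (2 * D)"
      using set_sample[OF j(1)] by (intro qstate_carrier interact_qstate[OF j(1) _ _ \<sigma>]) auto
    have "\<phi> (relax M j (ancilla_block D a b (?I X Y)))
        = complex_of_real (1 - p) * \<phi> (ancilla_block D a b (refresh M j False (?I X Y)))
          + complex_of_real p * \<phi> (ancilla_block D a b (refresh M j True (?I X Y)))"
      unfolding refresh_block_relax[OF j(2) I ab2, symmetric] using \<phi> by (simp add: linear_functional_def)
    then show "measure_pmf.expectation (bernoulli_pmf p) (\<lambda>c. \<phi> (ancilla_block D a b (refresh M j c (?I X Y))))
        = \<phi> (relax M j (ancilla_block D a b (?I X Y)))"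
      using swap_prob by (subst integral_measure_pmf[of UNIV]) (auto simp: UNIV_bool scaleR_conv_of_real)
  qed
  also have "\<dots> = complex_of_real (1 / (weight j)\<^sup>2) * \<phi> (relax M j (conj_by (approx j) (ancilla_block D a b (fst x))))"
    by (rule expectation_interact[OF j(1) linear_functional_relax[OF j(2) \<phi>] qstate_carrier[OF \<sigma>] ab])
  finally show ?thesis .
qed

text \<open>The induction is general in \<phi>: averaging over the last collision replaces \<phi> by
  \<open>?\<psi>\<close>, for which the hypothesis on the earlier collisions is used. The factor 1/2
  is the entry of the plus state.\<close>

lemma expectation_run_state:
  assumes \<rho>: "qstate s \<rho>" and "j < K" and \<phi>: "linear_functional D \<phi>"
    and ab: "(a, b) = (0, 1) \<or> (a, b) = (1, 0)"
  shows "measure_pmf.expectation (run_state M \<rho> r q j) (\<lambda>x. \<phi> (ancilla_block D a b (fst x)))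
    = complex_of_real (1 / 2 * (\<Prod>i=1..j. 1 / (weight i)\<^sup>2)) * \<phi> (chain_state M approx \<rho> j)"
  using assms(2) \<phi>
proof (induction j arbitrary: \<phi>)
  case 0
  have c: "\<rho> \<otimes>\<^sub>k env_state M 1 \<in> carrier_mat D D"
    using kron_carrier[OF qstate_carrier[OF \<rho>] env_state_carrier[of 1]] K by (simp add: dims(4))
  have "ancilla_block D a b (plus_state \<otimes>\<^sub>k (\<rho> \<otimes>\<^sub>k env_state M 1)) = (1 / 2) \<cdot>\<^sub>m (\<rho> \<otimes>\<^sub>k env_state M 1)"
    using ab by (intro ancilla_block_plus[OF c]) auto
  then show ?case using 0 c by (simp add: linear_functional_def)
next
  case (Suc j)
  have j: "Suc j \<in> {1..K}" "Suc (Suc j) \<in> {1..K}" using Suc.prems by auto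
  let ?\<psi> = "\<lambda>B. \<phi> (relax M (Suc j) (conj_by (approx (Suc j)) B))"
  have \<psi>: "linear_functional D ?\<psi>"
    using linear_functional_conj_by[OF coll_approx_carrier[OF j(1)] linear_functional_relax[OF j(2) Suc.prems(2)]] .
  have "measure_pmf.expectation (run_state M \<rho> r q (Suc j)) (\<lambda>x. \<phi> (ancilla_block D a b (fst x)))
      = measure_pmf.expectation (run_state M \<rho> r q j) (\<lambda>x. measure_pmf.expectation (collide (Suc j) x) (\<lambda>y. \<phi> (ancilla_block D a b (fst y))))"
    unfolding run_state_Suc using Suc.prems(1) j by (intro expectation_bind_pmf_finite finite_run_state finite_collide) auto
  also have "\<dots> = measure_pmf.expectation (run_state M \<rho> r q j) (\<lambda>x. complex_of_real (1 / (weight (Suc j))\<^sup>2) * ?\<psi> (ancilla_block D a b (fst x)))"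
    using run_state_qstate[OF \<rho>, of j] Suc.prems(1)
    by (intro expectation_pmf_cong expectation_collide[OF j Suc.prems(2) _ ab]) auto
  also have "\<dots> = complex_of_real (1 / (weight (Suc j))\<^sup>2) * measure_pmf.expectation (run_state M \<rho> r q j) (\<lambda>x. ?\<psi> (ancilla_block D a b (fst x)))"
    by (rule integral_mult_right_zero)
  also have "\<dots> = complex_of_real (1 / (weight (Suc j))\<^sup>2) * (complex_of_real (1 / 2 * (\<Prod>i=1..j. 1 / (weight i)\<^sup>2)) * ?\<psi> (chain_state M approx \<rho> j))"
    by (rule arg_cong[OF Suc.IH[OF _ \<psi>]]) (use Suc.prems(1) in simp)
  also have "\<dots> = complex_of_real (1 / 2 * (\<Prod>i=1..Suc j. 1 / (weight i)\<^sup>2)) * \<phi> (chain_state M approx \<rho> (Suc j))"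
    by (simp add: mult_ac)
  finally show ?case .
qed

definition final_outcome :: "complex mat \<Rightarrow> complex mat \<times> nat \<Rightarrow> lcu_block list \<Rightarrow> lcu_block list \<Rightarrow> real pmf" where
  "final_outcome A x X Y = outcome_pmf (2 * s) (pauli_mat Pauli_X \<otimes>\<^sub>k A)
     (ptrace_last (2 * s) e (interact M K (r K) X Y (fst x)))"

lemma coherent_run_eq:
  "coherent_run M K \<rho> A r q = run_state M \<rho> r q (K - 1) \<bind> (\<lambda>x. sample K \<bind> (\<lambda>X. sample K \<bind> (\<lambda>Y.
     map_pmf (\<lambda>\<mu>. (\<mu>, snd x + lcu_depth X + lcu_depth Y)) (final_outcome A x X Y))))"
  unfolding coherent_run_def final_outcome_def map_pmf_def
  by (intro arg_cong2[of _ _ _ _ bind_pmf] refl ext) (simp add: split_beta)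

lemma final_outcome_properties:
  assumes A: "hermitian_mat s A" and x: "qstate (2 * D) (fst x)" and XY: "X \<in> indices K" "Y \<in> indices K"
  shows "finite (set_pmf (final_outcome A x X Y))"
    and "\<And>\<mu>. \<mu> \<in> set_pmf (final_outcome A x X Y) \<Longrightarrow> \<bar>\<mu>\<bar> \<le> spectral_norm A"
    and "measure_pmf.expectation (final_outcome A x X Y) (\<lambda>\<mu>. complex_of_real \<mu>) =
      mat_trace (A * ptrace_last s e (ancilla_block D 0 1 (interact M K (r K) X Y (fst x))))
      + mat_trace (A * ptrace_last s e (ancilla_block D 1 0 (interact M K (r K) X Y (fst x))))"
proof -
  have K1: "K \<in> {1..K}" using K by auto
  have Ac: "A \<in> carrier_mat s s" and Aadj: "mat_adjoint A = A" using A by (auto simp: hermitian_mat_def)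
  let ?I = "interact M K (r K) X Y (fst x)"
  have I: "qstate (2 * D) ?I" by (rule interact_qstate[OF K1 XY x])
  have Ic: "?I \<in> carrier_mat (2 * (s * e)) (2 * (s * e))" using qstate_carrier[OF I] by (simp add: dims(4))
  have herm: "hermitian_mat (2 * s) (pauli_mat Pauli_X \<otimes>\<^sub>k A)"
    unfolding hermitian_mat_def kron_adjoint pauli_mat_adjoint Aadj using kron_carrier[OF pauli_mat_carrier Ac] by blast
  have \<sigma>: "qstate (2 * s) (ptrace_last (2 * s) e ?I)"
    using I by (intro qstate_ptrace_last) (simp add: dims(4) mult.assoc)
  have norm: "l2_norm ((pauli_mat Pauli_X \<otimes>\<^sub>k A) *\<^sub>v v) \<le> spectral_norm A * l2_norm v" if "v \<in> carrier_vec (2 * s)" for v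
    using spectral_norm_ge_0[OF Ac dims(1)] l2_norm_le_spectral_norm[OF Ac] that by (intro l2_norm_pauli_X_kron[OF Ac])
  note props = outcome_pmf_properties[OF herm \<sigma> spectral_norm_ge_0[OF Ac dims(1)] norm]
  show "finite (set_pmf (final_outcome A x X Y))" unfolding final_outcome_def by (rule props(1))
  show "\<bar>\<mu>\<bar> \<le> spectral_norm A" if "\<mu> \<in> set_pmf (final_outcome A x X Y)" for \<mu>
    using that props(2) unfolding final_outcome_def by blast
  have "measure_pmf.expectation (final_outcome A x X Y) (\<lambda>\<mu>. complex_of_real \<mu>)
      = mat_trace ((pauli_mat Pauli_X \<otimes>\<^sub>k A) * ptrace_last (2 * s) e ?I)"
  proof -
    have "complex_of_real (measure_pmf.expectation (final_outcome A x X Y) (\<lambda>\<mu>. \<mu>))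
        = mat_trace ((pauli_mat Pauli_X \<otimes>\<^sub>k A) * ptrace_last (2 * s) e ?I)"
      unfolding final_outcome_def by (rule props(3))
    then show ?thesis by (simp only: integral_complex_of_real)
  qed
  then show "measure_pmf.expectation (final_outcome A x X Y) (\<lambda>\<mu>. complex_of_real \<mu>) =
      mat_trace (A * ptrace_last s e (ancilla_block D 0 1 ?I)) + mat_trace (A * ptrace_last s e (ancilla_block D 1 0 ?I))"
    unfolding mat_trace_pauli_X[OF Ac Ic] dims(4) .
qed

text \<open>There are K - 1 passes of the loop and a final interaction without swap, so the bound
  has one unit to spare. The K preparations include the initial one.\<close>

lemma coherent_run_support:
  assumes A: "hermitian_mat s A" and \<rho>: "qstate s \<rho>"
    and R: "\<And>i. i \<in> {1..K} \<Longrightarrow> r i * (q i + 1) \<le> R" and P: "\<And>i. i \<in> {1..K} \<Longrightarrow> prep_depth M i \<le> P"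
    and y: "y \<in> set_pmf (coherent_run M K \<rho> A r q)"
  shows "\<bar>fst y\<bar> \<le> spectral_norm A" and "snd y \<le> K * (2 * R + 1) + K * P"
proof -
  have K1: "K \<in> {1..K}" "K - 1 < K" using K by auto
  obtain x X Y where x: "x \<in> set_pmf (run_state M \<rho> r q (K - 1))" and XY: "X \<in> indices K" "Y \<in> indices K"
    and out: "y \<in> set_pmf (map_pmf (\<lambda>\<mu>. (\<mu>, snd x + lcu_depth X + lcu_depth Y)) (final_outcome A x X Y))"
    using y set_sample[OF K1(1)] unfolding coherent_run_eq set_bind_pmf by blast
  from out obtain \<mu> where \<mu>: "\<mu> \<in> set_pmf (final_outcome A x X Y)" and yeq: "y = (\<mu>, snd x + lcu_depth X + lcu_depth Y)"
    unfolding set_map_pmf by blast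
  show "\<bar>fst y\<bar> \<le> spectral_norm A"
    using final_outcome_properties(2)[OF A run_state_qstate[OF \<rho> K1(2) x] XY \<mu>] yeq by simp
  have "lcu_depth X \<le> R" "lcu_depth Y \<le> R"
    using lcu_terms.lcu_depth_le[OF lcu_terms_normalized[OF K1(1)] XY(1)] lcu_terms.lcu_depth_le[OF lcu_terms_normalized[OF K1(1)] XY(2)]
      R[OF K1(1)] by linarith+
  moreover have "snd x \<le> (K - 1) * (2 * R + 1) + ((K - 1) + 1) * P" by (rule run_state_depth[OF R P K1(2) x])
  moreover have "K * (2 * R + 1) = (K - 1) * (2 * R + 1) + (2 * R + 1)" "(K - 1) + 1 = K" using K by (cases K, auto)+
  ultimately show "snd y \<le> K * (2 * R + 1) + K * P" unfolding yeq by simp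
qed

lemma finite_coherent_run:
  assumes A: "hermitian_mat s A" and \<rho>: "qstate s \<rho>"
  shows "finite (set_pmf (coherent_run M K \<rho> A r q))"
proof -
  have K1: "K \<in> {1..K}" "K - 1 < K" using K by auto
  have fin: "finite (set_pmf (final_outcome A x X Y))"
    if "x \<in> set_pmf (run_state M \<rho> r q (K - 1))" "X \<in> set_pmf (sample K)" "Y \<in> set_pmf (sample K)" for x X Y
    using final_outcome_properties(1)[OF A run_state_qstate[OF \<rho> K1(2) that(1)]] set_sample[OF K1(1)] that by auto
  show ?thesis unfolding coherent_run_eq
    by (intro finite_bind_pmf finite_run_state[OF K1(2)] finite_sample[OF K1(1)]) (use fin in simp)
qed

lemma linear_functional_trace:
  assumes A: "A \<in> carrier_mat s s"
  shows "linear_functional D (\<lambda>B. mat_trace (A * ptrace_last s e B))"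
  unfolding linear_functional_def dims(4)
  using mult_add_distrib_mat[OF A ptrace_last_carrier ptrace_last_carrier]
    mat_trace_add[OF mult_carrier_mat[OF A ptrace_last_carrier] mult_carrier_mat[OF A ptrace_last_carrier]]
    mult_smult_distrib[OF A ptrace_last_carrier] mat_trace_smult[OF mult_carrier_mat[OF A ptrace_last_carrier]]
  by (simp add: ptrace_last_add ptrace_last_smult)

text \<open>Each off-diagonal block contributes one half of the chain value divided by the product
  of the squared weights; the two halves add up, and the square of \<open>lcu_zeta\<close> cancels
  the product.\<close>

theorem coherent_run_mean:
  assumes A: "hermitian_mat s A" and \<rho>: "qstate s \<rho>"
  shows "complex_of_real ((lcu_zeta M K r q)\<^sup>2 * measure_pmf.expectation (coherent_run M K \<rho> A r q) fst)
    = chain_value M K approx \<rho> A"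
proof -
  have K1: "K \<in> {1..K}" "K - 1 < K" using K by auto
  have Ac: "A \<in> carrier_mat s s" using A by (auto simp: hermitian_mat_def)
  let ?\<psi> = "\<lambda>B. mat_trace (A * ptrace_last s e B)"
  let ?S = "run_state M \<rho> r q (K - 1)"
  let ?E = "\<lambda>a b x. measure_pmf.expectation (sample K) (\<lambda>X. measure_pmf.expectation (sample K) (\<lambda>Y.
      ?\<psi> (ancilla_block D a b (interact M K (r K) X Y (fst x)))))"
  let ?w = "complex_of_real (1 / (weight K)\<^sup>2)"
  let ?c = "complex_of_real (1 / 2 * (\<Prod>i=1..K - 1. 1 / (weight i)\<^sup>2))"
  have \<psi>: "linear_functional D ?\<psi>" by (rule linear_functional_trace[OF Ac])
  have \<psi>': "linear_functional D (\<lambda>B. ?\<psi> (conj_by (approx K) B))"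
    by (rule linear_functional_conj_by[OF coll_approx_carrier[OF K1(1)] \<psi>])
  have st: "qstate (2 * D) (fst x)" if "x \<in> set_pmf ?S" for x using run_state_qstate[OF \<rho> K1(2) that] .
  have int: "integrable (measure_pmf (sample K)) g" for g :: "lcu_block list \<Rightarrow> complex"
    by (rule integrable_measure_pmf_finite[OF finite_sample[OF K1(1)]])
  have intS: "integrable (measure_pmf ?S) g" for g :: "complex mat \<times> nat \<Rightarrow> complex"
    by (rule integrable_measure_pmf_finite[OF finite_run_state[OF K1(2)]])
  have half: "measure_pmf.expectation ?S (?E a b) = ?w * (?c * chain_value M K approx \<rho> A)"
    if ab: "(a, b) = (0, 1) \<or> (a, b) = (1, 0)" for a b
  proof -
    have "measure_pmf.expectation ?S (?E a b)
        = measure_pmf.expectation ?S (\<lambda>x. ?w * ?\<psi> (conj_by (approx K) (ancilla_block D a b (fst x))))"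
      by (intro expectation_pmf_cong expectation_interact[OF K1(1) \<psi> qstate_carrier[OF st] ab])
    also have "\<dots> = ?w * measure_pmf.expectation ?S (\<lambda>x. ?\<psi> (conj_by (approx K) (ancilla_block D a b (fst x))))"
      by (rule integral_mult_right_zero)
    also have "measure_pmf.expectation ?S (\<lambda>x. ?\<psi> (conj_by (approx K) (ancilla_block D a b (fst x)))) = ?c * chain_value M K approx \<rho> A"
      unfolding chain_value_def by (rule expectation_run_state[OF \<rho> K1(2) \<psi>' ab])
    finally show ?thesis .
  qed
  have "complex_of_real (measure_pmf.expectation (coherent_run M K \<rho> A r q) fst)
      = measure_pmf.expectation (coherent_run M K \<rho> A r q) (\<lambda>y. complex_of_real (fst y))"
    by (rule integral_complex_of_real[symmetric])
  also have "\<dots> = measure_pmf.expectation ?S (\<lambda>x. measure_pmf.expectation (sample K) (\<lambda>X. measure_pmf.expectation (sample K) (\<lambda>Y.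
      measure_pmf.expectation (final_outcome A x X Y) (\<lambda>\<mu>. complex_of_real \<mu>))))"
  proof -
    have fin: "finite (set_pmf (final_outcome A x X Y))"
      if "x \<in> set_pmf ?S" "X \<in> set_pmf (sample K)" "Y \<in> set_pmf (sample K)" for x X Y
      using final_outcome_properties(1)[OF A st[OF that(1)]] set_sample[OF K1(1)] that by auto
    show ?thesis
      unfolding coherent_run_eq
      \<comment> \<open>The tower rule is applied to the state and to each of the two samples; every
        application has to be supplied with finite supports.\<close>
      by (subst expectation_bind_pmf_finite, rule finite_run_state[OF K1(2)],
          (intro finite_bind_pmf finite_sample[OF K1(1)]; use fin in simp),
          rule expectation_pmf_cong,
          subst expectation_bind_pmf_finite, rule finite_sample[OF K1(1)],
          (intro finite_bind_pmf finite_sample[OF K1(1)]; use fin in simp),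
          rule expectation_pmf_cong,
          subst expectation_bind_pmf_finite, rule finite_sample[OF K1(1)], use fin in simp, simp)
  qed
  also have "\<dots> = measure_pmf.expectation ?S (\<lambda>x. measure_pmf.expectation (sample K) (\<lambda>X. measure_pmf.expectation (sample K) (\<lambda>Y.
      ?\<psi> (ancilla_block D 0 1 (interact M K (r K) X Y (fst x))) + ?\<psi> (ancilla_block D 1 0 (interact M K (r K) X Y (fst x))))))"
    using set_sample[OF K1(1)] by (intro expectation_pmf_cong final_outcome_properties(3)[OF A st]) auto
  also have "\<dots> = measure_pmf.expectation ?S (\<lambda>x. ?E 0 1 x + ?E 1 0 x)"
    by (simp only: Bochner_Integration.integral_add[OF int int])
  also have "\<dots> = measure_pmf.expectation ?S (?E 0 1) + measure_pmf.expectation ?S (?E 1 0)"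
    by (rule Bochner_Integration.integral_add[OF intS intS])
  also have "\<dots> = ?w * (?c * chain_value M K approx \<rho> A) + ?w * (?c * chain_value M K approx \<rho> A)"
    by (intro arg_cong2[of _ _ _ _ "(+)"] half) auto
  also have "\<dots> = complex_of_real (\<Prod>i=1..K. 1 / (weight i)\<^sup>2) * chain_value M K approx \<rho> A"
  proof -
    obtain k where k: "K = Suc k" using K by (cases K) auto
    have "(\<Prod>i=1..K. 1 / (weight i)\<^sup>2) = (\<Prod>i=1..K - 1. 1 / (weight i)\<^sup>2) * (1 / (weight K)\<^sup>2)"
      unfolding k by simp
    moreover have "x * (1 / 2 * y) + x * (1 / 2 * y) = y * x" for x y :: real by simp
    ultimately have "1 / (weight K)\<^sup>2 * (1 / 2 * (\<Prod>i=1..K - 1. 1 / (weight i)\<^sup>2))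
        + 1 / (weight K)\<^sup>2 * (1 / 2 * (\<Prod>i=1..K - 1. 1 / (weight i)\<^sup>2)) = (\<Prod>i=1..K. 1 / (weight i)\<^sup>2)"
      by (simp only:)
    then have "?w * ?c + ?w * ?c = complex_of_real (\<Prod>i=1..K. 1 / (weight i)\<^sup>2)"
      unfolding of_real_mult[symmetric] of_real_add[symmetric] by (rule arg_cong)
    then show ?thesis by (simp only: mult.assoc[symmetric] distrib_right[symmetric])
  qed
  finally have mean: "complex_of_real (measure_pmf.expectation (coherent_run M K \<rho> A r q) fst)
      = complex_of_real (\<Prod>i=1..K. 1 / (weight i)\<^sup>2) * chain_value M K approx \<rho> A" .
  have "(lcu_zeta M K r q)\<^sup>2 * (\<Prod>i=1..K. 1 / (weight i)\<^sup>2) = (\<Prod>i=1..K. (weight i)\<^sup>2 * (1 / (weight i)\<^sup>2))"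
    by (simp only: lcu_zeta_def prod_power_distrib prod.distrib)
  also have "\<dots> = 1"
  proof (intro prod.neutral ballI)
    fix i assume "i \<in> {1..K}"
    then have "weight i \<noteq> 0" using weight_bounds(1)[of i] by auto
    then show "(weight i)\<^sup>2 * (1 / (weight i)\<^sup>2) = 1" by simp
  qed
  finally have zeta: "(lcu_zeta M K r q)\<^sup>2 * (\<Prod>i=1..K. 1 / (weight i)\<^sup>2) = 1" .
  show ?thesis unfolding of_real_mult mean mult.assoc[symmetric]
    unfolding of_real_mult[symmetric] zeta by simp
qed

end

section \<open>Concentration and asymptotics\<close>

lemma finite_replicate_pmf: "finite (set_pmf P) \<Longrightarrow> finite (set_pmf (replicate_pmf n P))"
  by (induction n) (auto simp: set_bind_pmf)

text \<open>Independence in the form that Chernoff's method needs: the moment generating function of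
  the sum is a power.\<close>

lemma expectation_replicate_pmf_exp:
  fixes f :: "'a \<Rightarrow> real"
  assumes fin: "finite (set_pmf P)"
  shows "measure_pmf.expectation (replicate_pmf n P) (\<lambda>xs. exp (l * sum_list (map f xs)))
    = (measure_pmf.expectation P (\<lambda>x. exp (l * f x))) ^ n"
proof (induction n)
  case (Suc n)
  let ?R = "replicate_pmf n P"
  have "measure_pmf.expectation (replicate_pmf (Suc n) P) (\<lambda>xs. exp (l * sum_list (map f xs)))
      = measure_pmf.expectation P (\<lambda>x. measure_pmf.expectation ?R (\<lambda>xs. exp (l * f x) * exp (l * sum_list (map f xs))))"
    using fin finite_replicate_pmf[OF fin, of n]
    by (simp add: expectation_bind_pmf_finite set_bind_pmf exp_add distrib_left)
  also have "\<dots> = measure_pmf.expectation P (\<lambda>x. exp (l * f x) * measure_pmf.expectation ?R (\<lambda>xs. exp (l * sum_list (map f xs))))"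
    by simp
  finally show ?case by (simp add: Suc.IH)
qed simp

lemma hoeffding_replicate_pmf_upper:
  fixes f :: "'a \<Rightarrow> real"
  assumes fin: "finite (set_pmf P)" and f: "\<And>x. x \<in> set_pmf P \<Longrightarrow> \<bar>f x\<bar> \<le> c" and c: "0 < c" and t: "0 < t"
  shows "measure_pmf.prob (replicate_pmf n P) {xs. real n * (measure_pmf.expectation P f + t) \<le> sum_list (map f xs)}
    \<le> exp (- (real n * t\<^sup>2 / (2 * c\<^sup>2)))"
proof -
  let ?\<mu> = "measure_pmf.expectation P f"
  let ?R = "replicate_pmf n P"
  \<comment> \<open>The minimiser of l^2 c^2 / 2 - l t, the exponent per run at the end of the
    proof.\<close>
  define l where "l = t / c\<^sup>2"
  have l: "0 < l" using t c by (simp add: l_def)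
  have int: "integrable (measure_pmf P) g" for g :: "'a \<Rightarrow> real" by (rule integrable_measure_pmf_finite[OF fin])
  have intR: "integrable (measure_pmf ?R) g" for g :: "'a list \<Rightarrow> real"
    by (rule integrable_measure_pmf_finite[OF finite_replicate_pmf[OF fin]])
  interpret interval_bounded_random_variable "measure_pmf P" f "- c" c
    by unfold_locales (use f in \<open>auto simp: AE_measure_pmf_iff abs_le_iff minus_le_iff\<close>)
  have "ennreal (measure_pmf.expectation P (\<lambda>x. exp (l * (f x - ?\<mu>)))) = (\<integral>\<^sup>+ x. exp (l * (f x - ?\<mu>)) \<partial>measure_pmf P)"
    by (rule nn_integral_eq_integral[symmetric, OF int]) simp
  also have "\<dots> \<le> ennreal (exp (l\<^sup>2 * (c - - c)\<^sup>2 / 8))" by (rule Hoeffdings_lemma_nn_integral[OF l])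
  finally have "measure_pmf.expectation P (\<lambda>x. exp (l * (f x - ?\<mu>))) \<le> exp (l\<^sup>2 * (c - - c)\<^sup>2 / 8)"
    by (simp add: ennreal_le_iff)
  also have "l\<^sup>2 * (c - - c)\<^sup>2 / 8 = l\<^sup>2 * c\<^sup>2 / 2" by (simp add: power2_eq_square)
  finally have centered: "measure_pmf.expectation P (\<lambda>x. exp (l * (f x - ?\<mu>))) \<le> exp (l\<^sup>2 * c\<^sup>2 / 2)" .
  have "measure_pmf.expectation P (\<lambda>x. exp (l * f x)) = measure_pmf.expectation P (\<lambda>x. exp (l * ?\<mu>) * exp (l * (f x - ?\<mu>)))"
    by (simp add: algebra_simps flip: exp_add)
  also have "\<dots> = exp (l * ?\<mu>) * measure_pmf.expectation P (\<lambda>x. exp (l * (f x - ?\<mu>)))" by simp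
  also have "\<dots> \<le> exp (l * ?\<mu>) * exp (l\<^sup>2 * c\<^sup>2 / 2)" using centered by (intro mult_left_mono) auto
  finally have mgf: "measure_pmf.expectation P (\<lambda>x. exp (l * f x)) \<le> exp (l * ?\<mu> + l\<^sup>2 * c\<^sup>2 / 2)" by (simp add: exp_add)
  let ?A = "{xs. real n * (?\<mu> + t) \<le> sum_list (map f xs)}"
  have "measure_pmf.prob ?R ?A = measure_pmf.expectation ?R (indicator ?A)" by simp
  \<comment> \<open>Markov's inequality in exponential form: the indicator of the event lies below
    the tilted exponential.\<close>
  also have "\<dots> \<le> measure_pmf.expectation ?R (\<lambda>xs. exp (- (l * (real n * (?\<mu> + t)))) * exp (l * sum_list (map f xs)))"
  proof (rule integral_mono[OF intR intR])
    fix xs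
    show "indicator ?A xs \<le> exp (- (l * (real n * (?\<mu> + t)))) * exp (l * sum_list (map f xs))"
    proof (cases "xs \<in> ?A")
      case True
      then have "l * (real n * (?\<mu> + t)) \<le> l * sum_list (map f xs)" using l by (intro mult_left_mono) auto
      then have "1 \<le> exp (- (l * (real n * (?\<mu> + t))) + l * sum_list (map f xs))" by simp
      then have "1 \<le> exp (- (l * (real n * (?\<mu> + t)))) * exp (l * sum_list (map f xs))" by (simp only: exp_add)
      then show ?thesis using True by simp
    qed simp
  qed
  also have "\<dots> = exp (- (l * (real n * (?\<mu> + t)))) * (measure_pmf.expectation P (\<lambda>x. exp (l * f x))) ^ n"
    by (simp add: expectation_replicate_pmf_exp[OF fin])
  also have "\<dots> \<le> exp (- (l * (real n * (?\<mu> + t)))) * exp (l * ?\<mu> + l\<^sup>2 * c\<^sup>2 / 2) ^ n"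
    using mgf by (intro mult_left_mono power_mono Bochner_Integration.integral_nonneg) auto
  also have "\<dots> = exp (- (l * (real n * (?\<mu> + t))) + real n * (l * ?\<mu> + l\<^sup>2 * c\<^sup>2 / 2))"
    by (simp only: exp_of_nat_mult exp_add)
  also have "- (l * (real n * (?\<mu> + t))) + real n * (l * ?\<mu> + l\<^sup>2 * c\<^sup>2 / 2) = real n * (l\<^sup>2 * c\<^sup>2 / 2 - l * t)"
    by (simp add: algebra_simps)
  also have "l\<^sup>2 * c\<^sup>2 / 2 - l * t = - (t\<^sup>2 / (2 * c\<^sup>2))"
    using c by (simp add: l_def power2_eq_square field_simps)
  finally show ?thesis by simp
qed

lemma hoeffding_replicate_pmf:
  fixes f :: "'a \<Rightarrow> real"
  assumes fin: "finite (set_pmf P)" and f: "\<And>x. x \<in> set_pmf P \<Longrightarrow> \<bar>f x\<bar> \<le> c" and c: "0 < c" and t: "0 < t" and n: "0 < n"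
  shows "measure_pmf.prob (replicate_pmf n P) {xs. t \<le> \<bar>sum_list (map f xs) / real n - measure_pmf.expectation P f\<bar>}
    \<le> 2 * exp (- (real n * t\<^sup>2 / (2 * c\<^sup>2)))"
proof -
  let ?A = "\<lambda>f. {xs. real n * (measure_pmf.expectation P f + t) \<le> sum_list (map f xs)}"
  have neg: "sum_list (map (\<lambda>x. - f x) xs) = - sum_list (map f xs)" for xs by (induction xs) auto
  \<comment> \<open>The lower tail is the upper tail of the negated variable.\<close>
  have "{xs. t \<le> \<bar>sum_list (map f xs) / real n - measure_pmf.expectation P f\<bar>} \<subseteq> ?A f \<union> ?A (\<lambda>x. - f x)"
    using n by (auto simp: neg field_simps abs_if split: if_splits)
  then have "measure_pmf.prob (replicate_pmf n P) {xs. t \<le> \<bar>sum_list (map f xs) / real n - measure_pmf.expectation P f\<bar>}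
      \<le> measure_pmf.prob (replicate_pmf n P) (?A f \<union> ?A (\<lambda>x. - f x))"
    by (intro measure_pmf.finite_measure_mono) auto
  also have "\<dots> \<le> measure_pmf.prob (replicate_pmf n P) (?A f) + measure_pmf.prob (replicate_pmf n P) (?A (\<lambda>x. - f x))"
    by (rule measure_Un_le) auto
  also have "\<dots> \<le> exp (- (real n * t\<^sup>2 / (2 * c\<^sup>2))) + exp (- (real n * t\<^sup>2 / (2 * c\<^sup>2)))"
    using f by (intro add_mono hoeffding_replicate_pmf_upper[OF fin _ c t]) auto
  finally show ?thesis by simp
qed

text \<open>The quotient m^m / m! is a single term of the series of exp m. This weak form of
  Stirling's formula is all that is needed.\<close>

lemma power_le_fact_exp: "real m ^ m \<le> fact m * exp (real m)"
proof -
  have "(\<Sum>k\<in>{m}. real m ^ k /\<^sub>R fact k) \<le> (\<Sum>k. real m ^ k /\<^sub>R fact k)"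
    by (rule sum_le_suminf[OF summable_exp_generic]) auto
  then have "real m ^ m / fact m \<le> exp (real m)" by (simp add: exp_def divide_inverse mult.commute)
  then show ?thesis by (simp add: pos_divide_le_eq mult.commute)
qed

text \<open>Inverts the factorial up to constants. The factor 3 is the one that will relate Z to the
  precision of the series; the lower bound 1 on the quotient of logarithms lets additive constants
  be absorbed into it.\<close>

lemma factorial_order:
  "\<exists>c>0. \<forall>y\<ge>c. 1 \<le> ln y / ln (ln y) \<and>
     (\<exists>m. 3 * y \<le> fact (2 * m + 2) \<and> real (2 * m) \<le> 10 * (ln y / ln (ln y)))"
proof -
  \<comment> \<open>The factorial of m is at least exp(m (ln m - 1)). For m close to z this exponent
    grows like 4 ln y, which leaves ample room above ln (3 y).\<close>
  let ?z = "\<lambda>y. 4 * (ln y / ln (ln y)) :: real"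
  have "eventually (\<lambda>y::real. ln (3 * y) \<le> ?z y * (ln (?z y) - 1)) at_top" by real_asymp
  moreover have "eventually (\<lambda>y::real. 1 \<le> ln (?z y)) at_top" by real_asymp
  moreover have "eventually (\<lambda>y::real. 1 \<le> ln y / ln (ln y)) at_top" by real_asymp
  ultimately have "eventually (\<lambda>y::real. ln (3 * y) \<le> ?z y * (ln (?z y) - 1) \<and> 1 \<le> ln (?z y) \<and> 1 \<le> ln y / ln (ln y)) at_top"
    by eventually_elim auto
  then obtain c where c: "\<And>y. c \<le> y \<Longrightarrow> ln (3 * y) \<le> ?z y * (ln (?z y) - 1) \<and> 1 \<le> ln (?z y) \<and> 1 \<le> ln y / ln (ln y)"
    unfolding eventually_at_top_linorder by blast
  show ?thesis
  proof (intro exI[of _ "max c 1"] conjI allI impI)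
    fix y :: real assume y: "max c 1 \<le> y"
    then have y0: "0 < y" and cy: "ln (3 * y) \<le> ?z y * (ln (?z y) - 1)" "1 \<le> ln (?z y)" "1 \<le> ln y / ln (ln y)"
      using c[of y] by auto
    show "1 \<le> ln y / ln (ln y)" by (rule cy)
    define z where "z = ?z y"
    define m where "m = nat \<lceil>z\<rceil>"
    have z: "4 \<le> z" using cy(3) by (simp add: z_def)
    then have m: "z \<le> real m" "real m \<le> z + 1" by (auto simp: m_def)
    have m0: "0 < real m" using m z by linarith
    have "ln (3 * y) \<le> z * (ln z - 1)" using cy(1) by (simp add: z_def)
    also have "\<dots> \<le> real m * (ln (real m) - 1)"
    proof (rule mult_mono)
      show "ln z - 1 \<le> ln (real m) - 1" using m z by simp
      show "0 \<le> ln z - 1" using cy(2) by (simp add: z_def)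
    qed (use m z in auto)
    finally have "exp (ln (3 * y)) \<le> exp (real m * (ln (real m) - 1))" by simp
    moreover have "exp (ln (3 * y)) = 3 * y" using y0 by simp
    moreover have "exp (real m * (ln (real m) - 1)) = real m ^ m / exp (real m)"
      using m0 by (simp add: right_diff_distrib exp_diff exp_of_nat_mult)
    moreover have "real m ^ m / exp (real m) \<le> fact m" using power_le_fact_exp[of m] by (simp add: pos_divide_le_eq)
    \<comment> \<open>Passing to the much larger factorial of 2m + 2 gives away only a constant
      factor in the order.\<close>
    moreover have "(fact m :: real) \<le> fact (2 * m + 2)" by (rule fact_mono) simp
    ultimately have fact: "3 * y \<le> fact (2 * m + 2)" by linarith
    \<comment> \<open>Doubling z + 1 gives 8 times the quotient plus 2, and the quotient is at least
      1.\<close>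
    have "real (2 * m) \<le> 10 * (ln y / ln (ln y))" using m(2) cy(3) by (simp add: z_def)
    with fact show "\<exists>m. 3 * y \<le> fact (2 * m + 2) \<and> real (2 * m) \<le> 10 * (ln y / ln (ln y))" by blast
  qed simp
qed

section \<open>Correctness and cost of the algorithm\<close>

context lcu_run
begin

text \<open>Outside the trivial case the error budget is 2/3 of \<epsilon> for the bias and 1/3 for
  the fluctuation.\<close>

lemma estimator_accuracy:
  assumes A: "hermitian_mat s A" and A0: "0 < spectral_norm A" and \<rho>: "density_mat s \<rho>"
    and \<epsilon>: "0 < \<epsilon>" "\<epsilon> < 1" and \<delta>: "0 < \<delta>" "\<delta> < 1"
    and valid: "\<And>j. j \<in> {1..K} \<Longrightarrow>
      spectral_norm (approx j - U j) \<le> \<epsilon> / (6 * real K * spectral_norm A)"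
    and zeta: "(lcu_zeta M K r q)\<^sup>2 \<le> 2"
    and T: "0 < T" "72 * ((spectral_norm A)\<^sup>2 * ln (2 / \<delta>) / \<epsilon>\<^sup>2) \<le> real T"
  shows "1 - \<delta> \<le> measure_pmf.prob (estimator_pmf M K \<rho> A r q T)
    {\<mu>. cmod (complex_of_real \<mu> - mat_trace (A * nm_collision_map M K \<rho>)) \<le> \<epsilon>}"
proof -
  let ?N = "spectral_norm A" and ?z = "(lcu_zeta M K r q)\<^sup>2" and ?P = "coherent_run M K \<rho> A r q"
  let ?\<eta> = "\<epsilon> / (6 * real K * ?N)"
  have \<rho>q: "qstate s \<rho>" by (rule density_mat_qstate[OF \<rho>])
  have Ac: "A \<in> carrier_mat s s" using A by (simp add: hermitian_mat_def)
  have Kpos: "0 < real K" using K by simp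
  have \<eta>: "0 \<le> ?\<eta>" using \<epsilon> A0 by simp
  have near: "l2_norm ((approx i - U i) *\<^sub>v v) \<le> ?\<eta> * l2_norm v" if i: "i \<in> {1..K}" and v: "v \<in> carrier_vec D" for i v
  proof -
    have "approx i - U i \<in> carrier_mat D D" using coll_approx_carrier[OF i] coll_unitary_carrier[OF i] by auto
    then have "l2_norm ((approx i - U i) *\<^sub>v v) \<le> spectral_norm (approx i - U i) * l2_norm v"
      using v by (rule l2_norm_le_spectral_norm)
    also have "\<dots> \<le> ?\<eta> * l2_norm v" using valid[OF i] by (intro mult_right_mono) auto
    finally show ?thesis .
  qed
  have exact: "mat_trace (A * nm_collision_map M K \<rho>) = chain_value M K U \<rho> A"
    by (rule nm_collision_map_chain[OF qstate_carrier[OF \<rho>q]])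
  have bias: "cmod (chain_value M K approx \<rho> A - chain_value M K U \<rho> A) \<le> ?N * ((1 + ?\<eta>) ^ (2 * K) - 1)"
    and size: "cmod (chain_value M K U \<rho> A) \<le> ?N"
    using chain_value_perturbation[where V = approx and \<eta> = ?\<eta>, OF \<rho>q coll_approx_carrier near \<eta> Ac] by auto
  have fin: "finite (set_pmf ?P)" by (rule finite_coherent_run[OF A \<rho>q])
  obtain R where R: "\<And>i. i \<in> {1..K} \<Longrightarrow> r i * (q i + 1) \<le> R"
    by (rule that[of "Max ((\<lambda>i. r i * (q i + 1)) ` {1..K})"]) (auto intro!: Max_ge)
  obtain Q where Q: "\<And>i. i \<in> {1..K} \<Longrightarrow> prep_depth M i \<le> Q"
    by (rule that[of "Max (prep_depth M ` {1..K})"]) (auto intro!: Max_ge)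
  have bound: "\<bar>fst y\<bar> \<le> ?N" if "y \<in> set_pmf ?P" for y
    by (rule coherent_run_support(1)[OF A \<rho>q R Q that])
  let ?g = "\<lambda>runs :: (real \<times> nat) list. ?z / real T * sum_list (map fst runs)"
  let ?good = "{\<mu>. cmod (complex_of_real \<mu> - mat_trace (A * nm_collision_map M K \<rho>)) \<le> \<epsilon>}"
  let ?Rep = "replicate_pmf T ?P"
  have est: "measure_pmf.prob (estimator_pmf M K \<rho> A r q T) ?good = measure_pmf.prob ?Rep (?g -` ?good)"
    by (simp add: estimator_pmf_def)
  have z0: "0 \<le> ?z" by simp
  show ?thesis
  proof (cases "?N \<le> \<epsilon> / 3")
    case True
    have "runs \<in> ?g -` ?good" if "runs \<in> set_pmf ?Rep" for runs
    proof -
      have runs: "set runs \<subseteq> set_pmf ?P" "length runs = T" using that by (auto simp: set_replicate_pmf)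
      have "\<bar>sum_list (map fst runs)\<bar> \<le> sum_list (map (\<lambda>y. \<bar>fst y\<bar>) runs)"
        using sum_list_abs[of "map fst runs"] by (simp add: o_def)
      also have "\<dots> \<le> sum_list (map (\<lambda>_. ?N) runs)" using runs bound by (intro sum_list_mono) auto
      also have "\<dots> = real T * ?N" using runs by (simp add: sum_list_triv)
      finally have S: "\<bar>sum_list (map fst runs)\<bar> \<le> real T * ?N" .
      have "\<bar>?g runs\<bar> = ?z / real T * \<bar>sum_list (map fst runs)\<bar>" using z0 by (simp add: abs_mult)
      also have "\<dots> \<le> ?z / real T * (real T * ?N)" using S z0 by (intro mult_left_mono) auto
      also have "\<dots> = ?z * ?N" using T by simp
      also have "\<dots> \<le> 2 * ?N" using zeta A0 by (intro mult_right_mono) auto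
      finally have "cmod (complex_of_real (?g runs)) \<le> 2 * ?N" by (simp only: norm_of_real)
      \<comment> \<open>The exact value is at most the norm of \<open>A\<close>, so the total error
        is at most three times that norm.\<close>
      then have "cmod (complex_of_real (?g runs) - chain_value M K U \<rho> A) \<le> 2 * ?N + ?N"
        using size by (intro order_trans[OF norm_triangle_ineq4] add_mono)
      then show ?thesis using True by (simp add: exact)
    qed
    then have "measure_pmf.prob ?Rep (?g -` ?good) = 1"
      by (intro measure_pmf.prob_eq_1[THEN iffD2]) (auto simp: AE_measure_pmf_iff)
    then show ?thesis using \<delta> est by simp
  next
    case False
    \<comment> \<open>This is 2 K times the precision of the series. In this case it is at most 1,
      so exp x - 1 is at most 2 x.\<close>
    let ?x = "\<epsilon> / (3 * ?N)"
    have x: "0 < ?x" "?x \<le> 1" using \<epsilon> A0 False by (auto simp: field_simps)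
    have "(1 + ?\<eta>) ^ (2 * K) \<le> exp ?\<eta> ^ (2 * K)" using \<eta> by (intro power_mono) (auto simp: exp_ge_add_one_self)
    also have "\<dots> = exp (real (2 * K) * ?\<eta>)" by (rule exp_of_nat_mult[symmetric])
    also have "real (2 * K) * ?\<eta> = ?x" using Kpos A0 by (simp add: field_simps)
    also have "exp ?x \<le> 1 + ?x + ?x\<^sup>2" using x by (intro exp_bound) auto
    also have "\<dots> \<le> 1 + 2 * ?x" using x mult_left_le[of ?x ?x] by (simp add: power2_eq_square)
    finally have "?N * ((1 + ?\<eta>) ^ (2 * K) - 1) \<le> ?N * (2 * ?x)" using A0 by (intro mult_left_mono) auto
    also have "\<dots> = 2 * \<epsilon> / 3" using A0 by simp
    finally have bias': "cmod (chain_value M K approx \<rho> A - chain_value M K U \<rho> A) \<le> 2 * \<epsilon> / 3" using bias by linarith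
    let ?E = "measure_pmf.expectation ?P fst"
    \<comment> \<open>The allowed deviation of the plain mean is only a sixth of \<epsilon>, because
      the rescaling may double it.\<close>
    let ?bad = "{runs :: (real \<times> nat) list. \<epsilon> / 6 \<le> \<bar>sum_list (map fst runs) / real T - ?E\<bar>}"
    have "- ?bad \<subseteq> ?g -` ?good"
    proof
      fix runs assume "runs \<in> - ?bad"
      then have dev: "\<bar>sum_list (map fst runs) / real T - ?E\<bar> \<le> \<epsilon> / 6" by simp
      have "?g runs - ?z * ?E = ?z * (sum_list (map fst runs) / real T - ?E)"
        by (simp add: right_diff_distrib)
      then have "\<bar>?g runs - ?z * ?E\<bar> = ?z * \<bar>sum_list (map fst runs) / real T - ?E\<bar>"
        by (simp only: abs_mult abs_of_nonneg[OF z0])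
      also have "\<dots> \<le> 2 * (\<epsilon> / 6)" using dev zeta z0 by (intro mult_mono) auto
      finally have "cmod (complex_of_real (?g runs - ?z * ?E)) \<le> \<epsilon> / 3" by (simp only: norm_of_real)
      then have "cmod (complex_of_real (?g runs) - chain_value M K approx \<rho> A) \<le> \<epsilon> / 3"
        unfolding coherent_run_mean[OF A \<rho>q, symmetric] of_real_diff .
      then have "cmod ((complex_of_real (?g runs) - chain_value M K approx \<rho> A)
          + (chain_value M K approx \<rho> A - chain_value M K U \<rho> A)) \<le> \<epsilon> / 3 + 2 * \<epsilon> / 3"
        using bias' by (intro order_trans[OF norm_triangle_ineq] add_mono)
      then show "runs \<in> ?g -` ?good" by (simp add: exact)
    qed
    then have "measure_pmf.prob ?Rep (- ?bad) \<le> measure_pmf.prob ?Rep (?g -` ?good)"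
      by (intro measure_pmf.finite_measure_mono) auto
    moreover have "measure_pmf.prob ?Rep (- ?bad) = 1 - measure_pmf.prob ?Rep ?bad"
      using measure_pmf.prob_compl[of ?bad ?Rep] by (simp add: Compl_eq_Diff_UNIV)
    moreover have "measure_pmf.prob ?Rep ?bad \<le> 2 * exp (- (real T * (\<epsilon> / 6)\<^sup>2 / (2 * ?N\<^sup>2)))"
      using \<epsilon> T by (intro hoeffding_replicate_pmf[OF fin bound A0]) auto
    \<comment> \<open>The factor 72 in the number of runs is 2 * 6^2, from the deviation
      \<epsilon>/6 and the 2 in the exponent of Hoeffding's bound.\<close>
    moreover have "2 * exp (- (real T * (\<epsilon> / 6)\<^sup>2 / (2 * ?N\<^sup>2))) \<le> \<delta>"
    proof -
      have "ln (2 / \<delta>) = (72 * (?N\<^sup>2 * ln (2 / \<delta>) / \<epsilon>\<^sup>2)) * (\<epsilon>\<^sup>2 / (72 * ?N\<^sup>2))"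
        using \<epsilon> A0 by simp
      also have "\<dots> \<le> real T * (\<epsilon>\<^sup>2 / (72 * ?N\<^sup>2))" using T(2) by (intro mult_right_mono) auto
      also have "\<dots> = real T * (\<epsilon> / 6)\<^sup>2 / (2 * ?N\<^sup>2)" by (simp add: power_divide)
      finally have "exp (- (real T * (\<epsilon> / 6)\<^sup>2 / (2 * ?N\<^sup>2))) \<le> exp (- ln (2 / \<delta>))" by simp
      also have "\<dots> = \<delta> / 2" using \<delta> by (simp add: exp_minus)
      finally show ?thesis by simp
    qed
    ultimately show ?thesis using est by linarith
  qed
qed

end

section \<open>Choice of the segment number, the truncation order and the number of runs\<close>

context collision
begin

lemma coll_tau_le: "j \<in> {1..K} \<Longrightarrow> coll_tau M j \<le> max_beta M K * coll_time M"
  unfolding coll_tau_def max_beta_def using coll_time_pos by (intro mult_right_mono Max_ge) auto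

text \<open>One pair of parameters serves all collisions, since the error bound is monotone in the
  evolution time, which is at most \<open>t\<close>.\<close>

lemma lcu_valid_const:
  fixes R m :: nat and t :: real
  assumes j: "j \<in> {1..K}" and t: "t = max_beta M K * coll_time M" and R: "t < real R" "t\<^sup>2 \<le> real R"
    and err: "2 * (t\<^sup>2 / real R) \<le> \<epsilon>' * fact (2 * m + 2)"
  shows "lcu_valid M j R (2 * m) \<epsilon>'"
proof -
  interpret lcu_terms D "normalized_terms M j" by (rule lcu_terms_normalized[OF j])
  have \<tau>: "0 < coll_tau M j" "coll_tau M j \<le> t" using coll_tau_pos[OF j] coll_tau_le[OF j] t by auto
  have R0: "0 < real R" using \<tau> R by linarith
  have sq: "(coll_tau M j)\<^sup>2 \<le> t\<^sup>2" using \<tau> by (intro power_mono) auto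
  have "spectral_norm (coll_approx M j R (2 * m) - U j) \<le> 2 * ((coll_tau M j)\<^sup>2 / real R) / fact (2 * m + 2)"
    unfolding coll_approx_def coll_unitary_def ham_normalized[OF j, symmetric]
    using \<tau> R R0 order_trans[OF sq R(2)] by (intro lcu_approx_error) auto
  also have "\<dots> \<le> 2 * (t\<^sup>2 / real R) / fact (2 * m + 2)"
    using sq R0 by (intro divide_right_mono mult_left_mono) auto
  also have "\<dots> \<le> \<epsilon>'" using err by (simp only: pos_divide_le_eq[OF fact_gt_zero])
  finally show ?thesis using \<tau> R R0 unfolding lcu_valid_def by (auto simp: divide_less_eq)
qed

text \<open>Each weight is at most exp(1/(4 K)), so the product of all K weights is at most
  exp(1/4), and exp(1/2) is at most 7/4.\<close>

lemma lcu_zeta_const: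
  fixes R :: nat and t :: real
  assumes t: "t = max_beta M K * coll_time M" and R: "t < real R" "4 * real K * t\<^sup>2 \<le> real R"
  shows "(lcu_zeta M K (\<lambda>_. R) q)\<^sup>2 \<le> 2"
proof -
  have "0 < coll_tau M 1" "coll_tau M 1 \<le> t" using coll_tau_pos[of 1] coll_tau_le[of 1] t K by auto
  then have R0: "0 < real R" using R by linarith
  interpret lcu_run M K "\<lambda>_. R" q by unfold_locales (use R0 in simp)
  have w: "1 \<le> coll_weight M j R (q j)" "coll_weight M j R (q j) \<le> exp (1 / (4 * real K))" if j: "j \<in> {1..K}" for j
  proof -
    show "1 \<le> coll_weight M j R (q j)" by (rule weight_bounds(1)[OF j])
    have "(coll_tau M j)\<^sup>2 \<le> t\<^sup>2" using coll_tau_pos[OF j] coll_tau_le[OF j] t by (intro power_mono) auto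
    then have "(coll_tau M j)\<^sup>2 / real R \<le> t\<^sup>2 / real R" using R0 by (intro divide_right_mono) auto
    also have "\<dots> \<le> 1 / (4 * real K)" using R R0 K by (simp add: field_simps)
    finally show "coll_weight M j R (q j) \<le> exp (1 / (4 * real K))"
      using weight_bounds(2)[OF j] by (meson exp_le_cancel_iff order_trans)
  qed
  have "lcu_zeta M K (\<lambda>_. R) q \<le> (\<Prod>j=1..K. exp (1 / (4 * real K)))"
    unfolding lcu_zeta_def using w by (intro prod_mono) force
  also have "\<dots> = exp (1 / 4)" using K by (simp flip: exp_of_nat_mult)
  finally have le: "lcu_zeta M K (\<lambda>_. R) q \<le> exp (1 / 4)" .
  have "0 \<le> lcu_zeta M K (\<lambda>_. R) q" unfolding lcu_zeta_def using w(1) by (intro prod_nonneg) force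
  then have "(lcu_zeta M K (\<lambda>_. R) q)\<^sup>2 \<le> (exp (1 / 4))\<^sup>2" using le by (intro power_mono)
  also have "\<dots> = exp (1 / 2)" by (simp add: power2_eq_square flip: exp_add)
  also have "\<dots> \<le> 1 + 1 / 2 + (1 / 2)\<^sup>2" by (rule exp_bound) auto
  finally show ?thesis by (simp add: power2_eq_square)
qed

text \<open>The assumption \<open>order\<close> is the content of \<open>factorial_order\<close> for
  a threshold \<open>c0\<close> obtained beforehand, so that no constant depends on the
  model.\<close>

lemma accuracy_and_cost:
  fixes c0 :: real
  assumes A: "hermitian_mat s A" and A0: "0 < spectral_norm A" and \<rho>: "density_mat s \<rho>"
    and \<epsilon>: "0 < \<epsilon>" "\<epsilon> < 1" and \<delta>: "0 < \<delta>" "\<delta> < 1"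
    and order: "\<And>y. c0 \<le> y \<Longrightarrow> 1 \<le> ln y / ln (ln y) \<and>
      (\<exists>m. 3 * y \<le> fact (2 * m + 2) \<and> real (2 * m) \<le> 10 * (ln y / ln (ln y)))"
    and \<epsilon>': "\<epsilon>' = \<epsilon> / (6 * real K * spectral_norm A)" and \<beta>: "\<beta> = max_beta M K" and \<Delta>t: "\<Delta>t = coll_time M"
    and N: "N = (spectral_norm A)\<^sup>2 * ln (2 / \<delta>) / \<epsilon>\<^sup>2"
    and Z: "Z = \<beta> * real K * spectral_norm A * \<Delta>t / \<epsilon>"
  shows "\<exists>(r :: nat \<Rightarrow> nat) (q :: nat \<Rightarrow> nat) (T :: nat).
      T \<ge> 1 \<and>
      (\<forall>j \<in> {1..K}. lcu_valid M j (r j) (q j) \<epsilon>' \<and>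
         (real (r j) / \<epsilon>' \<ge> max c0 1 \<longrightarrow>
            real (q j) \<le> 200 * (ln (real (r j) / \<epsilon>') / ln (ln (real (r j) / \<epsilon>'))))) \<and>
      measure_pmf.prob (estimator_pmf M K \<rho> A r q T)
        {\<mu>. cmod (complex_of_real \<mu> - mat_trace (A * nm_collision_map M K \<rho>)) \<le> \<epsilon>} \<ge> 1 - \<delta> \<and>
      (N \<ge> max c0 1 \<longrightarrow> real T \<le> 200 * N) \<and>
      (real K * (\<beta> * \<Delta>t)\<^sup>2 \<ge> max c0 1 \<and> Z \<ge> max c0 1 \<longrightarrow>
         (\<forall>(\<mu>, dep) \<in> set_pmf (coherent_run M K \<rho> A r q).
            real dep \<le> 200 * (\<beta>\<^sup>2 * (real K)\<^sup>2 * \<Delta>t\<^sup>2 * (ln Z / ln (ln Z))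
                              + real K * real (max_prep_depth M K))))"
proof -
  define t where "t = \<beta> * \<Delta>t"
  have t: "t = max_beta M K * coll_time M" by (simp add: t_def \<beta> \<Delta>t)
  have t0: "0 < t" using coll_tau_pos[of 1] coll_tau_le[of 1] t K by fastforce
  have K1: "1 \<le> real K" using K by simp
  have \<epsilon>'0: "0 < \<epsilon>'" using \<epsilon> A0 K1 by (simp add: \<epsilon>')
  have nat_ceiling: "real (nat \<lceil>x\<rceil>) \<le> x + 1" if "0 \<le> x" for x :: real
  proof -
    have "real (nat \<lceil>x\<rceil>) = real_of_int \<lceil>x\<rceil>" using that by simp
    then show ?thesis using of_int_ceiling_le_add_one[of x] by linarith
  qed
  \<comment> \<open>The final 1 makes t < R strict. Together with the two roundings it explains the
    3 in \<open>Rhigh\<close>.\<close>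
  define R where "R = nat \<lceil>4 * real K * t\<^sup>2\<rceil> + nat \<lceil>t\<rceil> + 1"
  have Rlow: "4 * real K * t\<^sup>2 + t + 1 \<le> real R"
    unfolding R_def of_nat_add of_nat_1
    using real_nat_ceiling_ge[of "4 * real K * t\<^sup>2"] real_nat_ceiling_ge[of t] by linarith
  have Rhigh: "real R \<le> 4 * real K * t\<^sup>2 + t + 3"
  proof -
    have "0 \<le> 4 * real K * t\<^sup>2" by simp
    then show ?thesis unfolding R_def of_nat_add of_nat_1
      using nat_ceiling[of "4 * real K * t\<^sup>2"] nat_ceiling[of t] t0 by linarith
  qed
  have Kt2: "0 \<le> 4 * real K * t\<^sup>2" by simp
  have R: "t < real R" "4 * real K * t\<^sup>2 \<le> real R" "1 \<le> real R" using Rlow t0 Kt2 by linarith+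
  have "1 * t\<^sup>2 \<le> (4 * real K) * t\<^sup>2" using K1 by (intro mult_right_mono) auto
  then have tR: "t\<^sup>2 \<le> real R" using R by linarith
  have tR1: "t\<^sup>2 / real R \<le> 1 / (4 * real K)" using R K1 by (simp add: field_simps)
  have tR2: "t\<^sup>2 / real R \<le> real R"
  proof -
    have "t\<^sup>2 / real R \<le> real R / real R" using tR R by (intro divide_right_mono) auto
    moreover have "real R / real R = 1" using R(3) by simp
    ultimately show ?thesis using R(3) by linarith
  qed
  define good where "good = (\<lambda>m. 2 * (t\<^sup>2 / real R) \<le> \<epsilon>' * fact (2 * m + 2))"
  define m where "m = (LEAST m. good m)"
  \<comment> \<open>The trivial bound n! \<ge> n already yields an admissible order.\<close>
  have ex: "\<exists>m. good m"
  proof -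
    define m where "m = nat \<lceil>2 * (t\<^sup>2 / real R) / \<epsilon>'\<rceil>"
    have "2 * (t\<^sup>2 / real R) / \<epsilon>' \<le> real m" by (simp add: m_def real_nat_ceiling_ge)
    also have "\<dots> \<le> real (2 * m + 2)" by simp
    also have "\<dots> \<le> fact (2 * m + 2)" using fact_ge_self[of "2 * m + 2"] by (metis of_nat_fact of_nat_le_iff)
    finally have "2 * (t\<^sup>2 / real R) \<le> fact (2 * m + 2) * \<epsilon>'" using \<epsilon>'0 by (simp only: pos_divide_le_eq)
    then show ?thesis by (auto simp: good_def mult.commute)
  qed
  have m: "good m" unfolding m_def using ex by (rule LeastI_ex)
  have m_le: "m \<le> m0" if "good m0" for m0 unfolding m_def using that by (rule Least_le)
  let ?r = "\<lambda>_ :: nat. R" and ?q = "\<lambda>_ :: nat. 2 * m"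
  \<comment> \<open>The added 1 keeps \<open>T\<close> positive; once N is at least 1, the total 72
    N + 2 lies below 200 N.\<close>
  define T where "T = nat \<lceil>72 * N\<rceil> + 1"
  have N0: "0 < N" using A0 \<epsilon> \<delta> by (simp add: N)
  have T: "0 < T" "72 * N \<le> real T" "real T \<le> 72 * N + 2"
  proof -
    show "0 < T" by (simp add: T_def)
    have "0 \<le> 72 * N" using N0 by simp
    then show "72 * N \<le> real T" "real T \<le> 72 * N + 2"
      unfolding T_def of_nat_add of_nat_1
      using real_nat_ceiling_ge[of "72 * N"] nat_ceiling[of "72 * N"] by linarith+
  qed
  have Rpos: "0 < R" using R by simp
  interpret lcu_run M K ?r ?q by unfold_locales (rule Rpos)
  have valid: "lcu_valid M j R (2 * m) \<epsilon>'" if "j \<in> {1..K}" for j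
    using m unfolding good_def by (rule lcu_valid_const[OF that t R(1) tR])
  have order_q: "real (2 * m) \<le> 200 * (ln (real R / \<epsilon>') / ln (ln (real R / \<epsilon>')))" if "max c0 1 \<le> real R / \<epsilon>'"
  proof -
    let ?y = "real R / \<epsilon>'"
    have "c0 \<le> ?y" using that by (simp only: max.bounded_iff)
    from order[OF this] obtain m0 where m0: "3 * ?y \<le> fact (2 * m0 + 2)" "real (2 * m0) \<le> 10 * (ln ?y / ln (ln ?y))" and y1: "1 \<le> ln ?y / ln (ln ?y)"
      by blast
    \<comment> \<open>Here the crude bound t^2 / R \<le> R suffices, and the factor 2 is raised to 3
      to match \<open>order\<close>.\<close>
    have "2 * (t\<^sup>2 / real R) \<le> 3 * real R" using tR2 R by linarith
    also have "\<dots> = \<epsilon>' * (3 * ?y)" using \<epsilon>'0 by simp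
    also have "\<dots> \<le> \<epsilon>' * fact (2 * m0 + 2)" using m0(1) \<epsilon>'0 by (intro mult_left_mono) auto
    finally have "m \<le> m0" by (intro m_le) (simp add: good_def)
    then have "real (2 * m) \<le> real (2 * m0)" by simp
    then show ?thesis using m0(2) y1 by linarith
  qed
  have prob: "measure_pmf.prob (estimator_pmf M K \<rho> A ?r ?q T)
        {\<mu>. cmod (complex_of_real \<mu> - mat_trace (A * nm_collision_map M K \<rho>)) \<le> \<epsilon>} \<ge> 1 - \<delta>"
    using valid lcu_zeta_const[OF t R(1,2)] T(1,2)
    by (intro estimator_accuracy[OF A A0 \<rho> \<epsilon> \<delta>]) (auto simp: lcu_valid_def \<epsilon>' N)
  have depth: "real dep \<le> 200 * (\<beta>\<^sup>2 * (real K)\<^sup>2 * \<Delta>t\<^sup>2 * (ln Z / ln (ln Z)) + real K * real (max_prep_depth M K))"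
    if large: "max c0 1 \<le> real K * t\<^sup>2" "max c0 1 \<le> Z" and run: "(\<mu>, dep) \<in> set_pmf (coherent_run M K \<rho> A ?r ?q)" for \<mu> dep
  proof -
    let ?F = "ln Z / ln (ln Z)"
    let ?P = "max_prep_depth M K"
    have "c0 \<le> Z" using large(2) by (simp only: max.bounded_iff)
    from order[OF this] obtain m0 where m0: "3 * Z \<le> fact (2 * m0 + 2)" "real (2 * m0) \<le> 10 * ?F" and F1: "1 \<le> ?F"
      by blast
    have big: "1 \<le> real K * t\<^sup>2" using large by simp
    \<comment> \<open>The number t alone may be small. Only K t \<ge> 1 is available, and it is
      enough to bound t by K t^2.\<close>
    have "1 \<le> real K * (real K * t\<^sup>2)" using mult_mono[OF K1 big] by simp
    then have "1\<^sup>2 \<le> (real K * t)\<^sup>2" by (simp add: power2_eq_square mult_ac)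
    then have Kt: "1 \<le> real K * t" using K1 t0 by (intro power2_le_imp_le[of 1 "real K * t"]) auto
    have "1 * t \<le> (real K * t) * t" using Kt t0 by (intro mult_right_mono) auto
    then have tle: "t \<le> real K * t\<^sup>2" by (simp add: power2_eq_square mult.assoc)
    have R8: "real R \<le> 8 * (real K * t\<^sup>2)" using Rhigh tle big by linarith
    have Zeq: "\<epsilon> * Z = real K * t * spectral_norm A" using \<epsilon> by (simp add: Z t_def mult_ac)
    \<comment> \<open>The left side is at most 1/(2 K). Multiplication by K t, which is at least 1,
      gives t/2, and this is exactly three times the product of the precision and Z; no R is
      left.\<close>
    have "2 * (t\<^sup>2 / real R) \<le> 2 * (1 / (4 * real K))" using tR1 by (intro mult_left_mono) auto
    also have "\<dots> \<le> 2 * (1 / (4 * real K)) * (real K * t)" using mult_left_mono[OF Kt, of "2 * (1 / (4 * real K))"] by simp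
    also have "\<dots> = \<epsilon>' * (3 * Z)"
    proof -
      have "\<epsilon>' * (3 * Z) = 3 * (\<epsilon> * Z) / (6 * real K * spectral_norm A)" by (simp add: \<epsilon>')
      also have "\<dots> = 2 * (1 / (4 * real K)) * (real K * t)" unfolding Zeq using A0 K1 by simp
      finally show ?thesis ..
    qed
    also have "\<dots> \<le> \<epsilon>' * fact (2 * m0 + 2)" using m0(1) \<epsilon>'0 by (intro mult_left_mono) auto
    finally have "m \<le> m0" by (intro m_le) (simp add: good_def)
    then have "real (2 * m) \<le> real (2 * m0)" by simp
    then have q11: "real (2 * m) + 1 \<le> 11 * ?F" using m0(2) F1 by linarith
    have "dep \<le> K * (2 * (R * (2 * m + 1)) + 1) + K * ?P"
      using coherent_run_support(2)[OF A density_mat_qstate[OF \<rho>], of "R * (2 * m + 1)" ?P "(\<mu>, dep)"] run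
      by (auto simp: max_prep_depth_def intro!: Max_ge)
    then have "real dep \<le> real (K * (2 * (R * (2 * m + 1)) + 1) + K * ?P)" by (simp only: of_nat_le_iff)
    also have "\<dots> = 2 * real K * (real R * (real (2 * m) + 1)) + real K + real K * real ?P"
      by (simp add: algebra_simps)
    finally have dep: "real dep \<le> 2 * real K * (real R * (real (2 * m) + 1)) + real K + real K * real ?P" .
    define F where "F = ?F"
    define G where "G = \<beta>\<^sup>2 * (real K)\<^sup>2 * \<Delta>t\<^sup>2 * F"
    have G: "G = real K * ((real K * t\<^sup>2) * F)" by (simp add: G_def t_def power2_eq_square mult_ac)
    \<comment> \<open>The gates account for 2 * 8 * 11 = 176. The swaps, at most K and hence at most
      G, and the preparations fit into 200.\<close>
    have "2 * real K * (real R * (real (2 * m) + 1)) \<le> 2 * real K * ((8 * (real K * t\<^sup>2)) * (11 * F))"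
      using R8 q11 K1 unfolding F_def by (intro mult_left_mono mult_mono) auto
    also have "\<dots> = 176 * G" by (simp add: G)
    finally have main: "2 * real K * (real R * (real (2 * m) + 1)) \<le> 176 * G" .
    have "1 \<le> (real K * t\<^sup>2) * F" using mult_mono[OF big F1] by (simp add: F_def)
    then have swaps: "real K \<le> G" using mult_left_mono[of 1 "(real K * t\<^sup>2) * F" "real K"] by (simp add: G)
    have "0 \<le> real K * real ?P" by simp
    then have "real dep \<le> 200 * (G + real K * real ?P)"
      using dep main swaps K1 unfolding distrib_left by linarith
    then show ?thesis by (simp only: G_def F_def)
  qed
  show ?thesis
    using T(1,3) valid order_q prob depth
    by (intro exI[of _ ?r] exI[of _ ?q] exI[of _ T]) (auto simp: t_def)
qed

end

text \<open>Both constants precede the model, hence are uniform in the number of qubits, K and all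
  other data. The accuracy holds without any largeness condition; only the bounds on the truncation
  order, on T and on the depth ask that their own parameters exceed \<open>c\<close>.\<close>

theorem theoremA3:
  shows "\<exists>C c :: real. C > 0 \<and> c > 0 \<and>
    (\<forall>(M :: collision_model) (K :: nat) (\<rho>\<^sub>S :: complex mat) (A :: complex mat) (\<epsilon> :: real) (\<delta> :: real).
      K \<ge> 1 \<longrightarrow> collision_model_wf K M \<longrightarrow> density_mat (sys_dim M) \<rho>\<^sub>S \<longrightarrow>
      hermitian_mat (sys_dim M) A \<longrightarrow> spectral_norm A > 0 \<longrightarrow>
      0 < \<epsilon> \<longrightarrow> \<epsilon> < 1 \<longrightarrow> 0 < \<delta> \<longrightarrow> \<delta> < 1 \<longrightarrow>
      (let \<epsilon>' = \<epsilon> / (6 * real K * spectral_norm A);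
           \<beta> = max_beta M K;
           \<Delta>t = coll_time M;
           N = (spectral_norm A)\<^sup>2 * ln (2 / \<delta>) / \<epsilon>\<^sup>2;
           Z = \<beta> * real K * spectral_norm A * \<Delta>t / \<epsilon>
       in \<exists>(r :: nat \<Rightarrow> nat) (q :: nat \<Rightarrow> nat) (T :: nat).
            T \<ge> 1 \<and>
            (\<forall>j \<in> {1..K}. lcu_valid M j (r j) (q j) \<epsilon>' \<and>
               (real (r j) / \<epsilon>' \<ge> c \<longrightarrow>
                  real (q j) \<le> C * (ln (real (r j) / \<epsilon>') / ln (ln (real (r j) / \<epsilon>'))))) \<and>
            measure_pmf.prob (estimator_pmf M K \<rho>\<^sub>S A r q T)
              {\<mu>. cmod (complex_of_real \<mu> - mat_trace (A * nm_collision_map M K \<rho>\<^sub>S)) \<le> \<epsilon>} \<ge> 1 - \<delta> \<and>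
            (N \<ge> c \<longrightarrow> real T \<le> C * N) \<and>
            (real K * (\<beta> * \<Delta>t)\<^sup>2 \<ge> c \<and> Z \<ge> c \<longrightarrow>
               (\<forall>(\<mu>, dep) \<in> set_pmf (coherent_run M K \<rho>\<^sub>S A r q).
                  real dep \<le> C * (\<beta>\<^sup>2 * (real K)\<^sup>2 * \<Delta>t\<^sup>2 * (ln Z / ln (ln Z))
                                    + real K * real (max_prep_depth M K))))))"
proof -
  obtain c0 :: real where order: "\<And>y. c0 \<le> y \<Longrightarrow> 1 \<le> ln y / ln (ln y) \<and>
      (\<exists>m. 3 * y \<le> fact (2 * m + 2) \<and> real (2 * m) \<le> 10 * (ln y / ln (ln y)))"
    using factorial_order by blast
  show ?thesis
  proof (rule exI[of _ 200], rule exI[of _ "max c0 1"], intro conjI allI impI)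
    fix M :: collision_model and K :: nat and \<rho>\<^sub>S A :: "complex mat" and \<epsilon> \<delta> :: real
    assume *: "1 \<le> K" "collision_model_wf K M" "density_mat (sys_dim M) \<rho>\<^sub>S" "hermitian_mat (sys_dim M) A"
      "0 < spectral_norm A" "0 < \<epsilon>" "\<epsilon> < 1" "0 < \<delta>" "\<delta> < 1"
    interpret collision M K by unfold_locales (rule *)+
    show "let \<epsilon>' = \<epsilon> / (6 * real K * spectral_norm A);
           \<beta> = max_beta M K;
           \<Delta>t = coll_time M;
           N = (spectral_norm A)\<^sup>2 * ln (2 / \<delta>) / \<epsilon>\<^sup>2;
           Z = \<beta> * real K * spectral_norm A * \<Delta>t / \<epsilon>
       in \<exists>(r :: nat \<Rightarrow> nat) (q :: nat \<Rightarrow> nat) (T :: nat).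
            T \<ge> 1 \<and>
            (\<forall>j \<in> {1..K}. lcu_valid M j (r j) (q j) \<epsilon>' \<and>
               (real (r j) / \<epsilon>' \<ge> max c0 1 \<longrightarrow>
                  real (q j) \<le> 200 * (ln (real (r j) / \<epsilon>') / ln (ln (real (r j) / \<epsilon>'))))) \<and>
            measure_pmf.prob (estimator_pmf M K \<rho>\<^sub>S A r q T)
              {\<mu>. cmod (complex_of_real \<mu> - mat_trace (A * nm_collision_map M K \<rho>\<^sub>S)) \<le> \<epsilon>} \<ge> 1 - \<delta> \<and>
            (N \<ge> max c0 1 \<longrightarrow> real T \<le> 200 * N) \<and>
            (real K * (\<beta> * \<Delta>t)\<^sup>2 \<ge> max c0 1 \<and> Z \<ge> max c0 1 \<longrightarrow>
               (\<forall>(\<mu>, dep) \<in> set_pmf (coherent_run M K \<rho>\<^sub>S A r q).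
                  real dep \<le> 200 * (\<beta>\<^sup>2 * (real K)\<^sup>2 * \<Delta>t\<^sup>2 * (ln Z / ln (ln Z))
                                    + real K * real (max_prep_depth M K))))"
      unfolding Let_def
      by (rule accuracy_and_cost[OF *(4,5,3,6-9) order refl refl refl refl refl])
  qed auto
qed

end
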